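(* Let Standing Assumption 1 hold and let $\sigma\in C^1(\mathbb R)$. Fix $L\ge2$, an architecture $\mathcal R$, $\eta_1,\eta_2>0$ and $\alpha_{\mathcal R}>0$. If problem $(\mathcal P^\sigma_{\mathcal R})$ has at least one admissible pair, i.e. there is $\theta\in\mathcal R_{ad}$ for which an ensemble solution for $\mathcal F^\sigma_\theta$ exists, then $(\mathcal P^\sigma_{\mathcal R})$ admits a global minimizer $(\theta^*,\mathbf y_{\theta^*})\in\mathcal R_{ad}\times L^\infty_\mu(Y_0;W_\infty)$.
   Context: $I=[0,\infty)$, $W_\infty=\{y\in L^2(I;\mathbb R^n):\dot y\in L^2(I;\mathbb R^n)\}$ with norm $\|y\|_{W_\infty}=(\|y\|_{L^2}^2+\|\dot y\|_{L^2}^2)^{1/2}$; $C_\imath>0$ is a constant with $\sup_{t\ge0}|y(t)|\le C_\imath\|y\|_{W_\infty}$. Given $f:\mathbb R^n\to\mathbb R^n$, $B\in\mathbb R^{n\times m}$, positive semidefinite $Q$, $\beta>0$, problem $(P^{y_0}_\beta)$ is: minimize $J(y,u)=\frac12\int_0^\infty(|Qy|^2+\beta|u|^2)dt$ over $(y,u)\in W_\infty\times L^2(I;\mathbb R^m)$ with $\dot y=f(y)+Bu$, $y(0)=y_0$; the minimum is assumed attained. Standing Assumption 1: $Y_0\subset\mathbb R^n$ is compact with $0\in Y_0$, and (A.1) $f\in C^1$, $f(0)=0$, $Df$ Lipschitz on compact sets; (A.2) there exist an open neighbourhood $\mathcal N(Y_0)$ of $Y_0$ and $F^*:\mathcal N(Y_0)\to\mathbb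 R^m$, $F^*(0)=0$, such that for every $y_0\in\mathcal N(Y_0)$ the closed-loop system $\dot y=f(y)+BF^*(y)$, $y(0)=y_0$ has a unique solution $y^*(y_0)\in W_\infty$ and $(y^*(y_0),F^*(y^*(y_0)))$ minimizes $(P^{y_0}_\beta)$; (A.3) $y_0\mapsto y^*(y_0)$ is continuously Fréchet differentiable from $\mathcal N(Y_0)$ to $W_\infty$ and $\|y^*(y_0)\|_{W_\infty}\le M|y_0|$ for some $M>0$ and all $y_0\in\mathcal N(Y_0)$. Set $M_{Y_0}=M\max_{y_0\in Y_0}|y_0|$, $\widehat M=C_\imath M_{Y_0}$, $\mathcal Y_{ad}=\{y\in W_\infty:\|y\|_{W_\infty}\le2M_{Y_0}\}$; (A.4) $F^*$ extends to a $C^1$ map on $\bar B_{2\widehat M}(0)$ with Lipschitz derivative there. $\mathcal H$ is the set of operators $\mathcal F:\mathcal Y_{ad}\to L^2(I;\mathbb R^m)$, $\mathcal F(y)(t)=F(y(t))$, with $F:\bar B_{2\widehat M}(0)\to\mathbb R^m$ Lipschitz and $F(0)=0$. For $\mathcal F\in\mathcal H$: $a(\mathcal F)(y,y_0,\phi)=(\dot y-f(y)-B\mathcal F(y),\phi)_{L^2(I;\mathbb R^n)}+(y(0)-y_0)\cdot\phi(0)$. $(Y_0,\mathcal A,\mu)$ is a complete probability space; an ensemble solution for $\mathcal F$ is $\mathbf y\in L^\infty_\mu(Y_0;W_\infty)$ with $\|\mathbf y\|_{L^\infty_\mu(Y_0;W_\infty)}\le2M_{Y_0}$ and $\int_{Y_0}a(\mathcal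 F)(\mathbf y(y_0),y_0,\Phi(y_0))\,d\mu=0$ for all $\Phi\in L^2_\mu(Y_0;W_\infty)$; $j(\mathbf y,\mathcal F)=\int_{Y_0}J(\mathbf y(y_0),\mathcal F(\mathbf y(y_0)))\,d\mu$. Networks: architecture $(N_0,\dots,N_L)$, $N_0=n$, $N_L=m$; $\mathcal R=\prod_{i=1}^L(\mathbb R^{N_i\times N_{i-1}}\times\mathbb R^{N_i})$ with the Euclidean product norm; $\theta=(W_1,b_1,\dots,W_L,b_L)$; $f_{i,\theta}(x)=\sigma(W_ix+b_i)$ for $i<L$, $f_{L,\theta}(x)=W_Lx+b_L$, $\Psi_\theta=f_{L,\theta}\circ\dots\circ f_{1,\theta}$, $F^\sigma_\theta(x)=\Psi_\theta(x)-\Psi_\theta(0)$, $\mathcal F^\sigma_\theta\in\mathcal H$ its Nemytskii operator. $\mathcal R_{ad}=\{\theta:\|W_1\|_\infty\le\eta_1,\ |b_i|_\infty\le\eta_2,\ i=1,\dots,L\}$ (max norm and induced matrix norm). $\mathcal G_{\mathcal R}(\theta)=\alpha_{\mathcal R}\sum_{i=2}^L\|W_i\|^2$ (Frobenius) if $\theta\in\mathcal R_{ad}$ and $+\infty$ otherwise. Problem $(\mathcal P^\sigma_{\mathcal R})$: minimize $j(\mathbf y,\mathcal F^\sigma_\theta)+\mathcal G_{\mathcal R}(\theta)$ over $\theta\in\mathcal R$ and ensemble solutions $\mathbf y$ for $\mathcal F^\sigma_\theta$. *)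

theory Defs
  imports "HOL-Probability.Probability"
begin

text \<open>Elements of L2(I;R^k), represented by functions real => 'a (values for t<0 are irrelevant).\<close>
definition L2fun :: "(real \<Rightarrow> 'a::euclidean_space) \<Rightarrow> bool" where
  "L2fun y \<longleftrightarrow> set_borel_measurable lborel {0..} y \<and>
                set_integrable lborel {0..} (\<lambda>t. (norm (y t))\<^sup>2)"

text \<open>y has weak derivative v (in L2) on I: y is the (absolutely continuous) primitive of v.\<close>
definition has_Wderiv :: "(real \<Rightarrow> 'a::euclidean_space) \<Rightarrow> (real \<Rightarrow> 'a) \<Rightarrow> bool" where
  "has_Wderiv y v \<longleftrightarrow> L2fun v \<and>
     (\<forall>t\<ge>0. set_integrable lborel {0..t} v \<and> y t = y 0 + (LINT s:{0..t}|lborel. v s))"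

definition is_W :: "(real \<Rightarrow> 'a::euclidean_space) \<Rightarrow> bool" where
  "is_W y \<longleftrightarrow> L2fun y \<and> (\<exists>v. has_Wderiv y v)"

definition Wderiv :: "(real \<Rightarrow> 'a::euclidean_space) \<Rightarrow> (real \<Rightarrow> 'a)" where
  "Wderiv y = (SOME v. has_Wderiv y v)"

definition L2inner :: "(real \<Rightarrow> 'a::euclidean_space) \<Rightarrow> (real \<Rightarrow> 'a) \<Rightarrow> real" where
  "L2inner z w = (LINT t:{0..}|lborel. z t \<bullet> w t)"

definition Wnorm :: "(real \<Rightarrow> 'a::euclidean_space) \<Rightarrow> real" where
  "Wnorm y = sqrt ((LINT t:{0..}|lborel. (norm (y t))\<^sup>2) + (LINT t:{0..}|lborel. (norm (Wderiv y t))\<^sup>2))"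

definition state_sol ::
  "(real^'n \<Rightarrow> real^'n) \<Rightarrow> real^'m^'n \<Rightarrow> (real \<Rightarrow> real^'m) \<Rightarrow> real^'n \<Rightarrow> (real \<Rightarrow> real^'n) \<Rightarrow> bool" where
  "state_sol f B u y0 y \<longleftrightarrow> is_W y \<and>
     (\<forall>t\<ge>0. set_integrable lborel {0..t} (\<lambda>s. f (y s) + B *v u s) \<and>
             y t = y0 + (LINT s:{0..t}|lborel. f (y s) + B *v u s))"

definition Jcost :: "real^'n^'n \<Rightarrow> real \<Rightarrow> (real \<Rightarrow> real^'n) \<Rightarrow> (real \<Rightarrow> real^'m) \<Rightarrow> real" where
  "Jcost Q \<beta> y u = 1/2 * (LINT t:{0..}|lborel. (norm (Q *v y t))\<^sup>2 + \<beta> * (norm (u t))\<^sup>2)"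

definition is_opt ::
  "(real^'n \<Rightarrow> real^'n) \<Rightarrow> real^'m^'n \<Rightarrow> real^'n^'n \<Rightarrow> real \<Rightarrow> real^'n
     \<Rightarrow> (real \<Rightarrow> real^'n) \<Rightarrow> (real \<Rightarrow> real^'m) \<Rightarrow> bool" where
  "is_opt f B Q \<beta> y0 y u \<longleftrightarrow> is_W y \<and> L2fun u \<and> state_sol f B u y0 y \<and>
     (\<forall>y' u'. is_W y' \<and> L2fun u' \<and> state_sol f B u' y0 y' \<longrightarrow> Jcost Q \<beta> y u \<le> Jcost Q \<beta> y' u')"

definition psd :: "real^'n^'n \<Rightarrow> bool" where
  "psd Q \<longleftrightarrow> transpose Q = Q \<and> (\<forall>x. x \<bullet> (Q *v x) \<ge> 0)"

definition strongly_meas :: "'x measure \<Rightarrow> ('x \<Rightarrow> real \<Rightarrow> 'a::euclidean_space) \<Rightarrow> bool" where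
  "strongly_meas \<mu> Y \<longleftrightarrow>
     (\<exists>s :: nat \<Rightarrow> 'x \<Rightarrow> real \<Rightarrow> 'a.
        (\<forall>k. finite (s k ` space \<mu>) \<and> (\<forall>x\<in>space \<mu>. is_W (s k x)) \<and>
             (\<forall>v. s k -` {v} \<inter> space \<mu> \<in> sets \<mu>)) \<and>
        (AE x in \<mu>. (\<lambda>k. Wnorm (s k x - Y x)) \<longlonglongrightarrow> 0))"

definition L2W :: "'x measure \<Rightarrow> ('x \<Rightarrow> real \<Rightarrow> 'a::euclidean_space) \<Rightarrow> bool" where
  "L2W \<mu> \<Phi> \<longleftrightarrow> strongly_meas \<mu> \<Phi> \<and> (AE x in \<mu>. is_W (\<Phi> x)) \<and>
                 integrable \<mu> (\<lambda>x. (Wnorm (\<Phi> x))\<^sup>2)"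

definition aform ::
  "(real^'n \<Rightarrow> real^'n) \<Rightarrow> real^'m^'n \<Rightarrow> (real^'n \<Rightarrow> real^'m)
     \<Rightarrow> (real \<Rightarrow> real^'n) \<Rightarrow> real^'n \<Rightarrow> (real \<Rightarrow> real^'n) \<Rightarrow> real" where
  "aform f B F y y0 \<phi> = L2inner (\<lambda>t. Wderiv y t - f (y t) - B *v F (y t)) \<phi> + (y 0 - y0) \<bullet> \<phi> 0"

text \<open>Ensemble solution for the Nemytskii operator of F, with L^\<infinity> bound bnd (= 2 M_{Y0}).\<close>
definition ens_sol ::
  "(real^'n) measure \<Rightarrow> (real^'n \<Rightarrow> real^'n) \<Rightarrow> real^'m^'n \<Rightarrow> real \<Rightarrow> (real^'n \<Rightarrow> real^'m)
     \<Rightarrow> (real^'n \<Rightarrow> real \<Rightarrow> real^'n) \<Rightarrow> bool" where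
  "ens_sol \<mu> f B bnd F Y \<longleftrightarrow> strongly_meas \<mu> Y \<and>
     (AE y0 in \<mu>. is_W (Y y0) \<and> Wnorm (Y y0) \<le> bnd) \<and>
     (\<forall>\<Phi>. L2W \<mu> \<Phi> \<longrightarrow>
        integrable \<mu> (\<lambda>y0. aform f B F (Y y0) y0 (\<Phi> y0)) \<and>
        (\<integral>y0. aform f B F (Y y0) y0 (\<Phi> y0) \<partial>\<mu>) = 0)"

definition jcost ::
  "(real^'n) measure \<Rightarrow> real^'n^'n \<Rightarrow> real \<Rightarrow> (real^'n \<Rightarrow> real^'m) \<Rightarrow> (real^'n \<Rightarrow> real \<Rightarrow> real^'n) \<Rightarrow> real" where
  "jcost \<mu> Q \<beta> F Y = (\<integral>y0. Jcost Q \<beta> (Y y0) (\<lambda>t. F (Y y0 t)) \<partial>\<mu>)"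

text \<open>Parameters theta = (W_1,b_1, [(W_2,b_2),...,(W_{L-1},b_{L-1})], W_L, b_L).
  The architecture (N_0,...,N_L) with N_0 = n = CARD('n), N_L = m = CARD('m) is given by the
  list Ns = [N_1,...,N_{L-1}] of hidden widths. Hidden vectors are nat => real (index j < N_i);
  W_1 row j is a vector in R^n; W_L is indexed by output coordinate and hidden index.\<close>
record ('n::finite, 'm::finite) netparam =
  W1 :: "nat \<Rightarrow> real^'n"
  b1 :: "nat \<Rightarrow> real"
  mids :: "((nat \<Rightarrow> nat \<Rightarrow> real) \<times> (nat \<Rightarrow> real)) list"
  WL :: "'m \<Rightarrow> nat \<Rightarrow> real"
  bL :: "real^'m"

fun mid_eval :: "(real \<Rightarrow> real) \<Rightarrow> nat list \<Rightarrow> ((nat \<Rightarrow> nat \<Rightarrow> real) \<times> (nat \<Rightarrow> real)) list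
                  \<Rightarrow> (nat \<Rightarrow> real) \<Rightarrow> (nat \<Rightarrow> real)" where
  "mid_eval \<sigma> (p # q # Ns) ((W, b) # Ls) z =
     mid_eval \<sigma> (q # Ns) Ls (\<lambda>j. if j < q then \<sigma> ((\<Sum>k<p. W j k * z k) + b j) else 0)"
| "mid_eval \<sigma> _ _ z = z"

definition Psi :: "(real \<Rightarrow> real) \<Rightarrow> nat list \<Rightarrow> ('n::finite, 'm::finite) netparam \<Rightarrow> real^'n \<Rightarrow> real^'m" where
  "Psi \<sigma> Ns \<theta> x =
     (let z1 = (\<lambda>j. if j < hd Ns then \<sigma> (W1 \<theta> j \<bullet> x + b1 \<theta> j) else 0);
          z = mid_eval \<sigma> Ns (mids \<theta>) z1
      in \<chi> i. (\<Sum>k<last Ns. WL \<theta> i k * z k) + bL \<theta> $ i)"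

definition Fnet :: "(real \<Rightarrow> real) \<Rightarrow> nat list \<Rightarrow> ('n::finite, 'm::finite) netparam \<Rightarrow> real^'n \<Rightarrow> real^'m" where
  "Fnet \<sigma> Ns \<theta> x = Psi \<sigma> Ns \<theta> x - Psi \<sigma> Ns \<theta> 0"

definition in_R :: "nat list \<Rightarrow> ('n::finite, 'm::finite) netparam \<Rightarrow> bool" where
  "in_R Ns \<theta> \<longleftrightarrow> length (mids \<theta>) + 1 = length Ns \<and>
     (\<forall>j\<ge>hd Ns. W1 \<theta> j = 0 \<and> b1 \<theta> j = 0) \<and>
     (\<forall>l<length (mids \<theta>).
        (\<forall>j k. (Ns ! (l+1) \<le> j \<or> Ns ! l \<le> k) \<longrightarrow> fst (mids \<theta> ! l) j k = 0) \<and>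
        (\<forall>j\<ge>Ns ! (l+1). snd (mids \<theta> ! l) j = 0)) \<and>
     (\<forall>i k. last Ns \<le> k \<longrightarrow> WL \<theta> i k = 0)"

text \<open>\<R>_ad: induced max-norm of W_1 \<le> eta1, max-norm of every bias \<le> eta2.\<close>
definition in_Rad :: "nat list \<Rightarrow> real \<Rightarrow> real \<Rightarrow> ('n::finite, 'm::finite) netparam \<Rightarrow> bool" where
  "in_Rad Ns \<eta>1 \<eta>2 \<theta> \<longleftrightarrow> in_R Ns \<theta> \<and>
     Max ((\<lambda>j. \<Sum>i\<in>UNIV. \<bar>W1 \<theta> j $ i\<bar>) ` {..<hd Ns}) \<le> \<eta>1 \<and>
     (\<forall>j<hd Ns. \<bar>b1 \<theta> j\<bar> \<le> \<eta>2) \<and>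
     (\<forall>l<length (mids \<theta>). \<forall>j<Ns ! (l+1). \<bar>snd (mids \<theta> ! l) j\<bar> \<le> \<eta>2) \<and>
     (\<forall>i. \<bar>bL \<theta> $ i\<bar> \<le> \<eta>2)"

definition Greg :: "nat list \<Rightarrow> real \<Rightarrow> real \<Rightarrow> real \<Rightarrow> ('n::finite, 'm::finite) netparam \<Rightarrow> ereal" where
  "Greg Ns \<eta>1 \<eta>2 \<alpha> \<theta> =
     (if in_Rad Ns \<eta>1 \<eta>2 \<theta> then
        ereal (\<alpha> * ((\<Sum>l<length (mids \<theta>). \<Sum>j<Ns ! (l+1). \<Sum>k<Ns ! l. (fst (mids \<theta> ! l) j k)\<^sup>2)
                    + (\<Sum>i\<in>UNIV. \<Sum>k<last Ns. (WL \<theta> i k)\<^sup>2)))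
      else \<infinity>)"

end

theory Submission
  imports Defs "HOL-Library.Diagonal_Subsequence"
begin

text \<open>
  Direct method. Along a minimizing sequence the first layer and the biases are bounded by
  admissibility and the other weights by the regularizer, so a subsequence of the parameters
  converges and the feedback laws converge uniformly on the ball that contains all trajectories.
  Testing the weak formulation with indicator functions of measurable sets times cutoffs of
  constants shows that an ensemble solution solves, for almost every initial value, the closed-loop
  equation in integral form. By Gronwall's inequality these trajectories converge locally uniformly
  to a trajectory of the limit system. Fatou's lemma gives the norm bound for the limit and the
  lower semicontinuity of the cost.

  In general the convergence in \<open>W\<^sub>\<infinity>\<close> is only weak. The limit is nevertheless strongly
  measurable: if a trajectory is brought linearly to zero right after time \<open>T\<close>, the truncated
  trajectories converge in norm, the truncations of the limit converge in norm to the limit as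
  \<open>T \<rightarrow> \<infinity>\<close>, and strong measurability is stable under almost everywhere limits in norm.
\<close>

section \<open>The trajectory space\<close>

text \<open>The uniform norm bound cannot keep mass from escaping to late times, so the cost of the
  limit may be smaller than the limit of the costs. Truncation isolates the part of a trajectory on
  a bounded interval, where bounded convergence does give convergence in norm.

  For a fixed initial value all members of the sequence start at the same point, so Gronwall's
  inequality, with the Lipschitz constant of the limit law alone, makes the trajectories Cauchy at
  every time. Hence no subsequence depending on the initial value has to be chosen, and the limit is
  a function of the initial value without any measurable selection.

  The null set on which the weak formulation fails depends on the test function. It is therefore
  tested only with countably many cutoffs, at rational times, and continuity in time supplies the
  rest. Every trajectory stays in the ball of radius \<open>C * b\<close>, with \<open>C\<close> the
  embedding constant and \<open>b\<close> the norm bound, so that Lipschitz properties on this ball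
  suffice.\<close>

lemma L2fun_bound:
  fixes z :: "real \<Rightarrow> 'a::euclidean_space"
  assumes "set_borel_measurable lborel {0..} z" "set_integrable lborel {0..} g"
    "\<And>t. t \<ge> 0 \<Longrightarrow> (norm (z t))\<^sup>2 \<le> g t"
  shows "L2fun z"
  unfolding L2fun_def
proof
  have [measurable]: "(\<lambda>t. indicator {0..} t *\<^sub>R z t) \<in> borel_measurable borel"
    using assms(1) by (simp add: set_borel_measurable_def)
  have "(\<lambda>t. (norm (indicator {0..} t *\<^sub>R z t))\<^sup>2) \<in> borel_measurable borel"
    by measurable
  also have "(\<lambda>t. (norm (indicator {0..} t *\<^sub>R z t))\<^sup>2) = (\<lambda>t. indicator {0..} t *\<^sub>R (norm (z t))\<^sup>2)"
    by (auto simp: indicator_def)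
  finally have m: "set_borel_measurable lborel {0..} (\<lambda>t. (norm (z t))\<^sup>2)"
    by (simp add: set_borel_measurable_def)
  show "set_integrable lborel {0..} (\<lambda>t. (norm (z t))\<^sup>2)"
    by (rule set_integrable_bound[OF assms(2) m]) (use assms(3) in \<open>fastforce intro!: AE_I2\<close>)
qed (rule assms)

lemma L2fun_zero: "L2fun (\<lambda>_. 0)"
  by (simp add: L2fun_def set_borel_measurable_def set_integrable_def)

lemma norm_add_sq_le: "(norm (a + b))\<^sup>2 \<le> 2 * (norm a)\<^sup>2 + 2 * (norm (b::'a::real_normed_vector))\<^sup>2"
proof -
  have "(norm (a + b))\<^sup>2 \<le> (norm a + norm b)\<^sup>2"
    by (intro power_mono norm_triangle_ineq) auto
  also have "\<dots> \<le> 2 * (norm a)\<^sup>2 + 2 * (norm b)\<^sup>2"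
    using sum_squares_bound[of "norm a" "norm b"] by (simp add: power2_sum)
  finally show ?thesis .
qed

lemma norm_diff_sq_le: "(norm (a - b))\<^sup>2 \<le> 2 * (norm a)\<^sup>2 + 2 * (norm (b::'a::real_normed_vector))\<^sup>2"
  using norm_add_sq_le[of a "- b"] by simp

lemma set_borel_measurable_add:
  fixes y z :: "real \<Rightarrow> 'a::euclidean_space"
  assumes "set_borel_measurable lborel A y" "set_borel_measurable lborel A z"
  shows "set_borel_measurable lborel A (\<lambda>t. y t + z t)"
  using assms unfolding set_borel_measurable_def scaleR_add_right by (rule borel_measurable_add)

lemma set_borel_measurable_diff:
  fixes y z :: "real \<Rightarrow> 'a::euclidean_space"
  assumes "set_borel_measurable lborel A y" "set_borel_measurable lborel A z"
  shows "set_borel_measurable lborel A (\<lambda>t. y t - z t)"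
  using assms unfolding set_borel_measurable_def scaleR_diff_right by (rule borel_measurable_diff)

lemma L2fun_add:
  assumes "L2fun y" "L2fun z"
  shows "L2fun (\<lambda>t. y t + z t)"
proof (rule L2fun_bound)
  show "set_borel_measurable lborel {0..} (\<lambda>t. y t + z t)"
    using assms set_borel_measurable_add by (auto simp: L2fun_def)
  show "set_integrable lborel {0..} (\<lambda>t. 2 * (norm (y t))\<^sup>2 + 2 * (norm (z t))\<^sup>2)"
    using assms by (intro set_integral_add set_integrable_mult_right) (auto simp: L2fun_def)
qed (rule norm_add_sq_le)

lemma L2fun_diff:
  assumes "L2fun y" "L2fun z"
  shows "L2fun (\<lambda>t. y t - z t)"
proof (rule L2fun_bound)
  show "set_borel_measurable lborel {0..} (\<lambda>t. y t - z t)"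
    using assms set_borel_measurable_diff by (auto simp: L2fun_def)
  show "set_integrable lborel {0..} (\<lambda>t. 2 * (norm (y t))\<^sup>2 + 2 * (norm (z t))\<^sup>2)"
    using assms by (intro set_integral_add set_integrable_mult_right) (auto simp: L2fun_def)
qed (rule norm_diff_sq_le)

lemma L2fun_inner_integrable:
  assumes "L2fun y" "L2fun z"
  shows "set_integrable lborel {0..} (\<lambda>t. y t \<bullet> z t)"
proof (rule set_integrable_bound)
  show "set_integrable lborel {0..} (\<lambda>t. (norm (y t))\<^sup>2 + (norm (z t))\<^sup>2)"
    using assms by (intro set_integral_add) (auto simp: L2fun_def)
  have [measurable]: "(\<lambda>t. indicator {0..} t *\<^sub>R y t) \<in> borel_measurable borel"
    "(\<lambda>t. indicator {0..} t *\<^sub>R z t) \<in> borel_measurable borel"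
    using assms by (simp_all add: L2fun_def set_borel_measurable_def)
  have "(\<lambda>t. (indicator {0..} t *\<^sub>R y t) \<bullet> (indicator {0..} t *\<^sub>R z t)) \<in> borel_measurable borel"
    by measurable
  also have "(\<lambda>t. (indicator {0..} t *\<^sub>R y t) \<bullet> (indicator {0..} t *\<^sub>R z t)) =
      (\<lambda>t. indicator {0..} t *\<^sub>R (y t \<bullet> z t))"
    by (auto simp: indicator_def)
  finally show "set_borel_measurable lborel {0..} (\<lambda>t. y t \<bullet> z t)"
    by (simp add: set_borel_measurable_def)
  have "norm (y t \<bullet> z t) \<le> norm ((norm (y t))\<^sup>2 + (norm (z t))\<^sup>2)" for t
  proof -
    have "\<bar>y t \<bullet> z t\<bar> \<le> norm (y t) * norm (z t)"
      by (rule Cauchy_Schwarz_ineq2)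
    moreover have "2 * (norm (y t) * norm (z t)) \<le> (norm (y t))\<^sup>2 + (norm (z t))\<^sup>2"
      using sum_squares_bound[of "norm (y t)" "norm (z t)"] by simp
    moreover have "0 \<le> norm (y t) * norm (z t)"
      by simp
    ultimately have "\<bar>y t \<bullet> z t\<bar> \<le> (norm (y t))\<^sup>2 + (norm (z t))\<^sup>2"
      by linarith
    then show ?thesis by simp
  qed
  then show "AE t in lborel. t \<in> {0..} \<longrightarrow> norm (y t \<bullet> z t) \<le> norm ((norm (y t))\<^sup>2 + (norm (z t))\<^sup>2)"
    by blast
qed

lemma set_borel_measurable_lborel_subset:
  fixes y :: "real \<Rightarrow> 'a::euclidean_space"
  assumes "set_borel_measurable lborel A y" "B \<in> sets borel" "B \<subseteq> A"
  shows "set_borel_measurable lborel B y"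
  using set_borel_measurable_subset[OF assms(1), of B] assms by simp

text \<open>On a bounded interval the constant 1 is integrable, and the norm is dominated by one
  plus its square.\<close>

lemma L2fun_integrable_Icc:
  fixes y :: "real \<Rightarrow> 'a::euclidean_space"
  assumes "L2fun y" "a \<ge> 0"
  shows "set_integrable lborel {a..b} y"
proof (rule set_integrable_bound)
  have "set_integrable lborel {a..b} (\<lambda>t. 1 :: real)"
    unfolding set_integrable_def by (simp add: integrable_real_indicator emeasure_lborel_Icc_eq)
  moreover have "set_integrable lborel {a..b} (\<lambda>t. (norm (y t))\<^sup>2)"
    by (rule set_integrable_subset[where A="{0..}"]) (use assms in \<open>auto simp: L2fun_def\<close>)
  ultimately show "set_integrable lborel {a..b} (\<lambda>t. 1 + (norm (y t))\<^sup>2)"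
    by (rule set_integral_add)
  show "set_borel_measurable lborel {a..b} y"
    by (rule set_borel_measurable_lborel_subset[where A="{0..}"]) (use assms in \<open>auto simp: L2fun_def\<close>)
  have "norm (y t) \<le> norm (1 + (norm (y t))\<^sup>2)" for t
    using sum_squares_bound[of 1 "norm (y t)"] zero_le_power2[of "norm (y t)"] norm_ge_zero[of "y t"]
    using norm_ge_zero[of "y t"] by (simp del: norm_ge_zero)
  then show "AE t in lborel. t \<in> {a..b} \<longrightarrow> norm (y t) \<le> norm (1 + (norm (y t))\<^sup>2)"
    by blast
qed

section \<open>Weak derivatives as densities of primitives\<close>

lemma has_WderivI:
  assumes "L2fun v" "\<And>t. t \<ge> 0 \<Longrightarrow> y t = y 0 + (LINT s:{0..t}|lborel. v s)"
  shows "has_Wderiv y v"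
  unfolding has_Wderiv_def using assms(1) L2fun_integrable_Icc[OF assms(1), of 0] assms(2) by blast

lemma has_WderivD:
  assumes "has_Wderiv y v"
  shows "L2fun v" "t \<ge> 0 \<Longrightarrow> set_integrable lborel {0..t} v"
    "t \<ge> 0 \<Longrightarrow> (LINT s:{0..t}|lborel. v s) = y t - y 0"
  using assms unfolding has_Wderiv_def by (blast, blast, metis add_diff_cancel_left')

lemma has_Wderiv_add:
  assumes "has_Wderiv y v" "has_Wderiv z w"
  shows "has_Wderiv (\<lambda>t. y t + z t) (\<lambda>t. v t + w t)"
proof (rule has_WderivI)
  show "L2fun (\<lambda>t. v t + w t)"
    using assms by (intro L2fun_add has_WderivD(1))
  fix t :: real assume t: "t \<ge> 0"
  then have "(LINT s:{0..t}|lborel. v s + w s) = (LINT s:{0..t}|lborel. v s) + (LINT s:{0..t}|lborel. w s)"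
    using assms has_WderivD(2) by (intro set_integral_add(2)) blast+
  also have "\<dots> = (y t - y 0) + (z t - z 0)"
    using t assms by (simp add: has_WderivD(3))
  finally show "y t + z t = y 0 + z 0 + (LINT s:{0..t}|lborel. v s + w s)"
    by simp
qed

lemma has_Wderiv_diff:
  assumes "has_Wderiv y v" "has_Wderiv z w"
  shows "has_Wderiv (\<lambda>t. y t - z t) (\<lambda>t. v t - w t)"
proof (rule has_WderivI)
  show "L2fun (\<lambda>t. v t - w t)"
    using assms by (intro L2fun_diff has_WderivD(1))
  fix t :: real assume t: "t \<ge> 0"
  then have "(LINT s:{0..t}|lborel. v s - w s) = (LINT s:{0..t}|lborel. v s) - (LINT s:{0..t}|lborel. w s)"
    using assms has_WderivD(2) by (intro set_integral_diff(2)) blast+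
  also have "\<dots> = (y t - y 0) - (z t - z 0)"
    using t assms by (simp add: has_WderivD(3))
  finally show "y t - z t = y 0 - z 0 + (LINT s:{0..t}|lborel. v s - w s)"
    by simp
qed

lemma has_Wderiv_const: "has_Wderiv (\<lambda>_. c) (\<lambda>_. 0)"
  by (rule has_WderivI) (simp_all add: L2fun_zero)

lemma is_W_zero: "is_W (\<lambda>_. 0)"
  using L2fun_zero has_Wderiv_const by (auto simp: is_W_def)

lemma is_W_diff: "is_W y \<Longrightarrow> is_W z \<Longrightarrow> is_W (\<lambda>t. y t - z t)"
  using L2fun_diff has_Wderiv_diff unfolding is_W_def by blast

lemma has_Wderiv_Wderiv: "is_W y \<Longrightarrow> has_Wderiv y (Wderiv y)"
  unfolding is_W_def Wderiv_def by (metis someI_ex)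

lemma has_Wderiv_continuous_on:
  fixes y :: "real \<Rightarrow> 'a::euclidean_space"
  assumes "has_Wderiv y v"
  shows "continuous_on {0..} y"
proof -
  have *: "continuous_on {0..T} y" if "T \<ge> 0" for T
  proof -
    have "set_integrable lborel {0..T} v"
      using has_WderivD(2)[OF assms that] .
    then have "v integrable_on {0..T}"
      by (rule set_borel_integral_eq_integral)
    then have "continuous_on {0..T} (\<lambda>t. y 0 + integral {0..t} v)"
      by (intro continuous_intros indefinite_integral_continuous_1)
    moreover have "y t = y 0 + integral {0..t} v" if "t \<in> {0..T}" for t
    proof -
      have "(LINT s:{0..t}|lborel. v s) = y t - y 0" "set_integrable lborel {0..t} v"
        using has_WderivD[OF assms] that by auto
      then show ?thesis
        using set_borel_integral_eq_integral(2)[of "{0..t}" v] by simp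
    qed
    ultimately show ?thesis
      using continuous_on_cong[OF refl, of "{0..T}" y "\<lambda>t. y 0 + integral {0..t} v"] by blast
  qed
  show ?thesis
    unfolding continuous_on_eq_continuous_within
  proof
    fix t :: real assume t: "t \<in> {0..}"
    have "continuous (at t within {0..t+1}) y"
      using *[of "t+1"] t by (auto simp: continuous_on_eq_continuous_within)
    moreover have "at t within {0..} = at t within {0..t+1}"
    proof (rule at_within_nhd)
      show "t \<in> {..<t+1}" "open {..<t+1}" by auto
      show "{0..} \<inter> {..<t + 1} - {t} = {0..t + 1} \<inter> {..<t + 1} - {t}" by auto
    qed
    ultimately show "continuous (at t within {0..}) y"
      by simp
  qed
qed

text \<open>Cut off at \<open>T\<close>, the density becomes an integrable function \<open>g\<close>
  on the whole line. The Borel sets over which \<open>g\<close> integrates to zero form a Dynkin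
  system containing the half-lines \<open>{..a}\<close>, a generator stable under intersection. So
  all Borel sets qualify, and \<open>g\<close> vanishes almost everywhere.\<close>

lemma AE_zero_if_primitive_zero:
  fixes w :: "real \<Rightarrow> 'a::euclidean_space"
  assumes int: "\<And>t. t \<ge> 0 \<Longrightarrow> set_integrable lborel {0..t} w"
    and zero: "\<And>t. t \<ge> 0 \<Longrightarrow> (LINT s:{0..t}|lborel. w s) = 0"
  shows "AE t in lborel. t \<ge> 0 \<longrightarrow> w t = 0"
proof -
  have "AE t in lborel. indicator {0..real T} t *\<^sub>R w t = 0" for T :: nat
  proof -
    define g where "g t = indicator {0..real T} t *\<^sub>R w t" for t
    have g: "integrable lborel g"
      using int[of "real T"] by (simp add: g_def[abs_def] set_integrable_def)
    have gA: "set_integrable lborel A g" if "A \<in> sets borel" for A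
      using integrable_mult_indicator[OF _ g, of A] that by (simp add: set_integrable_def)
    have UN: "set_lebesgue_integral lborel UNIV g = 0"
      using zero[of "real T"] by (simp add: g_def[abs_def] set_lebesgue_integral_def)
    have "set_lebesgue_integral lborel A g = 0" if A: "A \<in> sets lborel" for A
    proof -
      have A': "A \<in> sigma_sets UNIV (range (\<lambda>a::real. {..a}))"
        using A by (simp add: borel_eq_atMost)
      have S: "B \<in> sets borel" if "B \<in> sigma_sets UNIV (range (\<lambda>a::real. {..a}))" for B
        using that by (simp add: borel_eq_atMost)
      have "Int_stable (range (\<lambda>a::real. {..a}))" "range (\<lambda>a::real. {..a}) \<subseteq> Pow UNIV"
        by (auto simp: Int_stable_def)
      from this A' show ?thesis
      proof (induct rule: sigma_sets_induct_disjoint)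
        case (basic A)
        then obtain a where a: "A = {..a}" by auto
        have "set_lebesgue_integral lborel A g = set_lebesgue_integral lborel {0..min a (real T)} w"
          unfolding set_lebesgue_integral_def g_def a
          by (intro Bochner_Integration.integral_cong refl) (auto simp: indicator_def)
        also have "\<dots> = 0"
          using zero[of "min a (real T)"] by (cases "min a (real T) \<ge> 0") (auto simp: set_lebesgue_integral_def)
        finally show ?case .
      next
        case empty then show ?case by (simp add: set_lebesgue_integral_def)
      next
        case (compl A)
        have "set_lebesgue_integral lborel (A \<union> (UNIV - A)) g =
          set_lebesgue_integral lborel A g + set_lebesgue_integral lborel (UNIV - A) g"
          using S[OF compl(1)] by (intro set_integral_Un gA) auto
        then show ?case using UN compl by simp
      next
        case (union A)
        have "set_lebesgue_integral lborel (\<Union>i. A i) g = (\<Sum>i. set_lebesgue_integral lborel (A i) g)"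
        proof (rule lebesgue_integral_countable_add)
          show A: "A i \<in> sets lborel" for i
            using union(2) S by auto
          show "set_integrable lborel (\<Union>i. A i) g"
            using A by (intro gA sets.countable_UN') auto
        qed (use union(1) in \<open>auto simp: disjoint_family_on_def\<close>)
        then show ?case using union by simp
      qed
    qed
    then have "AE t in lborel. g t = 0"
      by (intro sigma_finite_measure.density_zero[OF sigma_finite_lborel g])
    then show ?thesis by (simp add: g_def)
  qed
  then have "AE t in lborel. \<forall>T::nat. indicator {0..real T} t *\<^sub>R w t = 0"
    unfolding AE_all_countable by blast
  then show ?thesis
  proof eventually_elim
    case (elim t)
    obtain T :: nat where "t \<le> real T" using real_arch_simple by blast
    then show ?case using elim[rule_format, of T] by (auto simp: indicator_def)
  qed
qed

text \<open>\<open>Wderiv\<close> picks an arbitrary weak derivative; this shows that the choice is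
  immaterial under integrals.\<close>

lemma has_Wderiv_unique:
  assumes "has_Wderiv y v" "has_Wderiv y w"
  shows "AE t in lborel. t \<ge> 0 \<longrightarrow> v t = w t"
proof -
  have d: "has_Wderiv (\<lambda>t. y t - y t) (\<lambda>t. v t - w t)"
    using has_Wderiv_diff assms by blast
  have "AE t in lborel. t \<ge> 0 \<longrightarrow> v t - w t = 0"
  proof (rule AE_zero_if_primitive_zero)
    fix t :: real assume "t \<ge> 0"
    then show "set_integrable lborel {0..t} (\<lambda>t. v t - w t)" "(LINT s:{0..t}|lborel. v s - w s) = 0"
      using has_WderivD[OF d] by auto
  qed
  then show ?thesis by simp
qed

section \<open>The norm of the trajectory space\<close>

text \<open>Replaces the arbitrary \<open>Wderiv\<close> by any convenient derivative, for instance
  the right-hand side of the differential equation.\<close>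

lemma Wnorm_sq:
  assumes "L2fun y" "has_Wderiv y v"
  shows "(Wnorm y)\<^sup>2 = (LINT t:{0..}|lborel. (norm (y t))\<^sup>2 + (norm (v t))\<^sup>2)"
proof -
  have W: "has_Wderiv y (Wderiv y)"
    using assms by (intro has_Wderiv_Wderiv) (auto simp: is_W_def)
  have L: "L2fun v" "L2fun (Wderiv y)"
    using assms(2) W by (auto intro: has_WderivD)
  have "(LINT t:{0..}|lborel. (norm (Wderiv y t))\<^sup>2) = (LINT t:{0..}|lborel. (norm (v t))\<^sup>2)"
    unfolding set_lebesgue_integral_def
  proof (rule integral_cong_AE)
    show "(\<lambda>t. indicat_real {0..} t *\<^sub>R (norm (Wderiv y t))\<^sup>2) \<in> borel_measurable lborel"
      "(\<lambda>t. indicat_real {0..} t *\<^sub>R (norm (v t))\<^sup>2) \<in> borel_measurable lborel"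
      using L by (auto simp: L2fun_def set_integrable_def)
    show "AE x in lborel. indicat_real {0..} x *\<^sub>R (norm (Wderiv y x))\<^sup>2 = indicat_real {0..} x *\<^sub>R (norm (v x))\<^sup>2"
      using has_Wderiv_unique[OF W assms(2)] by eventually_elim (auto simp: indicator_def)
  qed
  moreover have "(LINT t:{0..}|lborel. (norm (y t))\<^sup>2 + (norm (v t))\<^sup>2) =
     (LINT t:{0..}|lborel. (norm (y t))\<^sup>2) + (LINT t:{0..}|lborel. (norm (v t))\<^sup>2)"
    using assms L by (intro set_integral_add) (auto simp: L2fun_def)
  moreover have "(LINT t:{0..}|lborel. (norm (y t))\<^sup>2) \<ge> 0" "(LINT t:{0..}|lborel. (norm (Wderiv y t))\<^sup>2) \<ge> 0"
    by (auto simp: set_lebesgue_integral_def intro!: integral_nonneg_AE)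
  ultimately show ?thesis
    by (simp add: Wnorm_def)
qed

lemma Wnorm_nonneg: "Wnorm y \<ge> 0"
  unfolding Wnorm_def by (auto simp: set_lebesgue_integral_def intro!: integral_nonneg_AE add_nonneg_nonneg)

lemma Wnorm_zero: "Wnorm (\<lambda>_. 0) = 0"
  using Wnorm_sq[OF L2fun_zero has_Wderiv_const] by simp

lemma Wnorm_sq_le:
  assumes "L2fun y" "has_Wderiv y v" "set_integrable lborel {0..} g"
    "\<And>t. t \<ge> 0 \<Longrightarrow> (norm (y t))\<^sup>2 + (norm (v t))\<^sup>2 \<le> g t"
  shows "(Wnorm y)\<^sup>2 \<le> (LINT t:{0..}|lborel. g t)"
  unfolding Wnorm_sq[OF assms(1,2)]
  using assms has_WderivD(1)[OF assms(2)] by (intro set_integral_mono set_integral_add) (auto simp: L2fun_def)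

text \<open>Young's inequality with the weight \<open>r\<close> at its optimal value gives Minkowski's inequality.\<close>

lemma Wnorm_triangle:
  assumes y: "is_W y" and z: "is_W z"
  shows "Wnorm (\<lambda>t. y t + z t) \<le> Wnorm y + Wnorm z"
proof -
  obtain v w where v: "has_Wderiv y v" and w: "has_Wderiv z w"
    using y z by (auto simp: is_W_def)
  have L: "L2fun y" "L2fun z" "L2fun v" "L2fun w"
    using y z v w by (auto simp: is_W_def intro: has_WderivD)
  have young: "(Wnorm (\<lambda>t. y t + z t))\<^sup>2 \<le> (1 + r) * (Wnorm y)\<^sup>2 + (1 + 1 / r) * (Wnorm z)\<^sup>2" if r: "r > 0" for r
  proof -
    have pt: "(norm (a + b))\<^sup>2 \<le> (1 + r) * (norm a)\<^sup>2 + (1 + 1 / r) * (norm b)\<^sup>2" for a b :: 'a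
    proof -
      have "(norm (a + b))\<^sup>2 \<le> (norm a + norm b)\<^sup>2"
        by (intro power_mono norm_triangle_ineq) auto
      moreover have "2 * (norm a * norm b) \<le> r * (norm a)\<^sup>2 + (1 / r) * (norm b)\<^sup>2"
      proof -
        have "0 \<le> (r * norm a - norm b)\<^sup>2 / r"
          using r by simp
        also have "(r * norm a - norm b)\<^sup>2 = r * (r * (norm a)\<^sup>2 - 2 * (norm a * norm b)) + (norm b)\<^sup>2"
          by (simp add: power2_eq_square algebra_simps)
        also have "\<dots> / r = r * (norm a)\<^sup>2 + (1 / r) * (norm b)\<^sup>2 - 2 * (norm a * norm b)"
          using r by (simp add: add_divide_distrib)
        finally show ?thesis by simp
      qed
      ultimately show ?thesis
        by (simp add: power2_sum algebra_simps)
    qed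
    have i: "set_integrable lborel {0..} (\<lambda>t. (norm (y t))\<^sup>2 + (norm (v t))\<^sup>2)"
      "set_integrable lborel {0..} (\<lambda>t. (norm (z t))\<^sup>2 + (norm (w t))\<^sup>2)"
      using L by (auto simp: L2fun_def intro!: set_integral_add)
    have "(Wnorm (\<lambda>t. y t + z t))\<^sup>2 \<le> (LINT t:{0..}|lborel. (1 + r) * ((norm (y t))\<^sup>2 + (norm (v t))\<^sup>2) +
      (1 + 1 / r) * ((norm (z t))\<^sup>2 + (norm (w t))\<^sup>2))"
    proof (rule Wnorm_sq_le[OF L2fun_add[OF L(1,2)] has_Wderiv_add[OF v w]])
      show "set_integrable lborel {0..} (\<lambda>t. (1 + r) * ((norm (y t))\<^sup>2 + (norm (v t))\<^sup>2) +
         (1 + 1 / r) * ((norm (z t))\<^sup>2 + (norm (w t))\<^sup>2))"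
        by (rule set_integral_add(1)[OF set_integrable_mult_right set_integrable_mult_right]) (rule i)+
      show "(norm (y t + z t))\<^sup>2 + (norm (v t + w t))\<^sup>2 \<le> (1 + r) * ((norm (y t))\<^sup>2 + (norm (v t))\<^sup>2) +
         (1 + 1 / r) * ((norm (z t))\<^sup>2 + (norm (w t))\<^sup>2)" for t
        using pt[of "y t" "z t"] pt[of "v t" "w t"] by (simp add: algebra_simps)
    qed
    also have "\<dots> = (1 + r) * (Wnorm y)\<^sup>2 + (1 + 1 / r) * (Wnorm z)\<^sup>2"
      unfolding Wnorm_sq[OF L(1) v] Wnorm_sq[OF L(2) w]
      by (subst set_integral_add(2)[OF set_integrable_mult_right set_integrable_mult_right]) ((rule i)+, simp)
    finally show ?thesis .
  qed
  have "(Wnorm (\<lambda>t. y t + z t))\<^sup>2 \<le> (Wnorm y + Wnorm z + e)\<^sup>2" if e: "e > 0" for e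
  proof -
    \<comment> \<open>The shift by \<open>e/2\<close> keeps both numbers positive, so that the
      weight \<open>b/a\<close> is positive and finite even if one of the norms vanishes.\<close>
    define a b where "a = Wnorm y + e/2" and "b = Wnorm z + e/2"
    have ab: "a > 0" "b > 0" "Wnorm y \<le> a" "Wnorm z \<le> b"
      using e Wnorm_nonneg[of y] Wnorm_nonneg[of z] by (auto simp: a_def b_def)
    have "(Wnorm (\<lambda>t. y t + z t))\<^sup>2 \<le> (1 + b/a) * (Wnorm y)\<^sup>2 + (1 + 1 / (b/a)) * (Wnorm z)\<^sup>2"
      using ab by (intro young) simp
    also have "\<dots> \<le> (1 + b/a) * a\<^sup>2 + (1 + 1 / (b/a)) * b\<^sup>2"
      using ab Wnorm_nonneg by (intro add_mono mult_left_mono power_mono) auto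
    also have "\<dots> = (a + b)\<^sup>2"
      using ab by (simp add: power2_eq_square field_simps)
    also have "a + b = Wnorm y + Wnorm z + e"
      by (simp add: a_def b_def)
    finally show ?thesis .
  qed
  then have "Wnorm (\<lambda>t. y t + z t) \<le> Wnorm y + Wnorm z + e" if e: "e > 0" for e
    by (rule power2_le_imp_le) (use that Wnorm_nonneg[of y] Wnorm_nonneg[of z] in auto)
  then show ?thesis
    by (rule field_le_epsilon)
qed

lemma Wnorm_minus_commute: "is_W y \<Longrightarrow> is_W z \<Longrightarrow> Wnorm (\<lambda>t. y t - z t) = Wnorm (\<lambda>t. z t - y t)"
proof -
  assume y: "is_W y" and z: "is_W z"
  obtain v w where v: "has_Wderiv y v" and w: "has_Wderiv z w"
    using y z by (auto simp: is_W_def)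
  have L: "L2fun y" "L2fun z"
    using y z by (auto simp: is_W_def)
  have "(Wnorm (\<lambda>t. y t - z t))\<^sup>2 = (Wnorm (\<lambda>t. z t - y t))\<^sup>2"
    unfolding Wnorm_sq[OF L2fun_diff[OF L] has_Wderiv_diff[OF v w]]
      Wnorm_sq[OF L2fun_diff[OF L(2,1)] has_Wderiv_diff[OF w v]]
    by (simp add: norm_minus_commute)
  then show ?thesis
    by (rule power2_eq_imp_eq) (rule Wnorm_nonneg)+
qed

lemma Wnorm_diff_triangle:
  assumes "is_W x" "is_W y" "is_W z"
  shows "Wnorm (\<lambda>t. x t - z t) \<le> Wnorm (\<lambda>t. x t - y t) + Wnorm (\<lambda>t. y t - z t)"
  using Wnorm_triangle[OF is_W_diff[OF assms(1,2)] is_W_diff[OF assms(2,3)]] by simp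

section \<open>Truncation in time and decay at infinity\<close>

text \<open>The slope \<open>N\<close> serves two purposes. With \<open>N = 1\<close> the ramp
  truncates a trajectory at a controlled price in norm. With \<open>N\<close> tending to infinity
  the cutoffs of a constant approximate that constant times the indicator of [0,T], which is the
  test function that turns the weak formulation into the integral equation.\<close>

definition cutoff :: "real \<Rightarrow> real \<Rightarrow> (real \<Rightarrow> 'a::euclidean_space) \<Rightarrow> real \<Rightarrow> 'a" where
  "cutoff T N y t = (if t \<le> T then y t else max 0 (1 - N * (t - T)) *\<^sub>R y T)"

definition cutoff_deriv :: "real \<Rightarrow> real \<Rightarrow> (real \<Rightarrow> 'a::euclidean_space) \<Rightarrow> (real \<Rightarrow> 'a) \<Rightarrow> real \<Rightarrow> 'a" where
  "cutoff_deriv T N y v t = (if t \<le> T then v t else if t \<le> T + 1 / N then - (N *\<^sub>R y T) else 0)"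

lemma set_integrable_indicator_Icc:
  fixes a b c :: real
  shows "set_integrable lborel {0..} (\<lambda>t. indicator {a..b} t *\<^sub>R c)"
  unfolding set_integrable_def
  by (intro integrable_mult_indicator integrable_scaleR_left) (simp_all add: emeasure_lborel_Icc_eq)

lemma has_Wderiv_cutoff:
  assumes y: "has_Wderiv y v" and T: "T \<ge> 0" and N: "N > 0"
  shows "has_Wderiv (cutoff T N y) (cutoff_deriv T N y v)"
proof (rule has_WderivI)
  let ?c = "cutoff_deriv T N y v"
  have L: "L2fun v" using has_WderivD(1)[OF y] .
  have [measurable]: "(\<lambda>t. indicator {0..} t *\<^sub>R v t) \<in> borel_measurable borel"
    using L by (simp add: L2fun_def set_borel_measurable_def)
  show Lc: "L2fun ?c"
  proof (rule L2fun_bound)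
    have "(\<lambda>t. if t \<le> T then indicator {0..} t *\<^sub>R v t else indicator {0..} t *\<^sub>R (if t \<le> T + 1 / N then - (N *\<^sub>R y T) else 0))
      \<in> borel_measurable borel" by measurable
    also have "(\<lambda>t. if t \<le> T then indicator {0..} t *\<^sub>R v t else indicator {0..} t *\<^sub>R (if t \<le> T + 1 / N then - (N *\<^sub>R y T) else 0))
       = (\<lambda>t. indicator {0..} t *\<^sub>R ?c t)"
      by (auto simp: cutoff_deriv_def)
    finally show "set_borel_measurable lborel {0..} ?c"
      by (simp add: set_borel_measurable_def)
    show "set_integrable lborel {0..} (\<lambda>t. (norm (v t))\<^sup>2 + indicator {T..T + 1/N} t *\<^sub>R (norm (N *\<^sub>R y T))\<^sup>2)"
      using L by (intro set_integral_add set_integrable_indicator_Icc) (auto simp: L2fun_def)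
    show "(norm (?c t))\<^sup>2 \<le> (norm (v t))\<^sup>2 + indicator {T..T + 1/N} t *\<^sub>R (norm (N *\<^sub>R y T))\<^sup>2" for t
      by (auto simp: cutoff_deriv_def)
  qed
  fix t :: real assume t: "t \<ge> 0"
  show "cutoff T N y t = cutoff T N y 0 + (LINT s:{0..t}|lborel. ?c s)"
  proof (cases "t \<le> T")
    case True
    then have "(LINT s:{0..t}|lborel. ?c s) = (LINT s:{0..t}|lborel. v s)"
      by (intro set_lebesgue_integral_cong) (auto simp: cutoff_deriv_def)
    then show ?thesis
      using has_WderivD(3)[OF y t] True T by (simp add: cutoff_def)
  next
    case False
    then have "{0..t} = {0..T} \<union> {T<..t}" using T by auto
    then have "(LINT s:{0..t}|lborel. ?c s) = (LINT s:{0..T}|lborel. ?c s) + (LINT s:{T<..t}|lborel. ?c s)"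
    proof (simp, intro set_integral_Un)
      show "set_integrable lborel {0..T} ?c"
        by (rule L2fun_integrable_Icc[OF Lc]) simp
      show "set_integrable lborel {T<..t} ?c"
        by (rule set_integrable_subset[OF L2fun_integrable_Icc[OF Lc, of 0 t]]) (use T in auto)
    qed auto
    also have "(LINT s:{0..T}|lborel. ?c s) = (LINT s:{0..T}|lborel. v s)"
      by (intro set_lebesgue_integral_cong) (auto simp: cutoff_deriv_def)
    also have "\<dots> = y T - y 0"
      using has_WderivD(3)[OF y T] .
    \<comment> \<open>The derivative is nonzero only until the ramp ends at \<open>T + 1/N\<close>,
      hence the minimum.\<close>
    also have "(LINT s:{T<..t}|lborel. ?c s) = (LINT s:{T<..min t (T + 1/N)}|lborel. - (N *\<^sub>R y T))"
      unfolding set_lebesgue_integral_def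
      by (intro Bochner_Integration.integral_cong) (auto simp: cutoff_deriv_def indicator_def)
    also have "\<dots> = - (min t (T + 1/N) - T) *\<^sub>R (N *\<^sub>R y T)"
      using False N by (simp add: set_lebesgue_integral_def left_diff_distrib scaleR_diff_left)
    finally have *: "(LINT s:{0..t}|lborel. ?c s) = y T - y 0 - ((min t (T + 1/N) - T) * N) *\<^sub>R y T"
      by (simp add: left_diff_distrib scaleR_diff_left)
    have "max 0 (1 - N * (t - T)) = 1 - (min t (T + 1/N) - T) * N"
    proof (cases "t \<le> T + 1/N")
      case True
      then have "N * (t - T) \<le> 1" using N by (simp add: field_simps)
      then show ?thesis using True by (simp add: min_def algebra_simps)
    next
      case False
      then have "N * (t - T) > 1" using N by (simp add: field_simps)
      then show ?thesis using False N by (simp add: min_def)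
    qed
    then have "cutoff T N y t = (1 - (min t (T + 1/N) - T) * N) *\<^sub>R y T"
      using False by (simp add: cutoff_def)
    then show ?thesis
      using T by (simp add: * cutoff_def scaleR_diff_left)
  qed
qed

lemma L2fun_cutoff:
  assumes y: "has_Wderiv y v" and T: "T \<ge> 0" and N: "N > 0"
  shows "L2fun (cutoff T N y)"
proof -
  have "continuous_on {0..} (cutoff T N y)"
    using has_Wderiv_continuous_on[OF has_Wderiv_cutoff[OF assms]] .
  then have meas: "set_borel_measurable lborel {0..} (cutoff T N y)"
    using set_measurable_continuous_on[of "{0..}" "cutoff T N y"] by (simp add: set_borel_measurable_def)
  have "compact (y ` {0..T})"
    by (intro compact_continuous_image continuous_on_subset[OF has_Wderiv_continuous_on[OF y]]) auto
  then obtain K where K: "\<And>t. t \<in> {0..T} \<Longrightarrow> norm (y t) \<le> K"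
    using compact_imp_bounded by (fastforce simp: bounded_iff)
  have "(norm (cutoff T N y t))\<^sup>2 \<le> indicator {0..T + 1/N} t *\<^sub>R K\<^sup>2" if t: "t \<ge> 0" for t
  proof (cases "t \<le> T + 1/N")
    case True
    have "norm (cutoff T N y t) \<le> K"
    proof (cases "t \<le> T")
      case False
      have "norm (cutoff T N y t) = max 0 (1 - N * (t - T)) * norm (y T)"
        using False by (simp add: cutoff_def)
      also have "\<dots> \<le> 1 * norm (y T)"
        using N False by (intro mult_right_mono) auto
      also have "\<dots> \<le> K" using K[of T] T by simp
      finally show ?thesis .
    qed (use t K in \<open>auto simp: cutoff_def\<close>)
    then show ?thesis using t True by (auto intro!: power_mono)
  next
    case False
    then have "N * (t - T) > 1" using N by (simp add: field_simps)
    moreover have "t > T" using False N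
      by (smt (verit) zero_less_divide_1_iff)
    ultimately show ?thesis using False t by (simp add: cutoff_def)
  qed
  then show ?thesis
    by (rule L2fun_bound[OF meas set_integrable_indicator_Icc])
qed

lemma is_W_cutoff: "has_Wderiv y v \<Longrightarrow> T \<ge> 0 \<Longrightarrow> N > 0 \<Longrightarrow> is_W (cutoff T N y)"
  using L2fun_cutoff has_Wderiv_cutoff unfolding is_W_def by blast

lemma cutoff_diff: "cutoff T N (\<lambda>t. y t - z t) = (\<lambda>t. cutoff T N y t - cutoff T N z t)"
  by (auto simp: cutoff_def algebra_simps)

text \<open>On the unit interval after \<open>T\<close> both the value and the slope of the ramp are
  bounded by \<open>norm (y T)\<close>, hence the factor 2. The bound sees \<open>y\<close> and
  \<open>v\<close> only up to time \<open>T\<close>, so bounded pointwise convergence on [0,T] is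
  enough to make it small.\<close>

lemma Wnorm_sq_cutoff_le:
  assumes y: "has_Wderiv y v" and T: "T \<ge> 0"
  shows "(Wnorm (cutoff T 1 y))\<^sup>2 \<le> (LINT t:{0..T}|lborel. (norm (y t))\<^sup>2 + (norm (v t))\<^sup>2) + 2 * (norm (y T))\<^sup>2"
proof -
  define h where "h t = indicator {0..T} t *\<^sub>R ((norm (y t))\<^sup>2 + (norm (v t))\<^sup>2)" for t
  define k where "k t = indicator {T<..T+1} t *\<^sub>R (2 * (norm (y T))\<^sup>2)" for t
  have c: "continuous_on {0..T} y"
    by (rule continuous_on_subset[OF has_Wderiv_continuous_on[OF y]]) auto
  have "set_integrable lborel {0..T} (\<lambda>t. (norm (y t))\<^sup>2)"
    by (intro borel_integrable_atLeastAtMost' continuous_intros c)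
  moreover have "set_integrable lborel {0..T} (\<lambda>t. (norm (v t))\<^sup>2)"
    by (rule set_integrable_subset[where A="{0..}"]) (use has_WderivD(1)[OF y] in \<open>auto simp: L2fun_def\<close>)
  ultimately have "set_integrable lborel {0..T} (\<lambda>t. (norm (y t))\<^sup>2 + (norm (v t))\<^sup>2)"
    by (rule set_integral_add)
  then have h: "integrable lborel h"
    by (simp add: h_def[abs_def] set_integrable_def)
  have k: "integrable lborel k"
    unfolding k_def[abs_def] by (intro integrable_scaleR_left) simp
  have "(Wnorm (cutoff T 1 y))\<^sup>2 \<le> (LINT t:{0..}|lborel. h t + k t)"
  proof (rule Wnorm_sq_le[OF L2fun_cutoff has_Wderiv_cutoff, OF y T _ y T])
    show "set_integrable lborel {0..} (\<lambda>t. h t + k t)"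
      unfolding set_integrable_def using h k by (intro integrable_mult_indicator) auto
    fix t :: real assume t: "t \<ge> 0"
    have "(norm (max 0 (1 - (t - T)) *\<^sub>R y T))\<^sup>2 \<le> (norm (y T))\<^sup>2" if "t > T"
    proof -
      have "norm (max 0 (1 - (t - T)) *\<^sub>R y T) = max 0 (1 - (t - T)) * norm (y T)" by simp
      also have "\<dots> \<le> 1 * norm (y T)" using that by (intro mult_right_mono) auto
      finally show ?thesis by (intro power_mono) auto
    qed
    then show "(norm (cutoff T 1 y t))\<^sup>2 + (norm (cutoff_deriv T 1 y v t))\<^sup>2 \<le> h t + k t"
      using t by (auto simp: cutoff_def cutoff_deriv_def h_def k_def indicator_def)
  qed auto
  also have "\<dots> = (LINT t|lborel. h t + k t)"
    unfolding set_lebesgue_integral_def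
    by (intro Bochner_Integration.integral_cong) (use T in \<open>auto simp: h_def k_def indicator_def\<close>)
  also have "\<dots> = (LINT t|lborel. h t) + (LINT t|lborel. k t)"
    by (rule Bochner_Integration.integral_add[OF h k])
  also have "(LINT t|lborel. k t) = 2 * (norm (y T))\<^sup>2"
    unfolding k_def by simp
  finally show ?thesis by (simp add: h_def[abs_def] set_lebesgue_integral_def)
qed

section \<open>Tails, time shifts and decay at infinity\<close>

lemma tail_integral_tendsto_0:
  fixes h :: "real \<Rightarrow> real"
  assumes "set_integrable lborel {0..} h"
  shows "(\<lambda>n. LINT t:{real n..}|lborel. h t) \<longlonglongrightarrow> 0"
proof -
  have h: "integrable lborel (\<lambda>t. indicator {0..} t *\<^sub>R h t)"
    using assms by (simp add: set_integrable_def)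
  have "(\<lambda>n. LINT t|lborel. indicator {real n..} t *\<^sub>R (indicator {0..} t *\<^sub>R h t)) \<longlonglongrightarrow> (LINT t::real|lborel. (0::real))"
  proof (rule integral_dominated_convergence)
    show "integrable lborel (\<lambda>t. norm (indicator {0..} t *\<^sub>R h t))"
      using h by (rule integrable_norm)
    show "(\<lambda>t. indicator {real n..} t *\<^sub>R (indicator {0..} t *\<^sub>R h t)) \<in> borel_measurable lborel" for n
      using integrable_mult_indicator[OF _ h, of "{real n..}"] by auto
    show "AE t in lborel. (\<lambda>n. indicator {real n..} t *\<^sub>R (indicator {0..} t *\<^sub>R h t)) \<longlonglongrightarrow> 0"
    proof (rule AE_I2)
      fix t :: real
      obtain m :: nat where "t < real m" using reals_Archimedean2 by blast
      then have "\<forall>n\<ge>m. indicator {real n..} t *\<^sub>R (indicator {0..} t *\<^sub>R h t) = 0"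
        by (auto simp: indicator_def)
      then show "(\<lambda>n. indicator {real n..} t *\<^sub>R (indicator {0..} t *\<^sub>R h t)) \<longlonglongrightarrow> 0"
        by (intro tendsto_eventually) (auto simp: eventually_sequentially)
    qed
  qed (auto simp: indicator_def)
  moreover have "(LINT t|lborel. indicator {real n..} t *\<^sub>R (indicator {0..} t *\<^sub>R h t)) = (LINT t:{real n..}|lborel. h t)" for n
    unfolding set_lebesgue_integral_def
    by (intro Bochner_Integration.integral_cong) (auto simp: indicator_def)
  ultimately show ?thesis by simp
qed

lemma lborel_set_integral_shift:
  fixes h :: "real \<Rightarrow> 'a::euclidean_space"
  shows "(LINT t:{a..b}|lborel. h (t + T)) = (LINT t:{a+T..b+T}|lborel. h t)"
    "(LINT t:{a..}|lborel. h (t + T)) = (LINT t:{a+T..}|lborel. h t)"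
    "set_integrable lborel {a+T..} h \<Longrightarrow> set_integrable lborel {a..} (\<lambda>t. h (t + T))"
proof -
  have ind: "indicat_real {T+a..T+b} (t+T) = indicat_real {a..b} t"
    "indicat_real {T+a..} (t+T) = indicat_real {a..} t" for t
    by (auto simp: indicator_def)
  show "(LINT t:{a..b}|lborel. h (t + T)) = (LINT t:{a+T..b+T}|lborel. h t)"
    unfolding set_lebesgue_integral_def
    by (subst (2) lborel_integral_real_affine[where c=1 and t=T]) (simp_all add: ind add.commute)
  show "(LINT t:{a..}|lborel. h (t + T)) = (LINT t:{a+T..}|lborel. h t)"
    unfolding set_lebesgue_integral_def
    by (subst (2) lborel_integral_real_affine[where c=1 and t=T]) (simp_all add: ind add.commute)
  show "set_integrable lborel {a..} (\<lambda>t. h (t + T))" if "set_integrable lborel {a+T..} h"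
    using lborel_integrable_real_affine[OF that[unfolded set_integrable_def], of 1 T]
    by (simp add: set_integrable_def ind add.commute)
qed

lemma L2fun_shift:
  assumes "L2fun y" "T \<ge> 0"
  shows "L2fun (\<lambda>t. y (t + T))"
  unfolding L2fun_def
proof
  have [measurable]: "(\<lambda>t. indicator {0..} t *\<^sub>R y t) \<in> borel_measurable borel"
    using assms by (simp add: L2fun_def set_borel_measurable_def)
  have "(\<lambda>t. indicat_real {0..} t *\<^sub>R (indicator {0..} (t + T) *\<^sub>R y (t + T))) \<in> borel_measurable borel"
    by measurable
  also have "(\<lambda>t. indicat_real {0..} t *\<^sub>R (indicat_real {0..} (t + T) *\<^sub>R y (t + T))) = (\<lambda>t. indicat_real {0..} t *\<^sub>R y (t + T))"
    using assms by (auto simp: indicator_def)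
  finally show "set_borel_measurable lborel {0..} (\<lambda>t. y (t + T))"
    by (simp add: set_borel_measurable_def)
  have "set_integrable lborel {0+T..} (\<lambda>t. (norm (y t))\<^sup>2)"
    by (rule set_integrable_subset[where A="{0..}"]) (use assms in \<open>auto simp: L2fun_def\<close>)
  then show "set_integrable lborel {0..} (\<lambda>t. (norm (y (t + T)))\<^sup>2)"
    by (rule lborel_set_integral_shift(3))
qed

lemma has_Wderiv_shift:
  assumes y: "has_Wderiv y v" and T: "T \<ge> 0"
  shows "has_Wderiv (\<lambda>t. y (t + T)) (\<lambda>t. v (t + T))"
proof (rule has_WderivI)
  have L: "L2fun v" using has_WderivD(1)[OF y] .
  show "L2fun (\<lambda>t. v (t + T))"
    using L2fun_shift[OF L T] .
  fix t :: real assume t: "t \<ge> 0"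
  have "(LINT s:{0..t}|lborel. v (s + T)) = (LINT s:{T..t+T}|lborel. v s)"
    using lborel_set_integral_shift(1)[of 0 t v T] by simp
  also have "\<dots> = (LINT s:{T<..t+T}|lborel. v s)"
  proof (rule set_integral_cong_set)
    show "set_borel_measurable lborel {T..t + T} v" "set_borel_measurable lborel {T<..t + T} v"
      by (rule set_borel_measurable_lborel_subset[where A="{0..}"]; use L T in \<open>auto simp: L2fun_def\<close>)+
    have "AE x in lborel. x \<noteq> T" by (rule AE_lborel_singleton)
    then show "AE x in lborel. (x \<in> {T<..t + T}) = (x \<in> {T..t + T})"
      by eventually_elim auto
  qed
  finally have 1: "(LINT s:{0..t}|lborel. v (s + T)) = (LINT s:{T<..t+T}|lborel. v s)" .
  have "(LINT s:{0..T} \<union> {T<..t+T}|lborel. v s) = (LINT s:{0..T}|lborel. v s) + (LINT s:{T<..t+T}|lborel. v s)"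
  proof (rule set_integral_Un)
    show "set_integrable lborel {0..T} v"
      by (rule L2fun_integrable_Icc[OF L]) simp
    show "set_integrable lborel {T<..t+T} v"
      by (rule set_integrable_subset[OF L2fun_integrable_Icc[OF L, of 0 "t+T"]]) (use T in auto)
  qed auto
  also have "{0..T} \<union> {T<..t+T} = {0..t+T}" using t T by auto
  finally show "y (t + T) = y (0 + T) + (LINT s:{0..t}|lborel. v (s + T))"
    using has_WderivD(3)[OF y T] has_WderivD(3)[OF y, of "t + T"] t T 1 by simp
qed

text \<open>The embedding inequality is applied to the shifted trajectory at time 0: the squared
  norm of the shift by \<open>n\<close> is the tail of a convergent integral.\<close>

lemma is_W_tendsto_0:
  fixes y :: "real \<Rightarrow> 'a::euclidean_space"
  assumes C: "\<And>y :: real \<Rightarrow> 'a. is_W y \<Longrightarrow> \<forall>t\<ge>0. norm (y t) \<le> C * Wnorm y"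
    and y: "is_W y"
  shows "(\<lambda>n. y (real n)) \<longlonglongrightarrow> 0"
proof -
  obtain v where v: "has_Wderiv y v" using y by (auto simp: is_W_def)
  have L: "L2fun y" "L2fun v" using y v has_WderivD by (auto simp: is_W_def)
  let ?h = "\<lambda>t. (norm (y t))\<^sup>2 + (norm (v t))\<^sup>2"
  have i: "set_integrable lborel {0..} ?h"
    using L by (intro set_integral_add) (auto simp: L2fun_def)
  have N: "(Wnorm (\<lambda>t. y (t + real n)))\<^sup>2 = (LINT t:{real n..}|lborel. ?h t)" for n :: nat
    using Wnorm_sq[OF L2fun_shift[OF L(1)] has_Wderiv_shift[OF v], of "real n"]
      lborel_set_integral_shift(2)[of 0 ?h "real n"] by simp
  have "(\<lambda>n. sqrt ((Wnorm (\<lambda>t. y (t + real n)))\<^sup>2)) \<longlonglongrightarrow> sqrt 0"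
    unfolding N by (intro tendsto_real_sqrt tail_integral_tendsto_0 i)
  then have "(\<lambda>n. C * Wnorm (\<lambda>t. y (t + real n))) \<longlonglongrightarrow> C * 0"
    by (intro tendsto_mult_left) (simp add: Wnorm_nonneg)
  then have lim: "(\<lambda>n. C * Wnorm (\<lambda>t. y (t + real n))) \<longlonglongrightarrow> 0"
    by simp
  have "norm (y (real n)) \<le> C * Wnorm (\<lambda>t. y (t + real n))" for n :: nat
  proof -
    have "is_W (\<lambda>t. y (t + real n))"
      unfolding is_W_def using L2fun_shift[OF L(1), of "real n"] has_Wderiv_shift[OF v, of "real n"] by auto
    from C[OF this, rule_format, of 0] show ?thesis by simp
  qed
  then show ?thesis
    by (intro Lim_null_comparison[OF _ lim]) simp
qed

text \<open>The error vanishes up to time \<open>T\<close>. After \<open>T\<close> it is controlled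
  by a tail integral, which tends to zero by integrability, and by \<open>norm (y T)\<close>, which
  tends to zero by the decay at infinity.\<close>

lemma cutoff_tendsto:
  fixes y :: "real \<Rightarrow> 'a::euclidean_space"
  assumes C: "\<And>y :: real \<Rightarrow> 'a. is_W y \<Longrightarrow> \<forall>t\<ge>0. norm (y t) \<le> C * Wnorm y"
    and y: "is_W y"
  shows "(\<lambda>n. Wnorm (\<lambda>t. cutoff (real n) 1 y t - y t)) \<longlonglongrightarrow> 0"
proof -
  obtain v where v: "has_Wderiv y v" using y by (auto simp: is_W_def)
  have L: "L2fun y" "L2fun v" using y v has_WderivD by (auto simp: is_W_def)
  let ?h = "\<lambda>t. (norm (y t))\<^sup>2 + (norm (v t))\<^sup>2"
  have i: "set_integrable lborel {0..} ?h"
    using L by (intro set_integral_add) (auto simp: L2fun_def)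
  \<comment> \<open>The factor 4 is the 2 from squaring a difference, counted once for the value and
    once for the slope of the ramp.\<close>
  have bd: "(Wnorm (\<lambda>t. cutoff T 1 y t - y t))\<^sup>2 \<le> 2 * (LINT t:{T..}|lborel. ?h t) + 4 * (norm (y T))\<^sup>2" if T: "T \<ge> 0" for T
  proof -
    define h where "h t = indicator {T..} t *\<^sub>R (2 * ?h t)" for t
    define k where "k t = indicator {T<..T+1} t *\<^sub>R (4 * (norm (y T))\<^sup>2)" for t
    have "set_integrable lborel {T..} (\<lambda>t. 2 * ?h t)"
      using set_integrable_subset[OF i, of "{T..}"] T by (intro set_integrable_mult_right) auto
    then have h: "integrable lborel h"
      by (simp add: h_def[abs_def] set_integrable_def)
    have k: "integrable lborel k"
      unfolding k_def[abs_def] by (intro integrable_scaleR_left) simp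
    have "(Wnorm (\<lambda>t. cutoff T 1 y t - y t))\<^sup>2 \<le> (LINT t:{0..}|lborel. h t + k t)"
    proof (rule Wnorm_sq_le)
      show "L2fun (\<lambda>t. cutoff T 1 y t - y t)"
        by (rule L2fun_diff[OF L2fun_cutoff[OF v T] L(1)]) simp
      show "has_Wderiv (\<lambda>t. cutoff T 1 y t - y t) (\<lambda>t. cutoff_deriv T 1 y v t - v t)"
        by (rule has_Wderiv_diff[OF has_Wderiv_cutoff[OF v T] v]) simp
      show "set_integrable lborel {0..} (\<lambda>t. h t + k t)"
        unfolding set_integrable_def using h k by (intro integrable_mult_indicator) auto
      fix t :: real assume t: "t \<ge> 0"
      show "(norm (cutoff T 1 y t - y t))\<^sup>2 + (norm (cutoff_deriv T 1 y v t - v t))\<^sup>2 \<le> h t + k t"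
      proof (cases "t \<le> T")
        case True
        then show ?thesis by (simp add: cutoff_def cutoff_deriv_def h_def k_def)
      next
        case False
        have "(norm (cutoff T 1 y t))\<^sup>2 \<le> indicator {T<..T+1} t * (norm (y T))\<^sup>2"
        proof (cases "t \<le> T + 1")
          case True
          have "norm (cutoff T 1 y t) = (1 - (t - T)) * norm (y T)" using True False by (simp add: cutoff_def)
          also have "\<dots> \<le> 1 * norm (y T)" using False by (intro mult_right_mono) auto
          finally have "norm (cutoff T 1 y t) \<le> norm (y T)" by simp
          then show ?thesis using True False by (auto intro!: power_mono)
        qed (use False in \<open>simp add: cutoff_def\<close>)
        moreover have "(norm (cutoff_deriv T 1 y v t))\<^sup>2 \<le> indicator {T<..T+1} t * (norm (y T))\<^sup>2"
          using False by (auto simp: cutoff_deriv_def)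
        ultimately have "(norm (cutoff T 1 y t - y t))\<^sup>2 + (norm (cutoff_deriv T 1 y v t - v t))\<^sup>2
          \<le> 2 * (indicator {T<..T+1} t * (norm (y T))\<^sup>2) + 2 * (norm (y t))\<^sup>2 
            + (2 * (indicator {T<..T+1} t * (norm (y T))\<^sup>2) + 2 * (norm (v t))\<^sup>2)"
          using norm_diff_sq_le[of "cutoff T 1 y t" "y t"] norm_diff_sq_le[of "cutoff_deriv T 1 y v t" "v t"]
          by linarith
        also have "\<dots> = h t + k t"
          using False by (simp add: h_def k_def)
        finally show ?thesis .
      qed
    qed
    also have "\<dots> = (LINT t|lborel. h t + k t)"
      unfolding set_lebesgue_integral_def
      by (intro Bochner_Integration.integral_cong) (use T in \<open>auto simp: h_def k_def indicator_def\<close>)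
    also have "\<dots> = (LINT t|lborel. h t) + (LINT t|lborel. k t)"
      by (rule Bochner_Integration.integral_add[OF h k])
    also have "(LINT t|lborel. k t) = 4 * (norm (y T))\<^sup>2"
      unfolding k_def by simp
    also have "(LINT t|lborel. h t) = (LINT t:{T..}|lborel. 2 * ?h t)"
      unfolding h_def set_lebesgue_integral_def ..
    also have "\<dots> = 2 * (LINT t:{T..}|lborel. ?h t)"
      by (rule set_integral_mult_right)
    finally show ?thesis .
  qed
  have "(\<lambda>n. 2 * (LINT t:{real n..}|lborel. ?h t) + 4 * (norm (y (real n)))\<^sup>2) \<longlonglongrightarrow> 2 * 0 + 4 * (norm (0::'a))\<^sup>2"
    by (intro tendsto_intros tail_integral_tendsto_0 i is_W_tendsto_0[OF C y])
  then have lim: "(\<lambda>n. 2 * (LINT t:{real n..}|lborel. ?h t) + 4 * (norm (y (real n)))\<^sup>2) \<longlonglongrightarrow> 0"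
    by simp
  have "(\<lambda>n. (Wnorm (\<lambda>t. cutoff (real n) 1 y t - y t))\<^sup>2) \<longlonglongrightarrow> 0"
    by (rule Lim_null_comparison[OF _ lim]) (use bd in auto)
  then have "(\<lambda>n. sqrt ((Wnorm (\<lambda>t. cutoff (real n) 1 y t - y t))\<^sup>2)) \<longlonglongrightarrow> sqrt 0"
    by (rule tendsto_real_sqrt)
  then show ?thesis
    by (simp add: Wnorm_nonneg)
qed

section \<open>Strong measurability\<close>

text \<open>In a complete measure space a set that agrees almost everywhere with a measurable set is
  measurable, so preimages under \<open>f\<close> inherit measurability from those under
  \<open>g\<close>. This permits working with limits that exist only almost everywhere.\<close>

lemma (in complete_measure) borel_measurable_AE_cong:
  assumes g: "g \<in> borel_measurable M" and ae: "AE x in M. f x = g x"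
  shows "f \<in> borel_measurable M"
proof (rule measurableI)
  fix A :: "'b set" assume "A \<in> sets borel"
  then have "g -` A \<inter> space M \<in> sets M"
    using g by (rule measurable_sets[rotated])
  then show "f -` A \<inter> space M \<in> sets M"
    by (rule in_sets_AE[rotated]) (use ae in \<open>auto elim!: eventually_mono\<close>)
qed simp

lemma (in complete_measure) borel_measurable_AE_LIMSEQ:
  fixes f :: "'a \<Rightarrow> 'b::{banach, second_countable_topology}"
  assumes s: "\<And>k::nat. s k \<in> borel_measurable M" and ae: "AE x in M. (\<lambda>k. s k x) \<longlonglongrightarrow> f x"
  shows "f \<in> borel_measurable M"
proof (rule borel_measurable_AE_cong)
  show "(\<lambda>x. lim (\<lambda>k. s k x)) \<in> borel_measurable M"
    using s by (rule borel_measurable_lim_metric)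
  show "AE x in M. f x = lim (\<lambda>k. s k x)"
    using ae by eventually_elim (simp add: limI)
qed

text \<open>Translates the explicit conditions into \<open>simple_function\<close>, whose
  composition rules are used below. Only points of the finite range matter, because other points
  have empty preimage.\<close>

lemma strongly_meas_iff:
  "strongly_meas \<mu> Y \<longleftrightarrow> (\<exists>s. (\<forall>k. simple_function \<mu> (s k) \<and> (\<forall>x\<in>space \<mu>. is_W (s k x))) \<and>
     (AE x in \<mu>. (\<lambda>k::nat. Wnorm (\<lambda>t. s k x t - Y x t)) \<longlonglongrightarrow> 0))"
proof -
  have "(finite (g ` space \<mu>) \<and> (\<forall>x\<in>space \<mu>. is_W (g x)) \<and> (\<forall>v. g -` {v} \<inter> space \<mu> \<in> sets \<mu>)) \<longleftrightarrow>
    (simple_function \<mu> g \<and> (\<forall>x\<in>space \<mu>. is_W (g x)))" for g :: "'a \<Rightarrow> real \<Rightarrow> 'b"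
  proof -
    have "g -` {v} \<inter> space \<mu> = {}" if "v \<notin> g ` space \<mu>" for v
      using that by auto
    then have "(\<forall>v. g -` {v} \<inter> space \<mu> \<in> sets \<mu>) \<longleftrightarrow> (\<forall>v\<in>g ` space \<mu>. g -` {v} \<inter> space \<mu> \<in> sets \<mu>)"
      by (metis sets.empty_sets)
    then show ?thesis
      unfolding simple_function_def by blast
  qed
  then show ?thesis
    unfolding strongly_meas_def fun_diff_def by simp
qed

lemma tendsto_Wnorm_diff:
  assumes ab: "(\<lambda>k. Wnorm (\<lambda>t. a k t - b t)) \<longlonglongrightarrow> 0" and W: "\<And>k. is_W (a k)" "is_W b" "is_W c"
  shows "(\<lambda>k. Wnorm (\<lambda>t. c t - a k t)) \<longlonglongrightarrow> Wnorm (\<lambda>t. c t - b t)"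
proof (rule Lim_transform[OF tendsto_const])
  show "(\<lambda>k. Wnorm (\<lambda>t. c t - a k t) - Wnorm (\<lambda>t. c t - b t)) \<longlonglongrightarrow> 0"
  proof (rule Lim_null_comparison[OF _ ab], intro always_eventually allI)
    fix k
    show "norm (Wnorm (\<lambda>t. c t - a k t) - Wnorm (\<lambda>t. c t - b t)) \<le> Wnorm (\<lambda>t. a k t - b t)"
      using Wnorm_diff_triangle[OF W(3) W(1)[of k] W(2)] Wnorm_diff_triangle[OF W(3) W(2) W(1)[of k]]
        Wnorm_minus_commute[OF W(2) W(1)[of k]] by simp
  qed
qed

text \<open>Trajectories come with the function \<open>Wnorm\<close> but with no Borel structure, so
  measurability of a distance cannot be obtained by composing measurable maps. It is instead a
  limit: the distance of two simple functions is simple, and distances converge along the simple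
  functions approximating \<open>Y\<close>.\<close>

lemma measurable_Wnorm_diff:
  assumes compl: "complete_measure \<mu>" and Y: "strongly_meas \<mu> Y" "AE x in \<mu>. is_W (Y x)"
    and s: "simple_function \<mu> s" "\<And>x. x \<in> space \<mu> \<Longrightarrow> is_W (s x)"
  shows "(\<lambda>x. Wnorm (\<lambda>t. s x t - Y x t)) \<in> borel_measurable \<mu>"
proof -
  obtain r where r: "\<And>k. simple_function \<mu> (r k)" "\<And>k x. x \<in> space \<mu> \<Longrightarrow> is_W (r k x)"
    "AE x in \<mu>. (\<lambda>k::nat. Wnorm (\<lambda>t. r k x t - Y x t)) \<longlonglongrightarrow> 0"
    using Y(1) unfolding strongly_meas_iff by blast
  show ?thesis
  proof (rule complete_measure.borel_measurable_AE_LIMSEQ[OF compl])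
    show "(\<lambda>x. Wnorm (\<lambda>t. s x t - r k x t)) \<in> borel_measurable \<mu>" for k
      by (rule borel_measurable_simple_function)
        (rule simple_function_compose2[OF s(1) r(1)[of k], of "\<lambda>a b. Wnorm (\<lambda>t. a t - b t)"])
    show "AE x in \<mu>. (\<lambda>k. Wnorm (\<lambda>t. s x t - r k x t)) \<longlonglongrightarrow> Wnorm (\<lambda>t. s x t - Y x t)"
      using r(3) Y(2) AE_space
    proof eventually_elim
      case (elim x)
      then show ?case
        using r(2) s(2) by (intro tendsto_Wnorm_diff) auto
    qed
  qed
qed

text \<open>On a finite measure space convergence almost everywhere implies convergence in measure.
  So each \<open>Z k\<close> has a simple function within \<open>(1/2)^k\<close> of it outside a set
  of measure below \<open>(1/2)^k\<close>. By the Borel-Cantelli lemma almost every point lies in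
  finitely many of these exceptional sets only, and there the chosen simple functions converge to
  \<open>Y\<close>.\<close>

lemma strongly_meas_LIMSEQ:
  assumes fin: "finite_measure \<mu>" and compl: "complete_measure \<mu>"
    and Z: "\<And>k::nat. strongly_meas \<mu> (Z k)" "\<And>k. AE x in \<mu>. is_W (Z k x)"
    and Y: "AE x in \<mu>. is_W (Y x)" and lim: "AE x in \<mu>. (\<lambda>k. Wnorm (\<lambda>t. Z k x t - Y x t)) \<longlonglongrightarrow> 0"
  shows "strongly_meas \<mu> Y"
proof -
  interpret finite_measure \<mu> by fact
  have "\<exists>s. simple_function \<mu> s \<and> (\<forall>x\<in>space \<mu>. is_W (s x)) \<and>
    measure \<mu> {x \<in> space \<mu>. Wnorm (\<lambda>t. s x t - Z k x t) > (1/2)^k} < (1/2)^k" for k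
  proof -
    obtain r where r: "\<And>j. simple_function \<mu> (r j)" "\<And>j x. x \<in> space \<mu> \<Longrightarrow> is_W (r j x)"
      "AE x in \<mu>. (\<lambda>j::nat. Wnorm (\<lambda>t. r j x t - Z k x t)) \<longlonglongrightarrow> 0"
      using Z(1)[of k] unfolding strongly_meas_iff by blast
    define A where "A j = {x \<in> space \<mu>. Wnorm (\<lambda>t. r j x t - Z k x t) > (1/2)^k}" for j
    have [measurable]: "(\<lambda>x. Wnorm (\<lambda>t. r j x t - Z k x t)) \<in> borel_measurable \<mu>" for j
      by (rule measurable_Wnorm_diff[OF compl Z(1,2) r(1,2)])
    have A: "A j \<in> sets \<mu>" for j
      unfolding A_def by measurable
    have "(\<lambda>j. LINT x|\<mu>. indicat_real (A j) x) \<longlonglongrightarrow> (LINT x|\<mu>. 0)"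
    proof (rule integral_dominated_convergence[where w="\<lambda>_. 1"])
      show "AE x in \<mu>. (\<lambda>j. indicat_real (A j) x) \<longlonglongrightarrow> 0"
        using r(3)
      proof eventually_elim
        case (elim x)
        have "eventually (\<lambda>j. Wnorm (\<lambda>t. r j x t - Z k x t) < (1/2)^k) sequentially"
          using elim by (rule order_tendstoD) simp
        then have "eventually (\<lambda>j. indicat_real (A j) x = 0) sequentially"
          by eventually_elim (auto simp: A_def indicator_def)
        then show ?case by (rule tendsto_eventually)
      qed
    qed (use A in \<open>auto simp: indicator_def\<close>)
    moreover have "(LINT x|\<mu>. indicat_real (A j) x) = measure \<mu> (A j)" for j
      using A by simp
    ultimately have "(\<lambda>j. measure \<mu> (A j)) \<longlonglongrightarrow> 0"
      by simp
    then have "eventually (\<lambda>j. measure \<mu> (A j) < (1/2)^k) sequentially"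
      by (rule order_tendstoD) simp
    then obtain j where "measure \<mu> (A j) < (1/2)^k"
      by (auto simp: eventually_sequentially)
    then show ?thesis
      using r(1,2) unfolding A_def by blast
  qed
  then have "\<forall>k. \<exists>s. simple_function \<mu> s \<and> (\<forall>x\<in>space \<mu>. is_W (s x)) \<and>
    measure \<mu> {x \<in> space \<mu>. Wnorm (\<lambda>t. s x t - Z k x t) > (1/2)^k} < (1/2)^k"
    by blast
  from choice[OF this] obtain s where s: "\<And>k. simple_function \<mu> (s k)" "\<And>k x. x \<in> space \<mu> \<Longrightarrow> is_W (s k x)"
    "\<And>k. measure \<mu> {x \<in> space \<mu>. Wnorm (\<lambda>t. s k x t - Z k x t) > (1/2)^k} < (1/2)^k"
    by blast
  define A where "A k = {x \<in> space \<mu>. Wnorm (\<lambda>t. s k x t - Z k x t) > (1/2)^k}" for k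
  have [measurable]: "(\<lambda>x. Wnorm (\<lambda>t. s k x t - Z k x t)) \<in> borel_measurable \<mu>" for k
    by (rule measurable_Wnorm_diff[OF compl Z s(1,2)])
  have "AE x in \<mu>. eventually (\<lambda>k. x \<in> space \<mu> - A k) sequentially"
  proof (rule borel_cantelli_AE1)
    show "A k \<in> sets \<mu>" for k unfolding A_def by measurable
    show "emeasure \<mu> (A k) < \<infinity>" for k by (simp add: less_top[symmetric])
    show "summable (\<lambda>k. measure \<mu> (A k))"
      by (rule summable_comparison_test'[where g="\<lambda>k. (1/2)^k" and N=0])
        (use s(3) in \<open>auto simp: A_def less_imp_le summable_geometric\<close>)
  qed
  moreover have "AE x in \<mu>. \<forall>k. is_W (Z k x)"
    using Z(2) by (simp add: AE_all_countable)
  ultimately have "AE x in \<mu>. (\<lambda>k. Wnorm (\<lambda>t. s k x t - Y x t)) \<longlonglongrightarrow> 0"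
    using Y lim AE_space
  proof eventually_elim
    case (elim x)
    have "(\<lambda>k. (1/2)^k + Wnorm (\<lambda>t. Z k x t - Y x t)) \<longlonglongrightarrow> 0 + 0"
      using elim by (intro tendsto_add LIMSEQ_realpow_zero) auto
    then have l: "(\<lambda>k. (1/2)^k + Wnorm (\<lambda>t. Z k x t - Y x t)) \<longlonglongrightarrow> 0"
      by simp
    have "eventually (\<lambda>k. norm (Wnorm (\<lambda>t. s k x t - Y x t)) \<le> (1/2)^k + Wnorm (\<lambda>t. Z k x t - Y x t)) sequentially"
      using elim(1)
    proof eventually_elim
      case (elim k)
      then show ?case
        using Wnorm_diff_triangle[OF s(2)[of x k], of "Z k x" "Y x"] \<open>\<forall>k. is_W (Z k x)\<close> \<open>is_W (Y x)\<close>
        by (auto simp: A_def Wnorm_nonneg)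
    qed
    then show ?case
      by (rule Lim_null_comparison[OF _ l])
  qed
  then show ?thesis
    unfolding strongly_meas_iff using s(1,2) by blast
qed

text \<open>Evaluation at a fixed time is continuous for \<open>Wnorm\<close> by the embedding
  inequality. This is the link from strong measurability to the joint measurability needed for
  integrating the cost over the ensemble.\<close>

lemma strongly_meas_eval_measurable:
  fixes Y :: "'x \<Rightarrow> real \<Rightarrow> 'a::euclidean_space"
  assumes C: "\<And>y :: real \<Rightarrow> 'a. is_W y \<Longrightarrow> \<forall>t\<ge>0. norm (y t) \<le> C * Wnorm y"
    and compl: "complete_measure \<mu>"
    and Y: "strongly_meas \<mu> Y" "AE x in \<mu>. is_W (Y x)" and t: "t \<ge> 0"
  shows "(\<lambda>x. Y x t) \<in> borel_measurable \<mu>"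
proof -
  obtain r where r: "\<And>j. simple_function \<mu> (r j)" "\<And>j x. x \<in> space \<mu> \<Longrightarrow> is_W (r j x)"
    "AE x in \<mu>. (\<lambda>j::nat. Wnorm (\<lambda>t. r j x t - Y x t)) \<longlonglongrightarrow> 0"
    using Y(1) unfolding strongly_meas_iff by blast
  show ?thesis
  proof (rule complete_measure.borel_measurable_AE_LIMSEQ[OF compl])
    show "(\<lambda>x. r j x t) \<in> borel_measurable \<mu>" for j
      by (rule borel_measurable_simple_function, rule simple_function_compose1[OF r(1)])
    show "AE x in \<mu>. (\<lambda>j. r j x t) \<longlonglongrightarrow> Y x t"
      using r(3) Y(2) AE_space
    proof eventually_elim
      case (elim x)
      then have "(\<lambda>j. C * Wnorm (\<lambda>t. r j x t - Y x t)) \<longlonglongrightarrow> C * 0"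
        by (intro tendsto_mult_left)
      then have l: "(\<lambda>j. C * Wnorm (\<lambda>t. r j x t - Y x t)) \<longlonglongrightarrow> 0" by simp
      have "norm (r j x t - Y x t) \<le> C * Wnorm (\<lambda>t. r j x t - Y x t)" for j
        using C[OF is_W_diff[OF r(2)[of x j]], of "Y x"] t elim by auto
      then have "(\<lambda>j. r j x t - Y x t) \<longlonglongrightarrow> 0"
        by (intro Lim_null_comparison[OF _ l]) simp
      then show ?case by (simp add: LIM_zero_iff)
    qed
  qed
qed

text \<open>Truncation is linear and bounded, so it carries approximating simple functions to
  approximating simple functions. In the operator bound \<open>sqrt (1 + 2 * C\<^sup>2)\<close> the
  1 accounts for the trajectory up to \<open>T\<close>, and the rest for the ramp, whose height is
  estimated by the embedding inequality.\<close>

lemma strongly_meas_cutoff: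
  fixes Y :: "'x \<Rightarrow> real \<Rightarrow> 'a::euclidean_space"
  assumes C: "\<And>y :: real \<Rightarrow> 'a. is_W y \<Longrightarrow> \<forall>t\<ge>0. norm (y t) \<le> C * Wnorm y"
    and Y: "strongly_meas \<mu> Y" "AE x in \<mu>. is_W (Y x)" and T: "T \<ge> 0"
  shows "strongly_meas \<mu> (\<lambda>x. cutoff T 1 (Y x))"
proof -
  have bd: "Wnorm (cutoff T 1 z) \<le> sqrt (1 + 2 * C\<^sup>2) * Wnorm z" if z: "is_W z" for z :: "real \<Rightarrow> 'a"
  proof (rule power2_le_imp_le)
    obtain v where v: "has_Wderiv z v" using z by (auto simp: is_W_def)
    have L: "L2fun z" "L2fun v" using z v has_WderivD by (auto simp: is_W_def)
    have i: "set_integrable lborel {0..} (\<lambda>t. (norm (z t))\<^sup>2 + (norm (v t))\<^sup>2)"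
      using L by (intro set_integral_add) (auto simp: L2fun_def)
    have "(Wnorm (cutoff T 1 z))\<^sup>2 \<le> (LINT t:{0..T}|lborel. (norm (z t))\<^sup>2 + (norm (v t))\<^sup>2) + 2 * (norm (z T))\<^sup>2"
      by (rule Wnorm_sq_cutoff_le[OF v T])
    also have "(LINT t:{0..T}|lborel. (norm (z t))\<^sup>2 + (norm (v t))\<^sup>2) \<le> (Wnorm z)\<^sup>2"
      unfolding Wnorm_sq[OF L(1) v] set_lebesgue_integral_def
    proof (rule integral_mono)
      show "integrable lborel (\<lambda>t. indicat_real {0..T} t *\<^sub>R ((norm (z t))\<^sup>2 + (norm (v t))\<^sup>2))"
        using set_integrable_subset[OF i, of "{0..T}"] by (auto simp: set_integrable_def)
      show "integrable lborel (\<lambda>t. indicat_real {0..} t *\<^sub>R ((norm (z t))\<^sup>2 + (norm (v t))\<^sup>2))"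
        using i by (simp add: set_integrable_def)
    qed (auto simp: indicator_def)
    also have "(norm (z T))\<^sup>2 \<le> (C * Wnorm z)\<^sup>2"
      using C[OF z] T by (intro power_mono) auto
    finally have "(Wnorm (cutoff T 1 z))\<^sup>2 \<le> (1 + 2 * C\<^sup>2) * (Wnorm z)\<^sup>2"
      by (simp add: power_mult_distrib algebra_simps)
    then show "(Wnorm (cutoff T 1 z))\<^sup>2 \<le> (sqrt (1 + 2 * C\<^sup>2) * Wnorm z)\<^sup>2"
      by (simp add: power_mult_distrib)
  qed (simp add: Wnorm_nonneg)
  obtain r where r: "\<And>j. simple_function \<mu> (r j)" "\<And>j x. x \<in> space \<mu> \<Longrightarrow> is_W (r j x)"
    "AE x in \<mu>. (\<lambda>j::nat. Wnorm (\<lambda>t. r j x t - Y x t)) \<longlonglongrightarrow> 0"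
    using Y(1) unfolding strongly_meas_iff by blast
  have "AE x in \<mu>. (\<lambda>j::nat. Wnorm (\<lambda>t. cutoff T 1 (r j x) t - cutoff T 1 (Y x) t)) \<longlonglongrightarrow> 0"
    using r(3) Y(2) AE_space
  proof eventually_elim
    case (elim x)
    then have "(\<lambda>j. sqrt (1 + 2 * C\<^sup>2) * Wnorm (\<lambda>t. r j x t - Y x t)) \<longlonglongrightarrow> sqrt (1 + 2 * C\<^sup>2) * 0"
      by (intro tendsto_mult_left)
    then have l: "(\<lambda>j. sqrt (1 + 2 * C\<^sup>2) * Wnorm (\<lambda>t. r j x t - Y x t)) \<longlonglongrightarrow> 0" by simp
    have "norm (Wnorm (\<lambda>t. cutoff T 1 (r j x) t - cutoff T 1 (Y x) t)) \<le> sqrt (1 + 2 * C\<^sup>2) * Wnorm (\<lambda>t. r j x t - Y x t)" for j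
      using bd[OF is_W_diff[OF r(2)[of x j]], of "Y x"] elim by (simp add: cutoff_diff Wnorm_nonneg)
    then show ?case
      by (intro Lim_null_comparison[OF _ l]) simp
  qed
  moreover have "simple_function \<mu> (\<lambda>x. cutoff T 1 (r j x))" for j
    by (rule simple_function_compose1[OF r(1)])
  moreover have "is_W (cutoff T 1 (r j x))" if "x \<in> space \<mu>" for j x
    using has_Wderiv_Wderiv[OF r(2)[OF that]] T by (intro is_W_cutoff) auto
  ultimately show ?thesis
    unfolding strongly_meas_iff by (intro exI[of _ "\<lambda>j x. cutoff T 1 (r j x)"]) blast
qed

section \<open>Ensemble solutions solve the closed-loop equation pointwise\<close>

text \<open>Since \<open>h\<close> vanishes at 0, Lipschitz continuity becomes linear growth, which
  preserves square integrability on the unbounded half-line. Here the normalization of the feedback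
  laws at 0 enters.\<close>

lemma L2fun_lipschitz_comp:
  fixes y :: "real \<Rightarrow> 'a::euclidean_space" and h :: "'a \<Rightarrow> 'b::euclidean_space"
  assumes y: "is_W y" "\<And>t. t \<ge> 0 \<Longrightarrow> y t \<in> cball 0 R" and h: "K-lipschitz_on (cball 0 R) h" "h 0 = 0"
  shows "L2fun (\<lambda>t. h (y t))"
proof (rule L2fun_bound)
  obtain v where "has_Wderiv y v" using y by (auto simp: is_W_def)
  then have "continuous_on {0..} y" by (rule has_Wderiv_continuous_on)
  then have "continuous_on {0..} (\<lambda>t. h (y t))"
    using y(2) by (intro continuous_on_compose2[OF lipschitz_on_continuous_on[OF h(1)]]) auto
  then show "set_borel_measurable lborel {0..} (\<lambda>t. h (y t))"
    using set_measurable_continuous_on[of "{0..}" "\<lambda>t. h (y t)"] by (simp add: set_borel_measurable_def)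
  show "set_integrable lborel {0..} (\<lambda>t. K\<^sup>2 * (norm (y t))\<^sup>2)"
    using y by (intro set_integrable_mult_right) (auto simp: is_W_def L2fun_def)
  fix t :: real assume t: "t \<ge> 0"
  have "0 \<in> cball (0::'a) R"
    using y(2)[OF t] order_trans[OF norm_ge_zero] by auto
  then have "norm (h (y t)) \<le> K * norm (y t)"
    using lipschitz_onD[OF h(1) y(2)[OF t], of 0] h(2) by (simp add: dist_norm)
  then have "(norm (h (y t)))\<^sup>2 \<le> (K * norm (y t))\<^sup>2"
    by (intro power_mono) auto
  then show "(norm (h (y t)))\<^sup>2 \<le> K\<^sup>2 * (norm (y t))\<^sup>2"
    by (simp add: power_mult_distrib)
qed

text \<open>The primitive itself may fail to be square integrable; \<open>has_Wderiv\<close> demands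
  this of the derivative only, so continuity of primitives is available for every such
  \<open>w\<close>.\<close>

lemma has_Wderiv_primitive:
  assumes "L2fun w"
  shows "has_Wderiv (\<lambda>t. LINT s:{0..t}|lborel. w s) w"
proof (rule has_WderivI[OF assms])
  have "(LINT s:{0..0}|lborel. w s) = (LINT s:{}|lborel. w s)"
  proof (rule set_integral_cong_set)
    show "set_borel_measurable lborel {0..0} w" "set_borel_measurable lborel {} w"
      by (rule set_borel_measurable_lborel_subset[where A="{0..}"]; use assms in \<open>auto simp: L2fun_def\<close>)+
    show "AE x in lborel. (x \<in> {}) = (x \<in> {0..(0::real)})"
      using AE_lborel_singleton[of "0::real"] by eventually_elim auto
  qed
  then show "(LINT s:{0..t}|lborel. w s) = (LINT s:{0..0}|lborel. w s) + (LINT s:{0..t}|lborel. w s)" for t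
    by (simp add: set_lebesgue_integral_def)
qed

text \<open>The ramps shrink to the indicator of [0,T] pointwise. Since every slope
  \<open>Suc n\<close> is at least one, all of them vanish after \<open>T + 1\<close>, and
  \<open>g\<close> restricted to [0,T+1] provides the integrable majorant.\<close>

lemma L2inner_cutoff_tendsto:
  fixes g :: "real \<Rightarrow> 'a::euclidean_space"
  assumes g: "L2fun g" and T: "T \<ge> 0"
  shows "(\<lambda>n. L2inner g (cutoff T (real (Suc n)) (\<lambda>_. e))) \<longlonglongrightarrow> (LINT t:{0..T}|lborel. g t) \<bullet> e"
proof -
  have gi: "integrable lborel (\<lambda>t. indicator {0..T} t *\<^sub>R g t)" "integrable lborel (\<lambda>t. indicator {0..T+1} t *\<^sub>R g t)"
    using L2fun_integrable_Icc[OF g, of 0] by (auto simp: set_integrable_def)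
  have "(\<lambda>n. LINT t|lborel. indicat_real {0..} t *\<^sub>R (g t \<bullet> cutoff T (real (Suc n)) (\<lambda>_. e) t)) \<longlonglongrightarrow>
    (LINT t|lborel. (indicat_real {0..T} t *\<^sub>R g t) \<bullet> e)"
  proof (rule integral_dominated_convergence)
    show "integrable lborel (\<lambda>t. norm (indicat_real {0..T+1} t *\<^sub>R g t) * norm e)"
      using gi(2) by (intro integrable_mult_left integrable_norm)
    show "(\<lambda>t. (indicat_real {0..T} t *\<^sub>R g t) \<bullet> e) \<in> borel_measurable lborel"
      using gi(1) by (intro borel_measurable_integrable integrable_inner_left)
    show "(\<lambda>t. indicat_real {0..} t *\<^sub>R (g t \<bullet> cutoff T (real (Suc n)) (\<lambda>_. e) t)) \<in> borel_measurable lborel" for n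
      using L2fun_inner_integrable[OF g L2fun_cutoff[OF has_Wderiv_const[of e] T, of "real (Suc n)"]]
      by (auto simp: set_integrable_def)
    show "AE t in lborel. norm (indicat_real {0..} t *\<^sub>R (g t \<bullet> cutoff T (real (Suc n)) (\<lambda>_. e) t))
       \<le> norm (indicat_real {0..T+1} t *\<^sub>R g t) * norm e" for n
    proof (rule AE_I2)
      fix t :: real
      have le: "max 0 (1 - real (Suc n) * (t - T)) \<le> indicat_real {..T+1} t" if "t > T"
      proof (cases "t \<le> T + 1")
        case False
        then have "1 * 1 \<le> real (Suc n) * (t - T)"
          by (intro mult_mono) auto
        then show ?thesis by auto
      qed (use that in auto)
      have "norm (cutoff T (real (Suc n)) (\<lambda>_. e) t) \<le> indicat_real {..T+1} t * norm e"
        using mult_right_mono[OF le, of "norm e"] by (auto simp: cutoff_def)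
      then have "\<bar>g t \<bullet> cutoff T (real (Suc n)) (\<lambda>_. e) t\<bar> \<le> norm (g t) * (indicat_real {..T+1} t * norm e)"
        using Cauchy_Schwarz_ineq2[of "g t" "cutoff T (real (Suc n)) (\<lambda>_. e) t"]
        by (meson mult_left_mono norm_ge_zero order_trans)
      then show "norm (indicat_real {0..} t *\<^sub>R (g t \<bullet> cutoff T (real (Suc n)) (\<lambda>_. e) t))
         \<le> norm (indicat_real {0..T+1} t *\<^sub>R g t) * norm e"
        by (auto simp: indicator_def)
    qed
    show "AE t in lborel. (\<lambda>n. indicat_real {0..} t *\<^sub>R (g t \<bullet> cutoff T (real (Suc n)) (\<lambda>_. e) t))
       \<longlonglongrightarrow> (indicat_real {0..T} t *\<^sub>R g t) \<bullet> e"
    proof (rule AE_I2)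
      fix t :: real
      show "(\<lambda>n. indicat_real {0..} t *\<^sub>R (g t \<bullet> cutoff T (real (Suc n)) (\<lambda>_. e) t)) \<longlonglongrightarrow> (indicat_real {0..T} t *\<^sub>R g t) \<bullet> e"
      proof (cases "t \<le> T")
        case True
        then show ?thesis by (simp add: cutoff_def indicator_def)
      next
        case False
        then obtain m :: nat where m: "1 / (t - T) < real m" using reals_Archimedean2 by blast
        have "cutoff T (real (Suc n)) (\<lambda>_. e) t = 0" if "n \<ge> m" for n
        proof -
          have "1 / (t - T) \<le> real (Suc n)" using m that by linarith
          then have "1 \<le> real (Suc n) * (t - T)" using False by (simp add: field_simps)
          then show ?thesis using False by (simp add: cutoff_def)
        qed
        then have "eventually (\<lambda>n. indicat_real {0..} t *\<^sub>R (g t \<bullet> cutoff T (real (Suc n)) (\<lambda>_. e) t) = 0) sequentially"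
          unfolding eventually_sequentially by (intro exI[of _ m]) simp
        then have "(\<lambda>n. indicat_real {0..} t *\<^sub>R (g t \<bullet> cutoff T (real (Suc n)) (\<lambda>_. e) t)) \<longlonglongrightarrow> 0"
          by (rule tendsto_eventually)
        then show ?thesis using False by simp
      qed
    qed
  qed
  also have "(LINT t|lborel. (indicat_real {0..T} t *\<^sub>R g t) \<bullet> e) = (LINT t:{0..T}|lborel. g t) \<bullet> e"
    unfolding set_lebesgue_integral_def using gi(1) by (intro integral_inner_left) simp
  finally show ?thesis
    by (simp add: L2inner_def set_lebesgue_integral_def)
qed

text \<open>The hypothesis \<open>weak\<close> involves a countable family of test functions, so
  that one null set of initial values can serve for all of them. Letting the slope tend to infinity
  gives the integral equation at positive rational times; both sides are continuous and these times
  are dense in the half-line.\<close>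

lemma integral_eq_if_weak_eq:
  fixes y :: "real \<Rightarrow> 'a::euclidean_space"
  assumes y: "has_Wderiv y v" and w: "L2fun w"
    and weak: "\<And>T e n. T \<in> \<rat> \<Longrightarrow> T > 0 \<Longrightarrow> e \<in> Basis \<Longrightarrow>
      L2inner (\<lambda>t. v t - w t) (cutoff T (real (Suc n)) (\<lambda>_. e)) + (y 0 - x) \<bullet> cutoff T (real (Suc n)) (\<lambda>_. e) 0 = 0"
    and t: "t \<ge> 0"
  shows "y t = x + (LINT s:{0..t}|lborel. w s)"
proof -
  have v: "L2fun v" using has_WderivD(1)[OF y] .
  have eq: "y T - (LINT s:{0..T}|lborel. w s) = x" if T: "T \<in> {0<..} \<inter> \<rat>" for T
  proof -
    have T0: "T > 0" "T \<ge> 0" "T \<in> \<rat>" using T by auto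
    have "((LINT t:{0..T}|lborel. v t - w t) + (y 0 - x)) \<bullet> e = 0" if e: "e \<in> Basis" for e
    proof -
      have "(\<lambda>n. L2inner (\<lambda>t. v t - w t) (cutoff T (real (Suc n)) (\<lambda>_. e)) + (y 0 - x) \<bullet> e) \<longlonglongrightarrow>
          (LINT t:{0..T}|lborel. v t - w t) \<bullet> e + (y 0 - x) \<bullet> e"
        by (intro tendsto_add tendsto_const L2inner_cutoff_tendsto L2fun_diff v w T0)
      moreover have "L2inner (\<lambda>t. v t - w t) (cutoff T (real (Suc n)) (\<lambda>_. e)) + (y 0 - x) \<bullet> e = 0" for n
        using weak[OF T0(3,1) e, of n] T0 by (simp add: cutoff_def[of _ _ _ 0])
      ultimately have "(LINT t:{0..T}|lborel. v t - w t) \<bullet> e + (y 0 - x) \<bullet> e = 0"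
        by (simp add: LIMSEQ_const_iff)
      then show ?thesis by (simp add: inner_add_left)
    qed
    then have "(LINT t:{0..T}|lborel. v t - w t) + (y 0 - x) = 0"
      using euclidean_eqI[of "(LINT t:{0..T}|lborel. v t - w t) + (y 0 - x)" 0] by simp
    moreover have "(LINT t:{0..T}|lborel. v t - w t) = (LINT t:{0..T}|lborel. v t) - (LINT t:{0..T}|lborel. w t)"
      using L2fun_integrable_Icc[OF v, of 0 T] L2fun_integrable_Icc[OF w, of 0 T] by (intro set_integral_diff) auto
    ultimately show ?thesis
      using has_WderivD(3)[OF y T0(2)] by (simp add: algebra_simps)
  qed
  have cl: "closure ({0<..} \<inter> \<rat>) = {0::real..}"
  proof
    show "closure ({0<..} \<inter> \<rat>) \<subseteq> {0::real..}"
      by (intro closure_minimal) auto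
    have "{0::real<..} \<subseteq> closure ({0<..} \<inter> \<rat>)"
      using open_Int_closure_subset[of "{0::real<..}" \<rat>] by (simp add: Rats_closure_real)
    then have "closure {0::real<..} \<subseteq> closure ({0<..} \<inter> \<rat>)"
      by (intro closure_minimal) auto
    then show "{0::real..} \<subseteq> closure ({0<..} \<inter> \<rat>)" by simp
  qed
  have "continuous_on {0..} (\<lambda>T. y T - (LINT s:{0..T}|lborel. w s))"
    using has_Wderiv_continuous_on[OF y] has_Wderiv_continuous_on[OF has_Wderiv_primitive[OF w]]
    by (intro continuous_on_diff)
  then have "y t - (LINT s:{0..t}|lborel. w s) = x"
    using continuous_constant_on_closure[where S="{0<..} \<inter> \<rat>" and f="\<lambda>T. y T - (LINT s:{0..T}|lborel. w s)", OF _ eq]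
      t unfolding cl by simp
  then show ?thesis by (simp add: algebra_simps)
qed

section \<open>Localization in the initial value\<close>

text \<open>Supplies the test functions that restrict the averaged weak formulation to a measurable
  set of initial values.\<close>

lemma L2W_indicator:
  assumes "finite_measure \<mu>" and A: "A \<in> sets \<mu>" and \<phi>: "is_W \<phi>"
  shows "L2W \<mu> (\<lambda>x. if x \<in> A then \<phi> else (\<lambda>_. 0))"
proof -
  interpret finite_measure \<mu> by fact
  have "simple_function \<mu> (\<lambda>x. (\<lambda>r::real. if r = 1 then \<phi> else (\<lambda>_. 0)) (indicator A x))"
    using A by (rule simple_function_compose1[OF simple_function_indicator])
  also have "(\<lambda>x. (\<lambda>r::real. if r = 1 then \<phi> else (\<lambda>_. 0)) (indicator A x)) = (\<lambda>x. if x \<in> A then \<phi> else (\<lambda>_. 0))"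
    by (auto simp: indicator_def)
  finally have s: "simple_function \<mu> (\<lambda>x. if x \<in> A then \<phi> else (\<lambda>_. 0))" .
  have W: "is_W (if x \<in> A then \<phi> else (\<lambda>_. 0))" for x
    using \<phi> by (auto intro: is_W_zero)
  have "strongly_meas \<mu> (\<lambda>x. if x \<in> A then \<phi> else (\<lambda>_. 0))"
    unfolding strongly_meas_iff
    by (rule exI[of _ "\<lambda>_ x. if x \<in> A then \<phi> else (\<lambda>_. 0)"]) (use s W in \<open>simp add: Wnorm_zero\<close>)
  moreover have "integrable \<mu> (\<lambda>x. (Wnorm (if x \<in> A then \<phi> else (\<lambda>_. 0)))\<^sup>2)"
  proof -
    have "integrable \<mu> (\<lambda>x. indicat_real A x * (Wnorm \<phi>)\<^sup>2)"
      using A by (intro integrable_mult_left) (simp add: less_top[symmetric])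
    also have "(\<lambda>x. indicat_real A x * (Wnorm \<phi>)\<^sup>2) = (\<lambda>x. (Wnorm (if x \<in> A then \<phi> else (\<lambda>_. 0)))\<^sup>2)"
      by (auto simp: Wnorm_zero)
    finally show ?thesis .
  qed
  ultimately show ?thesis
    using W by (simp add: L2W_def)
qed

text \<open>Testing with \<phi> on a measurable set \<open>A\<close> and zero elsewhere shows that
  the form integrates to zero over every \<open>A\<close>, which forces it to vanish almost
  everywhere. The exceptional null set depends on \<phi>.\<close>

lemma ens_sol_AE_aform_zero:
  assumes fin: "finite_measure \<mu>" and sol: "ens_sol \<mu> f B b F Y" and \<phi>: "is_W \<phi>"
  shows "AE x in \<mu>. aform f B F (Y x) x \<phi> = 0"
proof -
  interpret finite_measure \<mu> by fact
  have test: "integrable \<mu> (\<lambda>x. aform f B F (Y x) x (\<Phi> x))" "(\<integral>x. aform f B F (Y x) x (\<Phi> x) \<partial>\<mu>) = 0"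
    if "L2W \<mu> \<Phi>" for \<Phi>
    using sol that by (auto simp: ens_sol_def)
  have zero: "aform f B F y x (\<lambda>_. 0) = 0" for y x
    by (simp add: aform_def L2inner_def)
  show ?thesis
  proof (rule density_zero)
    have "integrable \<mu> (\<lambda>x. aform f B F (Y x) x (if x \<in> space \<mu> then \<phi> else (\<lambda>_. 0)))"
      by (intro test L2W_indicator fin \<phi>) simp
    then show "integrable \<mu> (\<lambda>x. aform f B F (Y x) x \<phi>)"
      by (simp cong: Bochner_Integration.integrable_cong)
    fix A assume A: "A \<in> sets \<mu>"
    have "(\<integral>x. aform f B F (Y x) x (if x \<in> A then \<phi> else (\<lambda>_. 0)) \<partial>\<mu>) = 0"
      by (intro test L2W_indicator fin \<phi> A)
    also have "(\<integral>x. aform f B F (Y x) x (if x \<in> A then \<phi> else (\<lambda>_. 0)) \<partial>\<mu>) = set_lebesgue_integral \<mu> A (\<lambda>x. aform f B F (Y x) x \<phi>)"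
      unfolding set_lebesgue_integral_def
      by (intro Bochner_Integration.integral_cong refl) (simp add: zero indicator_def)
    finally show "set_lebesgue_integral \<mu> A (\<lambda>x. aform f B F (Y x) x \<phi>) = 0" .
  qed
qed

text \<open>The counterpart of \<open>ens_sol\<close> for a single initial value. The norm bound is
  included because, through the embedding inequality, it confines the trajectory to the ball on
  which the right-hand side is Lipschitz.\<close>

definition ode_sol :: "('a::euclidean_space \<Rightarrow> 'a) \<Rightarrow> real \<Rightarrow> 'a \<Rightarrow> (real \<Rightarrow> 'a) \<Rightarrow> bool" where
  "ode_sol h b x y \<longleftrightarrow> is_W y \<and> Wnorm y \<le> b \<and> (\<forall>t\<ge>0. y t = x + (LINT s:{0..t}|lborel. h (y s)))"

lemma ens_sol_imp_ode_sol:
  fixes Y :: "real^'n \<Rightarrow> real \<Rightarrow> real^'n" and B :: "real^'m^'n"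
  assumes C: "C > 0" "\<And>y :: real \<Rightarrow> real^'n. is_W y \<Longrightarrow> \<forall>t\<ge>0. norm (y t) \<le> C * Wnorm y"
    and fin: "finite_measure \<mu>" and sol: "ens_sol \<mu> f B b F Y"
    and h: "K-lipschitz_on (cball 0 (C * b)) (\<lambda>z. f z + B *v F z)" "f 0 + B *v F 0 = 0"
  shows "AE x in \<mu>. ode_sol (\<lambda>z. f z + B *v F z) b x (Y x)"
proof -
  let ?h = "\<lambda>z. f z + B *v F z"
  let ?P = "\<lambda>T e n x. aform f B F (Y x) x (cutoff T (real (Suc n)) (\<lambda>_. e)) = 0"
  have "AE x in \<mu>. ?P T e n x" if "T > 0" for T e n
    using that by (intro ens_sol_AE_aform_zero[OF fin sol] is_W_cutoff[OF has_Wderiv_const]) auto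
  \<comment> \<open>Rational times, basis vectors and integer slopes are countably many, so the
    exceptional sets merge into one null set.\<close>
  then have "AE x in \<mu>. \<forall>T\<in>\<rat> \<inter> {0<..}. \<forall>e\<in>Basis. \<forall>n. ?P T e n x"
    by (simp add: AE_ball_countable countable_rat AE_all_countable countable_finite)
  moreover have "AE x in \<mu>. is_W (Y x) \<and> Wnorm (Y x) \<le> b"
    using sol by (auto simp: ens_sol_def)
  ultimately show ?thesis
  proof eventually_elim
    case (elim x)
    have yR: "Y x t \<in> cball 0 (C * b)" if "t \<ge> 0" for t
    proof -
      have "norm (Y x t) \<le> C * Wnorm (Y x)" using C(2) elim that by blast
      also have "\<dots> \<le> C * b" using elim C(1) by (intro mult_left_mono) auto
      finally show ?thesis by simp
    qed
    have "Y x t = x + (LINT s:{0..t}|lborel. ?h (Y x s))" if "t \<ge> 0" for t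
    proof (rule integral_eq_if_weak_eq[OF _ _ _ that])
      show "has_Wderiv (Y x) (Wderiv (Y x))"
        using elim has_Wderiv_Wderiv by blast
      show "L2fun (\<lambda>t. ?h (Y x t))"
        using elim yR by (intro L2fun_lipschitz_comp[OF _ _ h(1)] h) auto
      show "L2inner (\<lambda>t. Wderiv (Y x) t - ?h (Y x t)) (cutoff T (real (Suc n)) (\<lambda>_. e)) + (Y x 0 - x) \<bullet> cutoff T (real (Suc n)) (\<lambda>_. e) 0 = 0"
        if "T \<in> \<rat>" "T > 0" "e \<in> Basis" for T e n
      proof -
        have "?P T e n x" using elim that by blast
        then show ?thesis by (simp add: aform_def diff_diff_eq)
      qed
    qed
    then show ?case using elim by (simp add: ode_sol_def)
  qed
qed

lemma integral_eq_imp_has_Wderiv: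
  assumes eq: "\<And>t. t \<ge> 0 \<Longrightarrow> y t = x + (LINT s:{0..t}|lborel. w s)" and w: "L2fun w"
  shows "has_Wderiv y w"
proof (rule has_WderivI[OF w])
  have "(LINT s:{0..0}|lborel. w s) = 0"
    using has_WderivD(3)[OF has_Wderiv_primitive[OF w], of 0] by simp
  then show "y t = y 0 + (LINT s:{0..t}|lborel. w s)" if "t \<ge> 0" for t
    using eq[OF that] eq[of 0] by simp
qed

lemma ode_sol_imp_has_Wderiv:
  assumes "ode_sol h b x y" "L2fun (\<lambda>t. h (y t))"
  shows "has_Wderiv y (\<lambda>t. h (y t))"
  by (rule integral_eq_imp_has_Wderiv[OF _ assms(2)]) (use assms(1) in \<open>unfold ode_sol_def, blast\<close>)

text \<open>At a good initial value \<open>Wderiv\<close> agrees almost everywhere in time with the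
  right-hand side and the initial condition holds, so the form vanishes for all \<phi> at once. The
  exceptional set is therefore the same for every test function.\<close>

lemma ode_sol_imp_ens_sol:
  fixes Y :: "real^'n \<Rightarrow> real \<Rightarrow> real^'n" and B :: "real^'m^'n"
  assumes C: "C > 0" "\<And>y :: real \<Rightarrow> real^'n. is_W y \<Longrightarrow> \<forall>t\<ge>0. norm (y t) \<le> C * Wnorm y"
    and compl: "complete_measure \<mu>" and Y: "strongly_meas \<mu> Y" and sol: "AE x in \<mu>. ode_sol (\<lambda>z. f z + B *v F z) b x (Y x)"
    and h: "K-lipschitz_on (cball 0 (C * b)) (\<lambda>z. f z + B *v F z)" "f 0 + B *v F 0 = 0"
  shows "ens_sol \<mu> f B b F Y"
proof -
  have "AE x in \<mu>. \<forall>\<phi>. aform f B F (Y x) x \<phi> = 0"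
    using sol
  proof eventually_elim
    case (elim x)
    have W: "is_W (Y x)" "Wnorm (Y x) \<le> b" using elim by (auto simp: ode_sol_def)
    have yR: "Y x t \<in> cball 0 (C * b)" if "t \<ge> 0" for t
    proof -
      have "norm (Y x t) \<le> C * Wnorm (Y x)" using C(2) W that by blast
      also have "\<dots> \<le> C * b" using W C(1) by (intro mult_left_mono) auto
      finally show ?thesis by simp
    qed
    have w: "L2fun (\<lambda>t. f (Y x t) + B *v F (Y x t))"
      using W yR by (intro L2fun_lipschitz_comp[OF _ _ h(1)] h) auto
    have d: "has_Wderiv (Y x) (\<lambda>t. f (Y x t) + B *v F (Y x t))"
      using ode_sol_imp_has_Wderiv[OF elim w] .
    have 0: "Y x 0 = x"
    proof -
      have "Y x 0 = x + (LINT s:{0..0}|lborel. f (Y x s) + B *v F (Y x s))"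
        using elim unfolding ode_sol_def by blast
      then show ?thesis using has_WderivD(3)[OF d, of 0] by simp
    qed
    show ?case
    proof
      fix \<phi>
      have "AE t in lborel. indicator {0..} t *\<^sub>R ((Wderiv (Y x) t - f (Y x t) - B *v F (Y x t)) \<bullet> \<phi> t) = 0"
        using has_Wderiv_unique[OF has_Wderiv_Wderiv[OF W(1)] d]
        by eventually_elim (auto simp: indicator_def)
      then show "aform f B F (Y x) x \<phi> = 0"
        using 0 by (simp add: aform_def L2inner_def set_lebesgue_integral_def integral_eq_zero_AE)
    qed
  qed
  then have z: "AE x in \<mu>. aform f B F (Y x) x (\<Phi> x) = 0" for \<Phi>
    by eventually_elim blast
  \<comment> \<open>The integrand vanishes almost everywhere, and completeness turns this into
    measurability for an arbitrary \<Phi>.\<close>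
  have "integrable \<mu> (\<lambda>x. aform f B F (Y x) x (\<Phi> x))" for \<Phi>
  proof -
    have "(\<lambda>x. aform f B F (Y x) x (\<Phi> x)) \<in> borel_measurable \<mu>"
      by (rule complete_measure.borel_measurable_AE_cong[OF compl _ z]) simp
    then show ?thesis
      using z by (subst integrable_cong_AE[where g="\<lambda>_. 0"]) auto
  qed
  then show ?thesis
    unfolding ens_sol_def using Y sol z
    by (auto simp: ode_sol_def integral_eq_zero_AE elim!: eventually_mono)
qed

section \<open>Stability of trajectories\<close>

text \<open>Multiplied by \<open>exp (- (K * t))\<close>, the right-hand side of the integral
  inequality is nonincreasing: its derivative is \<open>K * exp (- (K * t))\<close> times the
  nonpositive defect \<open>u t - (a + K * integral {0..t} u)\<close>.\<close>

lemma gronwall: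
  fixes u :: "real \<Rightarrow> real"
  assumes cont: "continuous_on {0..T} u" and T: "T \<ge> 0" and K: "K \<ge> 0"
    and le: "\<And>t. t \<in> {0..T} \<Longrightarrow> u t \<le> a + K * integral {0..t} u"
  shows "u T \<le> a * exp (K * T)"
proof -
  define G where "G t = (a + K * integral {0..t} u) * exp (- (K * t))" for t
  have "G T \<le> G 0"
  proof (rule DERIV_nonpos_imp_decreasing_open[where f=G, OF T])
    fix t assume t: "0 < t" "t < T"
    have "((\<lambda>t. integral {0..t} u) has_real_derivative u t) (at t within {0..T})"
      using cont t by (intro integral_has_real_derivative) auto
    moreover have "at t within {0..T} = at t"
      using t by (intro at_within_interior) (simp add: interior_atLeastAtMost_real)
    ultimately have [derivative_intros]: "((\<lambda>t. integral {0..t} u) has_real_derivative u t) (at t)"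
      by simp
    have "(G has_real_derivative (K * u t) * exp (- (K * t)) + (a + K * integral {0..t} u) * (exp (- (K * t)) * - K)) (at t)"
      unfolding G_def by (auto intro!: derivative_eq_intros)
    moreover have "(K * u t) * exp (- (K * t)) + (a + K * integral {0..t} u) * (exp (- (K * t)) * - K)
        = K * exp (- (K * t)) * (u t - (a + K * integral {0..t} u))"
      by (simp add: algebra_simps)
    moreover have "\<dots> \<le> 0"
      using K le[of t] t by (intro mult_nonneg_nonpos) auto
    ultimately show "\<exists>y. (G has_real_derivative y) (at t) \<and> y \<le> 0"
      by metis
  next
    show "continuous_on {0..T} G"
      unfolding G_def
      by (intro continuous_intros indefinite_integral_continuous_1 integrable_continuous_real cont)
  qed
  then have "(a + K * integral {0..T} u) * exp (- (K * T)) \<le> a"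
    by (simp add: G_def)
  then have "a + K * integral {0..T} u \<le> a * exp (K * T)"
    by (simp add: exp_minus field_simps)
  then show ?thesis
    using le[of T] T by simp
qed

lemma set_borel_measurable_LIMSEQ:
  fixes y :: "real \<Rightarrow> 'a::euclidean_space"
  assumes "\<And>k::nat. set_borel_measurable lborel A (s k)" "\<And>t. t \<in> A \<Longrightarrow> (\<lambda>k. s k t) \<longlonglongrightarrow> y t"
  shows "set_borel_measurable lborel A y"
  unfolding set_borel_measurable_def
proof (rule borel_measurable_LIMSEQ_metric)
  show "(\<lambda>t. indicat_real A t *\<^sub>R s k t) \<in> borel_measurable lborel" for k
    using assms(1) by (simp add: set_borel_measurable_def)
  show "(\<lambda>k. indicat_real A t *\<^sub>R s k t) \<longlonglongrightarrow> indicat_real A t *\<^sub>R y t" for t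
    using assms(2) by (cases "t \<in> A") auto
qed

lemma set_integral_bounded_convergence_Icc:
  fixes g :: "real \<Rightarrow> 'a::euclidean_space"
  assumes m: "\<And>k::nat. set_borel_measurable lborel {a..b} (s k)"
    and lim: "\<And>t. t \<in> {a..b} \<Longrightarrow> (\<lambda>k. s k t) \<longlonglongrightarrow> g t"
    and bd: "\<And>k t. t \<in> {a..b} \<Longrightarrow> norm (s k t) \<le> D"
  shows "(\<lambda>k. LINT t:{a..b}|lborel. s k t) \<longlonglongrightarrow> (LINT t:{a..b}|lborel. g t)"
  unfolding set_lebesgue_integral_def
proof (rule integral_dominated_convergence)
  show "(\<lambda>t. indicat_real {a..b} t *\<^sub>R g t) \<in> borel_measurable lborel"
    using set_borel_measurable_LIMSEQ[OF m lim] by (simp add: set_borel_measurable_def)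
  show "(\<lambda>t. indicat_real {a..b} t *\<^sub>R s k t) \<in> borel_measurable lborel" for k
    using m by (simp add: set_borel_measurable_def)
  show "integrable lborel (\<lambda>t. indicat_real {a..b} t * D)"
    by (intro integrable_mult_left) (simp add: emeasure_lborel_Icc_eq)
qed (use lim bd in \<open>auto simp: indicator_def\<close>)

lemma uniform_limit_tendsto_compose:
  fixes h :: "'a::metric_space \<Rightarrow> 'b::metric_space"
  assumes u: "uniform_limit S hs h sequentially" and c: "continuous_on S h"
    and y: "\<And>k::nat. ys k \<in> S" "y \<in> S" "ys \<longlonglongrightarrow> y"
  shows "(\<lambda>k. hs k (ys k)) \<longlonglongrightarrow> h y"
proof (rule tendstoI)
  fix e :: real assume e: "e > 0"
  have "(\<lambda>k. h (ys k)) \<longlonglongrightarrow> h y"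
    using continuous_on_tendsto_compose[OF c y(3) y(2)] y(1) by simp
  then have "eventually (\<lambda>k. dist (h (ys k)) (h y) < e/2) sequentially"
    using e by (intro tendstoD) auto
  moreover have "eventually (\<lambda>k. \<forall>z\<in>S. dist (hs k z) (h z) < e/2) sequentially"
    using e by (intro uniform_limitD[OF u]) auto
  ultimately show "eventually (\<lambda>k. dist (hs k (ys k)) (h y) < e) sequentially"
  proof eventually_elim
    case (elim k)
    have "dist (hs k (ys k)) (h (ys k)) < e/2"
      using elim y(1) by blast
    then show ?case
      using elim dist_triangle[of "hs k (ys k)" "h y" "h (ys k)"] by linarith
  qed
qed

text \<open>The tail of the sequence is bounded by the bound of the limit plus one. The finitely
  many earlier members are bounded through their own Lipschitz constants, which may vary with
  \<open>k\<close>. The result is the constant majorant for passing to the limit under time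
  integrals.\<close>

lemma uniform_limit_lipschitz_uniform_bound:
  fixes h :: "'a::real_normed_vector \<Rightarrow> 'b::real_normed_vector"
  assumes u: "uniform_limit (cball 0 R) hs h sequentially" and R: "R \<ge> 0"
    and h: "K-lipschitz_on (cball 0 R) h" "h 0 = 0"
    and hs: "\<And>k::nat. \<exists>K. K-lipschitz_on (cball 0 R) (hs k)" "\<And>k. hs k 0 = 0"
  obtains D where "\<And>k z. z \<in> cball 0 R \<Longrightarrow> norm (hs k z) \<le> D"
proof -
  obtain Ks where Ks: "\<And>k. (Ks k)-lipschitz_on (cball 0 R) (hs k)"
    using hs(1) by metis
  have bd: "norm (g z) \<le> c * R" if "c-lipschitz_on (cball 0 R) g" "g 0 = 0" "z \<in> cball 0 R" for g :: "'a \<Rightarrow> 'b" and c z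
  proof -
    have "norm (g z) \<le> c * norm z"
      using lipschitz_onD[OF that(1,3), of 0] that(2) R by (simp add: dist_norm)
    also have "\<dots> \<le> c * R"
      using that lipschitz_on_nonneg[OF that(1)] by (intro mult_left_mono) auto
    finally show ?thesis .
  qed
  have "eventually (\<lambda>k. \<forall>z\<in>cball 0 R. dist (hs k z) (h z) < 1) sequentially"
    by (rule uniform_limitD[OF u]) simp
  then obtain N where N: "\<And>k z. k \<ge> N \<Longrightarrow> z \<in> cball 0 R \<Longrightarrow> dist (hs k z) (h z) < 1"
    unfolding eventually_sequentially by blast
  have nn: "0 \<le> Ks k * R" for k
    using lipschitz_on_nonneg[OF Ks] R by simp
  have nnK: "0 \<le> K * R"
    using lipschitz_on_nonneg[OF h(1)] R by simp
  show ?thesis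
  proof (rule that[of "(\<Sum>k<N. Ks k * R) + (K * R + 1)"])
    fix k and z :: 'a assume z: "z \<in> cball 0 R"
    show "norm (hs k z) \<le> (\<Sum>k<N. Ks k * R) + (K * R + 1)"
    proof (cases "k < N")
      case True
      then have "Ks k * R \<le> (\<Sum>k<N. Ks k * R)"
        using nn by (intro member_le_sum) auto
      then show ?thesis
        using bd[OF Ks hs(2) z, of k] nnK by linarith
    next
      case False
      then have "norm (hs k z) \<le> norm (h z) + 1"
        using N[of k z] z norm_triangle_sub[of "hs k z" "h z"] by (simp add: dist_norm)
      then show ?thesis
        using bd[OF h z] sum_nonneg[of "{..<N}" "\<lambda>k. Ks k * R"] nn by simp
    qed
  qed
qed

section \<open>Comparison and convergence of trajectories\<close>

lemma ode_sol_bounded: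
  fixes y :: "real \<Rightarrow> 'a::euclidean_space"
  assumes C: "C > 0" "\<And>y :: real \<Rightarrow> 'a. is_W y \<Longrightarrow> \<forall>t\<ge>0. norm (y t) \<le> C * Wnorm y"
    and y: "ode_sol h b x y" and t: "t \<ge> 0"
  shows "y t \<in> cball 0 (C * b)"
proof -
  have "norm (y t) \<le> C * Wnorm y" using C(2)[of y, rule_format, OF _ t] y by (simp only: ode_sol_def simp_thms)
  also have "\<dots> \<le> C * b" using y C(1) by (intro mult_left_mono) (auto simp: ode_sol_def)
  finally show ?thesis by simp
qed

text \<open>Both right-hand sides are compared with one Lipschitz reference \<open>h\<close>, so
  only the constant of \<open>h\<close> reaches the exponential. With a common initial value the
  distance is driven by the two deviations alone, which accumulate to at most
  \<open>2 * e * T\<close>. In the application \<open>g\<close> and \<open>g'\<close> are two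
  members of the sequence and \<open>h\<close> is its limit.\<close>

lemma ode_sol_dist_le:
  fixes y z :: "real \<Rightarrow> 'a::euclidean_space"
  assumes y: "ode_sol g b x y" and z: "ode_sol g' b x z"
    and in_S: "\<And>t. t \<ge> 0 \<Longrightarrow> y t \<in> S \<and> z t \<in> S"
    and L2: "L2fun (\<lambda>t. g (y t))" "L2fun (\<lambda>t. g' (z t))"
    and h: "K-lipschitz_on S h" and close: "\<And>w. w \<in> S \<Longrightarrow> norm (g w - h w) \<le> e" "\<And>w. w \<in> S \<Longrightarrow> norm (g' w - h w) \<le> e"
    and T: "T \<ge> 0" and e: "e \<ge> 0"
  shows "norm (y T - z T) \<le> 2 * e * T * exp (K * T)"
proof -
  have dy: "has_Wderiv y (\<lambda>t. g (y t))" and dz: "has_Wderiv z (\<lambda>t. g' (z t))"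
    using ode_sol_imp_has_Wderiv y z L2 by blast+
  let ?u = "\<lambda>t. norm (y t - z t)"
  have cont: "continuous_on {0..s} ?u" for s
    using has_Wderiv_continuous_on[OF dy] has_Wderiv_continuous_on[OF dz]
    by (intro continuous_intros) (auto intro: continuous_on_subset)
  show ?thesis
  proof (rule gronwall[of T ?u K "2 * e * T"])
    show "K \<ge> 0" using h by (rule lipschitz_on_nonneg)
    fix t assume t: "t \<in> {0..T}"
    then have t0: "t \<ge> 0" by simp
    have i: "set_integrable lborel {0..t} (\<lambda>s. g (y s))" "set_integrable lborel {0..t} (\<lambda>s. g' (z s))"
      using L2fun_integrable_Icc[OF L2(1)] L2fun_integrable_Icc[OF L2(2)] by auto
    have hk: "(\<lambda>s. g (y s)) integrable_on {0..t}" "(\<lambda>s. g' (z s)) integrable_on {0..t}"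
      using i set_borel_integral_eq_integral(1) by blast+
    have "y t - z t = (LINT s:{0..t}|lborel. g (y s)) - (LINT s:{0..t}|lborel. g' (z s))"
      using y z t0 unfolding ode_sol_def by (metis add_diff_cancel_left)
    also have "\<dots> = integral {0..t} (\<lambda>s. g (y s)) - integral {0..t} (\<lambda>s. g' (z s))"
      using i set_borel_integral_eq_integral(2) by metis
    also have "\<dots> = integral {0..t} (\<lambda>s. g (y s) - g' (z s))"
      using hk by (rule Henstock_Kurzweil_Integration.integral_diff[symmetric])
    finally have "norm (y t - z t) \<le> integral {0..t} (\<lambda>s. 2 * e + K * ?u s)"
    proof (simp only:, intro integral_norm_bound_integral)
      show "(\<lambda>s. g (y s) - g' (z s)) integrable_on {0..t}"
        using hk by (rule integrable_diff)
      show "(\<lambda>s. 2 * e + K * ?u s) integrable_on {0..t}"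
        by (intro integrable_continuous_real continuous_intros cont)
      fix s assume s: "s \<in> {0..t}"
      then have S: "y s \<in> S" "z s \<in> S" using in_S by auto
      have "g (y s) - g' (z s) = (g (y s) - h (y s)) + (h (y s) - h (z s)) - (g' (z s) - h (z s))"
        by simp
      also have "norm \<dots> \<le> norm (g (y s) - h (y s)) + norm (h (y s) - h (z s)) + norm (g' (z s) - h (z s))"
        by (meson add_right_mono norm_triangle_ineq norm_triangle_ineq4 order_trans)
      also have "\<dots> \<le> e + K * ?u s + e"
        using close S lipschitz_onD[OF h S] by (intro add_mono) (auto simp: dist_norm)
      finally show "norm (g (y s) - g' (z s)) \<le> 2 * e + K * ?u s" by simp
    qed
    also have "\<dots> = integral {0..t} (\<lambda>s. 2 * e) + integral {0..t} (\<lambda>s. K * ?u s)"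
      by (intro Henstock_Kurzweil_Integration.integral_add integrable_continuous_real continuous_intros cont)
    also have "\<dots> = 2 * e * t + K * integral {0..t} ?u"
      using t0 by simp
    also have "\<dots> \<le> 2 * e * T + K * integral {0..t} ?u"
      using t e by (intro add_right_mono mult_left_mono) auto
    finally show "?u t \<le> 2 * e * T + K * integral {0..t} ?u" .
  qed (use cont T in auto)
qed

text \<open>The third conclusion is stated for truncations because the Fatou estimate yields a norm
  bound for the limit but no control of the tails of \<open>ys k\<close> uniform in
  \<open>k\<close>.\<close>

lemma ode_sol_convergent:
  fixes ys :: "nat \<Rightarrow> real \<Rightarrow> 'a::euclidean_space"
  assumes C: "C > 0" "\<And>y :: real \<Rightarrow> 'a. is_W y \<Longrightarrow> \<forall>t\<ge>0. norm (y t) \<le> C * Wnorm y"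
    and u: "uniform_limit (cball 0 (C * b)) hs h sequentially"
    and h: "K-lipschitz_on (cball 0 (C * b)) h" "h 0 = 0"
    and hs: "\<And>k. \<exists>K. K-lipschitz_on (cball 0 (C * b)) (hs k)" "\<And>k. hs k 0 = 0"
    and ys: "\<And>k. ode_sol (hs k) b x (ys k)"
    and y: "\<And>t. t \<ge> 0 \<Longrightarrow> y t = lim (\<lambda>k. ys k t)"
  shows "\<And>t. t \<ge> 0 \<Longrightarrow> (\<lambda>k. ys k t) \<longlonglongrightarrow> y t"
    "ode_sol h b x y"
    "\<And>T. T \<ge> 0 \<Longrightarrow> (\<lambda>k. Wnorm (\<lambda>t. cutoff T 1 (ys k) t - cutoff T 1 y t)) \<longlonglongrightarrow> 0"
proof -
  let ?S = "cball 0 (C * b) :: 'a set"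
  have b: "b \<ge> 0"
    using ys[of 0] Wnorm_nonneg[of "ys 0"] by (auto simp: ode_sol_def)
  have R: "C * b \<ge> 0" using b C(1) by simp
  have yS: "ys k t \<in> ?S" if "t \<ge> 0" for k t
    using ode_sol_bounded[OF C ys that] .
  have W: "is_W (ys k)" for k using ys by (simp add: ode_sol_def)
  have L2: "L2fun (\<lambda>t. hs k (ys k t))" for k
    using hs(1)[of k] L2fun_lipschitz_comp[OF W yS] hs(2) by blast
  have dk: "has_Wderiv (ys k) (\<lambda>t. hs k (ys k t))" for k
    using ode_sol_imp_has_Wderiv[OF ys L2] .
  show lim: "(\<lambda>k. ys k t) \<longlonglongrightarrow> y t" if t: "t \<ge> 0" for t
  proof -
    have "Cauchy (\<lambda>k. ys k t)"
    proof (rule metric_CauchyI)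
      fix e :: real assume e: "e > 0"
      \<comment> \<open>Chosen so that the comparison bound \<open>2 * d * t * exp (K * t)\<close>
        stays below \<open>e\<close>; the added 1 keeps the divisor positive when
        \<open>t = 0\<close>.\<close>
      define d where "d = e / 2 / (2 * t * exp (K * t) + 1)"
      have pos: "2 * t * exp (K * t) + 1 > 0"
        using t by (intro add_nonneg_pos) auto
      have d: "d > 0" using e pos by (simp add: d_def)
      have "2 * d * t * exp (K * t) \<le> d * (2 * t * exp (K * t) + 1)"
        using d by (simp add: algebra_simps)
      also have "\<dots> = e / 2"
        using pos unfolding d_def by (metis less_irrefl nonzero_eq_divide_eq)
      also have "\<dots> < e" using e by simp
      finally have de: "2 * d * t * exp (K * t) < e" .
      have "eventually (\<lambda>k. \<forall>z\<in>?S. dist (hs k z) (h z) < d) sequentially"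
        by (rule uniform_limitD[OF u d])
      then obtain N where N: "\<And>k z. k \<ge> N \<Longrightarrow> z \<in> ?S \<Longrightarrow> dist (hs k z) (h z) < d"
        unfolding eventually_sequentially by blast
      have "dist (ys k t) (ys l t) < e" if "k \<ge> N" "l \<ge> N" for k l
      proof -
        have "norm (ys k t - ys l t) \<le> 2 * d * t * exp (K * t)"
          by (rule ode_sol_dist_le[OF ys ys _ L2 L2 h(1) _ _ t])
            (use yS N that d in \<open>auto simp: dist_norm less_imp_le\<close>)
        then show ?thesis using de by (simp add: dist_norm)
      qed
      then show "\<exists>N. \<forall>k\<ge>N. \<forall>l\<ge>N. dist (ys k t) (ys l t) < e" by blast
    qed
    then have "convergent (\<lambda>k. ys k t)" by (rule Cauchy_convergent)
    then show ?thesis using y[OF t] by (simp add: convergent_LIMSEQ_iff)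
  qed
  have yS': "y t \<in> ?S" if "t \<ge> 0" for t
    using closed_sequentially[OF closed_cball _ lim[OF that]] yS[OF that] by blast
  have limh: "(\<lambda>k. hs k (ys k t)) \<longlonglongrightarrow> h (y t)" if "t \<ge> 0" for t
    using uniform_limit_tendsto_compose[OF u lipschitz_on_continuous_on[OF h(1)] yS yS' lim] that by blast
  obtain D where D: "\<And>k z. z \<in> ?S \<Longrightarrow> norm (hs k z) \<le> D"
    using uniform_limit_lipschitz_uniform_bound[OF u R h hs] by blast
  have m: "set_borel_measurable lborel {0..} (ys k)" "set_borel_measurable lborel {0..} (\<lambda>t. hs k (ys k t))" for k
    using W L2 by (auto simp: is_W_def L2fun_def)
  have m': "set_borel_measurable lborel {0..} y"
    by (rule set_borel_measurable_LIMSEQ[OF m(1)]) (use lim in simp)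
  have m'': "set_borel_measurable lborel {0..} (\<lambda>t. h (y t))"
    by (rule set_borel_measurable_LIMSEQ[OF m(2)]) (use limh in simp)
  have eq: "y t = x + (LINT s:{0..t}|lborel. h (y s))" if t: "t \<ge> 0" for t
  proof (rule LIMSEQ_unique[OF lim[OF t]])
    have "(\<lambda>k. LINT s:{0..t}|lborel. hs k (ys k s)) \<longlonglongrightarrow> (LINT s:{0..t}|lborel. h (y s))"
    proof (rule set_integral_bounded_convergence_Icc[where D=D])
      show "set_borel_measurable lborel {0..t} (\<lambda>s. hs k (ys k s))" for k
        by (rule set_borel_measurable_lborel_subset[OF m(2)]) auto
    qed (use limh D yS in auto)
    then have "(\<lambda>k. x + (LINT s:{0..t}|lborel. hs k (ys k s))) \<longlonglongrightarrow> x + (LINT s:{0..t}|lborel. h (y s))"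
      by (intro tendsto_intros)
    moreover have "ys k t = x + (LINT s:{0..t}|lborel. hs k (ys k s))" for k
      using ys[of k] t unfolding ode_sol_def by blast
    ultimately show "(\<lambda>k. ys k t) \<longlonglongrightarrow> x + (LINT s:{0..t}|lborel. h (y s))"
      by simp
  qed
  \<comment> \<open>By the equation the right-hand side is the weak derivative, so \<open>?g\<close>
    is the full energy density. One application of Fatou's lemma then yields square integrability of
    the limit and of its derivative together with the bound \<open>b\<close>.\<close>
  let ?g = "\<lambda>t. (norm (y t))\<^sup>2 + (norm (h (y t)))\<^sup>2"
  let ?gs = "\<lambda>k t. (norm (ys k t))\<^sup>2 + (norm (hs k (ys k t)))\<^sup>2"
  have gsi: "set_integrable lborel {0..} (?gs k)" for k
    using W[of k] L2[of k] by (intro set_integral_add) (auto simp: is_W_def L2fun_def)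
  have "set_borel_measurable lborel {0..} ?g"
    by (rule set_borel_measurable_LIMSEQ[where s="?gs"])
      (use gsi in \<open>auto simp: set_integrable_def set_borel_measurable_def intro!: tendsto_intros lim limh\<close>)
  then have gm: "(\<lambda>t. indicator {0..} t *\<^sub>R ?g t) \<in> borel_measurable lborel"
    by (simp add: set_borel_measurable_def)
  have "(\<integral>\<^sup>+t. ennreal (indicator {0..} t *\<^sub>R ?g t) \<partial>lborel) \<le> (\<integral>\<^sup>+t. liminf (\<lambda>k. ennreal (indicator {0..} t *\<^sub>R ?gs k t)) \<partial>lborel)"
  proof (rule nn_integral_mono)
    fix t :: real
    have "(\<lambda>k. ennreal (indicator {0..} t *\<^sub>R ?gs k t)) \<longlonglongrightarrow> ennreal (indicator {0..} t *\<^sub>R ?g t)"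
      by (cases "t \<ge> 0") (auto intro!: tendsto_intros lim limh)
    from lim_imp_Liminf[OF sequentially_bot this]
    show "ennreal (indicator {0..} t *\<^sub>R ?g t) \<le> liminf (\<lambda>k. ennreal (indicator {0..} t *\<^sub>R ?gs k t))"
      by (rule eq_refl[OF sym])
  qed
  also have "\<dots> \<le> liminf (\<lambda>k. \<integral>\<^sup>+t. ennreal (indicator {0..} t *\<^sub>R ?gs k t) \<partial>lborel)"
    by (intro nn_integral_liminf) (use gsi in \<open>auto simp: set_integrable_def\<close>)
  also have "\<dots> \<le> ennreal (b\<^sup>2)"
  proof (rule Liminf_le)
    have "(\<integral>\<^sup>+t. ennreal (indicator {0..} t *\<^sub>R ?gs k t) \<partial>lborel) = ennreal ((Wnorm (ys k))\<^sup>2)" for k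
      using W[of k] Wnorm_sq[OF _ dk, of k] gsi[of k]
      by (subst nn_integral_eq_integral) (auto simp: is_W_def set_lebesgue_integral_def set_integrable_def)
    moreover have "(Wnorm (ys k))\<^sup>2 \<le> b\<^sup>2" for k
      using ys[of k] Wnorm_nonneg[of "ys k"] by (intro power_mono) (auto simp: ode_sol_def)
    ultimately show "eventually (\<lambda>k. (\<integral>\<^sup>+t. ennreal (indicator {0..} t *\<^sub>R ?gs k t) \<partial>lborel) \<le> ennreal (b\<^sup>2)) sequentially"
      by (simp add: ennreal_leI)
  qed simp
  finally have fin: "(\<integral>\<^sup>+t. ennreal (indicator {0..} t *\<^sub>R ?g t) \<partial>lborel) \<le> ennreal (b\<^sup>2)" .
  have gi: "set_integrable lborel {0..} ?g"
    unfolding set_integrable_def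
  proof (rule integrableI_nonneg[OF gm])
    show "(\<integral>\<^sup>+t. ennreal (indicator {0..} t *\<^sub>R ?g t) \<partial>lborel) < \<infinity>"
      using fin by (rule le_less_trans) simp
  qed simp
  have Ly: "L2fun y" "L2fun (\<lambda>t. h (y t))"
    using L2fun_bound[OF m' gi] L2fun_bound[OF m'' gi] by simp_all
  have d: "has_Wderiv y (\<lambda>t. h (y t))"
    by (rule integral_eq_imp_has_Wderiv[OF eq Ly(2)])
  have "(Wnorm y)\<^sup>2 \<le> b\<^sup>2"
  proof -
    have "ennreal ((Wnorm y)\<^sup>2) = (\<integral>\<^sup>+t. ennreal (indicator {0..} t *\<^sub>R ?g t) \<partial>lborel)"
      using gi Wnorm_sq[OF Ly(1) d]
      by (subst nn_integral_eq_integral) (auto simp: set_lebesgue_integral_def set_integrable_def)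
    then have "ennreal ((Wnorm y)\<^sup>2) \<le> ennreal (b\<^sup>2)" using fin by (simp only:)
    then show ?thesis by (simp only: ennreal_le_iff[OF zero_le_power2])
  qed
  then have "Wnorm y \<le> b"
    by (rule power2_le_imp_le) (rule b)
  then show "ode_sol h b x y"
    unfolding ode_sol_def is_W_def using Ly d eq by blast
  show "(\<lambda>k. Wnorm (\<lambda>t. cutoff T 1 (ys k) t - cutoff T 1 y t)) \<longlonglongrightarrow> 0" if T: "T \<ge> 0" for T
  proof -
    \<comment> \<open>Up to time \<open>T\<close> the states and the right-hand sides are uniformly
      bounded, so pointwise convergence suffices; the value at \<open>T\<close> takes care of the
      ramp.\<close>
    let ?q = "\<lambda>k t. (norm (ys k t - y t))\<^sup>2 + (norm (hs k (ys k t) - h (y t)))\<^sup>2"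
    have "(\<lambda>k. LINT t:{0..T}|lborel. ?q k t) \<longlonglongrightarrow> (LINT t:{0..T}|lborel. (0::real))"
    proof (rule set_integral_bounded_convergence_Icc)
      fix k
      have "set_integrable lborel {0..} (?q k)"
        using L2fun_diff[OF _ Ly(1), of "ys k"] L2fun_diff[OF L2[of k] Ly(2)] W[of k]
        unfolding is_W_def L2fun_def by (intro set_integral_add(1)) blast+
      then have "set_borel_measurable lborel {0..} (?q k)"
        by (auto simp: set_integrable_def set_borel_measurable_def)
      then show "set_borel_measurable lborel {0..T} (?q k)"
        by (rule set_borel_measurable_lborel_subset) auto
    next
      fix t assume t: "t \<in> {0..T}"
      have "(\<lambda>k. ?q k t) \<longlonglongrightarrow> (norm (y t - y t))\<^sup>2 + (norm (h (y t) - h (y t)))\<^sup>2"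
        by (intro tendsto_intros lim limh) (use t in auto)
      then show "(\<lambda>k. ?q k t) \<longlonglongrightarrow> 0" by simp
    next
      fix k t assume t: "t \<in> {0..T}"
      have hD: "norm (h (y t)) \<le> D"
        using tendsto_upperbound[OF tendsto_norm[OF limh]] D yS t by simp
      have "norm (ys k t - y t) \<le> C * b + C * b"
        using yS[of t k] yS'[of t] t norm_triangle_ineq4[of "ys k t" "y t"] by simp
      moreover have "norm (hs k (ys k t) - h (y t)) \<le> D + D"
        using D[OF yS[of t k], of k] hD t norm_triangle_ineq4[of "hs k (ys k t)" "h (y t)"] by simp
      ultimately have "?q k t \<le> (C * b + C * b)\<^sup>2 + (D + D)\<^sup>2"
        by (intro add_mono power_mono) auto
      then show "norm (?q k t) \<le> (C * b + C * b)\<^sup>2 + (D + D)\<^sup>2" by simp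
    qed
    then have "(\<lambda>k. (LINT t:{0..T}|lborel. ?q k t) + 2 * (norm (ys k T - y T))\<^sup>2) \<longlonglongrightarrow> 0 + 2 * (norm (y T - y T))\<^sup>2"
      by (intro tendsto_intros lim T) simp
    then have l: "(\<lambda>k. (LINT t:{0..T}|lborel. ?q k t) + 2 * (norm (ys k T - y T))\<^sup>2) \<longlonglongrightarrow> 0"
      by simp
    have "(\<lambda>k. (Wnorm (cutoff T 1 (\<lambda>t. ys k t - y t)))\<^sup>2) \<longlonglongrightarrow> 0"
      by (rule Lim_null_comparison[OF _ l]) (use Wnorm_sq_cutoff_le[OF has_Wderiv_diff[OF dk d] T] in simp)
    then have "(\<lambda>k. sqrt ((Wnorm (cutoff T 1 (\<lambda>t. ys k t - y t)))\<^sup>2)) \<longlonglongrightarrow> sqrt 0"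
      by (rule tendsto_real_sqrt)
    then show ?thesis
      by (simp add: Wnorm_nonneg cutoff_diff)
  qed
qed

section \<open>Networks\<close>

lemma C1_imp_lipschitz_on_Icc:
  fixes \<sigma> :: "real \<Rightarrow> real"
  assumes "\<sigma> C1_differentiable_on UNIV"
  shows "\<exists>K. K-lipschitz_on {-r..r} \<sigma>"
proof -
  obtain D where D: "\<And>x. (\<sigma> has_vector_derivative D x) (at x)" "continuous_on UNIV D"
    using assms by (auto simp: C1_differentiable_on_def)
  have "compact (D ` {-r..r})"
    by (intro compact_continuous_image continuous_on_subset[OF D(2)]) auto
  then have "bounded (D ` {-r..r})" by (rule compact_imp_bounded)
  then obtain K where K: "K > 0" "\<And>x. x \<in> {-r..r} \<Longrightarrow> norm (D x) \<le> K"
    unfolding bounded_pos by blast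
  have "K-lipschitz_on {-r..r} \<sigma>"
  proof (rule bounded_derivative_imp_lipschitz)
    show "(\<sigma> has_derivative (\<lambda>h. h *\<^sub>R D x)) (at x within {-r..r})" for x
      using D(1)[of x] unfolding has_vector_derivative_def by (rule has_derivative_at_withinI)
    show "onorm (\<lambda>h. h *\<^sub>R D x) \<le> K" if "x \<in> {-r..r}" for x
    proof (rule onorm_bound)
      show "norm (h *\<^sub>R D x) \<le> K * norm h" for h
        using mult_left_mono[OF K(2)[OF that], of "norm h"] by (simp add: abs_mult mult.commute)
    qed (use K in simp)
  qed (use K in auto)
  then show ?thesis by blast
qed

text \<open>Comparison with the derivative at the centre bounds the derivative on the ball, and the
  mean value inequality applies because the ball is convex. The absolute value appears because the
  sign of \<open>L\<close> is not known.\<close>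

lemma lipschitz_on_cball_if_deriv_lipschitz:
  fixes f :: "'a::euclidean_space \<Rightarrow> 'b::real_normed_vector"
  assumes D: "\<And>x. (f has_derivative Df x) (at x)"
    and L: "\<And>x z. x \<in> cball 0 R \<Longrightarrow> z \<in> cball 0 R \<Longrightarrow> onorm (\<lambda>h. Df x h - Df z h) \<le> L * dist x z"
    and R: "R \<ge> 0"
  shows "\<exists>K. K-lipschitz_on (cball 0 R) f"
proof -
  have bl: "bounded_linear (Df x)" for x using D has_derivative_bounded_linear by blast
  have le: "onorm (Df x) \<le> \<bar>L\<bar> * R + onorm (Df 0)" if x: "x \<in> cball 0 R" for x
  proof -
    have "onorm (Df x) = onorm (\<lambda>h. (Df x h - Df 0 h) + Df 0 h)" by simp
    also have "\<dots> \<le> onorm (\<lambda>h. Df x h - Df 0 h) + onorm (Df 0)"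
      by (intro onorm_triangle bounded_linear_sub bl)
    also have "onorm (\<lambda>h. Df x h - Df 0 h) \<le> L * dist x 0"
      using L[OF x, of 0] R by simp
    also have "\<dots> \<le> \<bar>L\<bar> * R"
      using x by (intro mult_mono) auto
    finally show ?thesis by simp
  qed
  have "(\<bar>L\<bar> * R + onorm (Df 0))-lipschitz_on (cball 0 R) f"
  proof (rule bounded_derivative_imp_lipschitz[where f'=Df])
    show "(f has_derivative Df x) (at x within cball 0 R)" for x
      using D by (rule has_derivative_at_withinI)
    show "0 \<le> \<bar>L\<bar> * R + onorm (Df 0)"
      using R by (intro add_nonneg_nonneg mult_nonneg_nonneg onorm_pos_le bl) auto
  qed (use le in auto)
  then show ?thesis by blast
qed

lemma lipschitz_on_sum_ex:
  fixes g :: "'i \<Rightarrow> 'a::metric_space \<Rightarrow> 'b::real_normed_vector"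
  assumes "finite A" "\<And>i. i \<in> A \<Longrightarrow> \<exists>K. K-lipschitz_on S (g i)"
  shows "\<exists>K. K-lipschitz_on S (\<lambda>x. \<Sum>i\<in>A. g i x)"
  using assms
proof (induction rule: finite_induct)
  case empty
  then show ?case using lipschitz_on_constant by auto
next
  case (insert i A)
  obtain K where K: "K-lipschitz_on S (g i)" using insert.prems by blast
  obtain K' where "K'-lipschitz_on S (\<lambda>x. \<Sum>i\<in>A. g i x)" using insert by blast
  from lipschitz_on_add[OF K this] show ?case using insert.hyps by auto
qed

lemma lipschitz_on_affine_ex:
  fixes z :: "'a::metric_space \<Rightarrow> nat \<Rightarrow> real"
  assumes "\<And>j. \<exists>K. K-lipschitz_on S (\<lambda>x. z x j)"
  shows "\<exists>K. K-lipschitz_on S (\<lambda>x. (\<Sum>k<p. w k * z x k) + c)"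
proof -
  have "\<exists>K. K-lipschitz_on S (\<lambda>x. w k * z x k)" for k
    using assms[of k] lipschitz_on_cmult_real by blast
  then have "\<exists>K. K-lipschitz_on S (\<lambda>x. \<Sum>k<p. w k * z x k)"
    by (intro lipschitz_on_sum_ex) auto
  then show ?thesis
    using lipschitz_on_add[OF _ lipschitz_on_constant] by blast
qed

text \<open>A C1 activation is in general Lipschitz on bounded intervals only, so each layer uses
  the compactness of \<open>S\<close> to bound the range of its input.\<close>

lemma lipschitz_on_C1_compose_ex:
  fixes g :: "'a::metric_space \<Rightarrow> real" and \<sigma> :: "real \<Rightarrow> real"
  assumes \<sigma>: "\<sigma> C1_differentiable_on UNIV" and S: "compact S" and g: "\<exists>K. K-lipschitz_on S g"
  shows "\<exists>K. K-lipschitz_on S (\<lambda>x. \<sigma> (g x))"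
proof -
  obtain K where K: "K-lipschitz_on S g" using g by blast
  have "compact (g ` S)"
    using lipschitz_on_continuous_on[OF K] S by (rule compact_continuous_image)
  then have "bounded (g ` S)" by (rule compact_imp_bounded)
  then obtain r where r: "\<And>x. x \<in> S \<Longrightarrow> \<bar>g x\<bar> \<le> r"
    unfolding bounded_iff real_norm_def by blast
  obtain K' where "K'-lipschitz_on {-r..r} \<sigma>"
    using C1_imp_lipschitz_on_Icc[OF \<sigma>] by blast
  then have "K'-lipschitz_on (g ` S) \<sigma>"
    by (rule lipschitz_on_subset) (use r in \<open>fastforce simp: abs_le_iff\<close>)
  then show ?thesis
    using lipschitz_on_compose2[OF K] by blast
qed

lemma mid_eval_Nil2 [simp]: "mid_eval \<sigma> Ns [] z = z"
  \<comment> \<open>This rule separates lists of length zero, one and at least two, which is the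
    case split behind the equations of \<open>mid_eval\<close>.\<close>
  by (cases Ns rule: remdups_adj.cases) auto

lemma mid_eval_lipschitz:
  fixes z :: "'a::metric_space \<Rightarrow> nat \<Rightarrow> real"
  assumes \<sigma>: "\<sigma> C1_differentiable_on UNIV" and S: "compact S"
    and z: "\<And>j. \<exists>K. K-lipschitz_on S (\<lambda>x. z x j)"
  shows "\<exists>K. K-lipschitz_on S (\<lambda>x. mid_eval \<sigma> Ns Ls (z x) j)"
  using z
proof (induction Ls arbitrary: Ns z)
  case Nil
  then show ?case by simp
next
  case (Cons l Ls)
  obtain W c where l: "l = (W, c)" by (cases l)
  show ?case
  proof (cases Ns rule: remdups_adj.cases)
    case (3 p q Ns')
    have "\<exists>K. K-lipschitz_on S (\<lambda>x. mid_eval \<sigma> (q # Ns') Ls (\<lambda>j. if j < q then \<sigma> ((\<Sum>k<p. W j k * z x k) + c j) else 0) j)"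
    proof (rule Cons.IH)
      fix j
      show "\<exists>K. K-lipschitz_on S (\<lambda>x. if j < q then \<sigma> ((\<Sum>k<p. W j k * z x k) + c j) else 0)"
      proof (cases "j < q")
        case True
        then show ?thesis
          using lipschitz_on_C1_compose_ex[OF \<sigma> S lipschitz_on_affine_ex[OF Cons.prems]] by simp
      next
        case False
        then show ?thesis using lipschitz_on_constant[of S "0::real"] by auto
      qed
    qed
    then show ?thesis using 3 l by simp
  qed (use Cons.prems in auto)
qed

lemma lipschitz_on_vec_ex:
  fixes g :: "'a::metric_space \<Rightarrow> real^'m"
  assumes "\<And>i. \<exists>K. K-lipschitz_on S (\<lambda>x. g x $ i)"
  shows "\<exists>K. K-lipschitz_on S g"
proof -
  obtain K where K: "\<And>i. (K i)-lipschitz_on S (\<lambda>x. g x $ i)" using assms by metis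
  have "(\<Sum>i\<in>UNIV. K i)-lipschitz_on S g"
  proof (rule lipschitz_onI)
    fix x y assume "x \<in> S" "y \<in> S"
    have "dist (g x) (g y) \<le> (\<Sum>i\<in>UNIV. \<bar>(g x - g y) $ i\<bar>)"
      unfolding dist_norm by (rule norm_le_l1_cart)
    also have "\<dots> \<le> (\<Sum>i\<in>UNIV. K i * dist x y)"
      using lipschitz_onD[OF K \<open>x \<in> S\<close> \<open>y \<in> S\<close>] by (intro sum_mono) (simp add: dist_real_def)
    finally show "dist (g x) (g y) \<le> (\<Sum>i\<in>UNIV. K i) * dist x y"
      by (simp add: sum_distrib_right)
  qed (intro sum_nonneg lipschitz_on_nonneg[OF K])
  then show ?thesis by blast
qed

lemma Fnet_lipschitz:
  fixes S :: "(real^'n) set" and \<theta> :: "('n::finite, 'm::finite) netparam"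
  assumes \<sigma>: "\<sigma> C1_differentiable_on UNIV" and S: "compact S"
  shows "\<exists>K. K-lipschitz_on S (Fnet \<sigma> Ns \<theta>)"
proof -
  have z1: "\<exists>K. K-lipschitz_on S (\<lambda>x. if j < hd Ns then \<sigma> (W1 \<theta> j \<bullet> x + b1 \<theta> j) else 0)" for j
  proof (cases "j < hd Ns")
    case True
    have "\<exists>K. K-lipschitz_on S (\<lambda>x. W1 \<theta> j \<bullet> x)"
      using bounded_linear.lipschitz_boundE[OF bounded_linear_inner_right] by blast
    then have "\<exists>K. K-lipschitz_on S (\<lambda>x. W1 \<theta> j \<bullet> x + b1 \<theta> j)"
      using lipschitz_on_add[OF _ lipschitz_on_constant] by blast
    then show ?thesis
      using lipschitz_on_C1_compose_ex[OF \<sigma> S] True by simp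
  next
    case False
    then show ?thesis using lipschitz_on_constant[of S "0::real"] by auto
  qed
  have "\<exists>K. K-lipschitz_on S (Psi \<sigma> Ns \<theta>)"
    by (rule lipschitz_on_vec_ex)
      (simp add: Psi_def Let_def lipschitz_on_affine_ex mid_eval_lipschitz \<sigma> S z1)
  then obtain K where "K-lipschitz_on S (Psi \<sigma> Ns \<theta>)" by blast
  then have "(K + 0)-lipschitz_on S (\<lambda>x. Psi \<sigma> Ns \<theta> x - Psi \<sigma> Ns \<theta> 0)"
    by (intro lipschitz_on_diff lipschitz_on_constant)
  then show ?thesis
    by (auto simp: Fnet_def[abs_def])
qed

section \<open>Continuous dependence of networks on their parameters\<close>

text \<open>Under \<open>in_R\<close> only finitely many entries can be nonzero, so entrywise
  convergence amounts to convergence in the Euclidean norm. The equality of lengths makes the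
  comparison layer by layer meaningful.\<close>

definition net_tendsto :: "(nat \<Rightarrow> ('n::finite, 'm::finite) netparam) \<Rightarrow> ('n, 'm) netparam \<Rightarrow> bool" where
  "net_tendsto \<theta>s \<theta> \<longleftrightarrow>
     (\<forall>j. (\<lambda>k. W1 (\<theta>s k) j) \<longlonglongrightarrow> W1 \<theta> j) \<and> (\<forall>j. (\<lambda>k. b1 (\<theta>s k) j) \<longlonglongrightarrow> b1 \<theta> j) \<and>
     (\<forall>k. length (mids (\<theta>s k)) = length (mids \<theta>)) \<and>
     (\<forall>l<length (mids \<theta>). \<forall>i j. (\<lambda>k. fst (mids (\<theta>s k) ! l) i j) \<longlonglongrightarrow> fst (mids \<theta> ! l) i j) \<and>
     (\<forall>l<length (mids \<theta>). \<forall>j. (\<lambda>k. snd (mids (\<theta>s k) ! l) j) \<longlonglongrightarrow> snd (mids \<theta> ! l) j) \<and>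
     (\<forall>i j. (\<lambda>k. WL (\<theta>s k) i j) \<longlonglongrightarrow> WL \<theta> i j) \<and> (\<lambda>k. bL (\<theta>s k)) \<longlonglongrightarrow> bL \<theta>"

lemma net_tendsto_compose:
  assumes "net_tendsto \<theta>s \<theta>" "filterlim r sequentially sequentially"
  shows "net_tendsto (\<lambda>k. \<theta>s (r k)) \<theta>"
  using assms unfolding net_tendsto_def by (auto intro: filterlim_compose[OF _ assms(2)])

lemma mid_eval_tendsto:
  assumes \<sigma>: "continuous_on UNIV \<sigma>"
    and len: "\<And>k. length (Ms k) = length Ls"
    and "\<And>l i j. l < length Ls \<Longrightarrow> (\<lambda>k. fst (Ms k ! l) i j) \<longlonglongrightarrow> fst (Ls ! l) i j"
    and "\<And>l j. l < length Ls \<Longrightarrow> (\<lambda>k. snd (Ms k ! l) j) \<longlonglongrightarrow> snd (Ls ! l) j"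
    and z: "\<And>j. (\<lambda>k. zs k j) \<longlonglongrightarrow> z j"
  shows "(\<lambda>k::nat. mid_eval \<sigma> Ns (Ms k) (zs k) j) \<longlonglongrightarrow> mid_eval \<sigma> Ns Ls z j"
  using assms(2-5)
proof (induction Ls arbitrary: Ns Ms zs z)
  case Nil
  then show ?case by simp
next
  case (Cons l Ls)
  obtain W c where l: "l = (W, c)" by (cases l)
  \<comment> \<open>Equal lengths ensure that every \<open>Ms k\<close> has a first layer, which is
    split off for all \<open>k\<close> simultaneously.\<close>
  define Wk ck Mk where "Wk k = fst (hd (Ms k))" and "ck k = snd (hd (Ms k))" and "Mk k = tl (Ms k)" for k
  have Ms: "Ms k = (Wk k, ck k) # Mk k" for k
    using Cons.prems(1)[of k] by (cases "Ms k") (auto simp: Wk_def ck_def Mk_def)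
  have W: "(\<lambda>k. Wk k i j) \<longlonglongrightarrow> W i j" and c: "(\<lambda>k. ck k j) \<longlonglongrightarrow> c j" for i j
    using Cons.prems(2)[of 0 i j] Cons.prems(3)[of 0 j] by (auto simp: Ms l)
  show ?case
  proof (cases Ns rule: remdups_adj.cases)
    case (3 p q Ns')
    have "(\<lambda>k. mid_eval \<sigma> (q # Ns') (Mk k) (\<lambda>j. if j < q then \<sigma> ((\<Sum>i<p. Wk k j i * zs k i) + ck k j) else 0) j) \<longlonglongrightarrow>
       mid_eval \<sigma> (q # Ns') Ls (\<lambda>j. if j < q then \<sigma> ((\<Sum>i<p. W j i * z i) + c j) else 0) j"
    proof (rule Cons.IH)
      show "length (Mk k) = length Ls" for k using Cons.prems(1)[of k] by (simp add: Ms)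
      show "(\<lambda>k. fst (Mk k ! l) i j) \<longlonglongrightarrow> fst (Ls ! l) i j" if "l < length Ls" for l i j
        using Cons.prems(2)[of "Suc l" i j] that by (simp add: Ms)
      show "(\<lambda>k. snd (Mk k ! l) j) \<longlonglongrightarrow> snd (Ls ! l) j" if "l < length Ls" for l j
        using Cons.prems(3)[of "Suc l" j] that by (simp add: Ms)
      show "(\<lambda>k. if j < q then \<sigma> ((\<Sum>i<p. Wk k j i * zs k i) + ck k j) else 0) \<longlonglongrightarrow>
         (if j < q then \<sigma> ((\<Sum>i<p. W j i * z i) + c j) else 0)" for j
      proof (cases "j < q")
        case True
        have "(\<lambda>k. (\<Sum>i<p. Wk k j i * zs k i) + ck k j) \<longlonglongrightarrow> (\<Sum>i<p. W j i * z i) + c j"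
          by (intro tendsto_intros W c Cons.prems(4))
        then have "(\<lambda>k. \<sigma> ((\<Sum>i<p. Wk k j i * zs k i) + ck k j)) \<longlonglongrightarrow> \<sigma> ((\<Sum>i<p. W j i * z i) + c j)"
          by (rule continuous_on_tendsto_compose[OF \<sigma>]) auto
        then show ?thesis using True by simp
      qed simp
    qed
    then show ?thesis using 3 l by (simp add: Ms)
  qed (use Cons.prems in auto)
qed

text \<open>The argument moves together with the parameters: it is this joint continuity that
  upgrades to uniform convergence on compact sets.\<close>

lemma Fnet_tendsto:
  fixes \<theta>s :: "nat \<Rightarrow> ('n::finite, 'm::finite) netparam"
  assumes \<sigma>: "continuous_on UNIV \<sigma>" and \<theta>: "net_tendsto \<theta>s \<theta>" and x: "xs \<longlonglongrightarrow> x"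
  shows "(\<lambda>k. Fnet \<sigma> Ns (\<theta>s k) (xs k)) \<longlonglongrightarrow> Fnet \<sigma> Ns \<theta> x"
proof -
  have Psi: "(\<lambda>k. Psi \<sigma> Ns (\<theta>s k) (ys k)) \<longlonglongrightarrow> Psi \<sigma> Ns \<theta> y" if y: "ys \<longlonglongrightarrow> y" for ys y
  proof (rule vec_tendstoI)
    fix i
    have z1: "(\<lambda>k. if j < hd Ns then \<sigma> (W1 (\<theta>s k) j \<bullet> ys k + b1 (\<theta>s k) j) else 0) \<longlonglongrightarrow>
      (if j < hd Ns then \<sigma> (W1 \<theta> j \<bullet> y + b1 \<theta> j) else 0)" for j
    proof (cases "j < hd Ns")
      case True
      have "(\<lambda>k. W1 (\<theta>s k) j \<bullet> ys k + b1 (\<theta>s k) j) \<longlonglongrightarrow> W1 \<theta> j \<bullet> y + b1 \<theta> j"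
        using \<theta> y unfolding net_tendsto_def by (intro tendsto_intros) auto
      then have "(\<lambda>k. \<sigma> (W1 (\<theta>s k) j \<bullet> ys k + b1 (\<theta>s k) j)) \<longlonglongrightarrow> \<sigma> (W1 \<theta> j \<bullet> y + b1 \<theta> j)"
        by (rule continuous_on_tendsto_compose[OF \<sigma>]) auto
      then show ?thesis using True by simp
    qed simp
    have z: "(\<lambda>k. mid_eval \<sigma> Ns (mids (\<theta>s k)) (\<lambda>j. if j < hd Ns then \<sigma> (W1 (\<theta>s k) j \<bullet> ys k + b1 (\<theta>s k) j) else 0) j) \<longlonglongrightarrow>
      mid_eval \<sigma> Ns (mids \<theta>) (\<lambda>j. if j < hd Ns then \<sigma> (W1 \<theta> j \<bullet> y + b1 \<theta> j) else 0) j" for j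
      by (rule mid_eval_tendsto[OF \<sigma> _ _ _ z1]) (use \<theta> in \<open>auto simp: net_tendsto_def\<close>)
    have "(\<lambda>k. bL (\<theta>s k)) \<longlonglongrightarrow> bL \<theta>" "\<And>i j. (\<lambda>k. WL (\<theta>s k) i j) \<longlonglongrightarrow> WL \<theta> i j"
      using \<theta> by (auto simp: net_tendsto_def)
    then show "(\<lambda>k. Psi \<sigma> Ns (\<theta>s k) (ys k) $ i) \<longlonglongrightarrow> Psi \<sigma> Ns \<theta> y $ i"
      unfolding Psi_def Let_def by (simp, intro tendsto_intros z)
  qed
  show ?thesis
    unfolding Fnet_def by (intro tendsto_diff Psi x tendsto_const)
qed

text \<open>If uniformity failed, the points witnessing the failure would accumulate in
  \<open>S\<close>, against convergence along moving points. The indices of the failures are only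
  known to satisfy \<open>k N \<ge> N\<close>, so \<open>conv\<close> has to allow any reindexing
  that tends to infinity, not just strictly increasing ones.\<close>

lemma uniform_limit_compactI:
  fixes F :: "'a::metric_space \<Rightarrow> 'b::metric_space"
  assumes S: "compact S" and F: "continuous_on S F"
    and conv: "\<And>r zs z. filterlim r sequentially sequentially \<Longrightarrow> (\<And>n::nat. zs n \<in> S) \<Longrightarrow> z \<in> S \<Longrightarrow> zs \<longlonglongrightarrow> z \<Longrightarrow>
      (\<lambda>n. Fs (r n) (zs n)) \<longlonglongrightarrow> F z"
  shows "uniform_limit S Fs F sequentially"
proof (rule ccontr)
  assume "\<not> ?thesis"
  then obtain e where e: "e > 0" "\<And>N. \<exists>k\<ge>N. \<exists>z\<in>S. \<not> dist (Fs k z) (F z) < e"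
    unfolding uniform_limit_sequentially_iff by blast
  then obtain k zs where kz: "\<And>N. k N \<ge> N" "\<And>N. zs N \<in> S" "\<And>N. \<not> dist (Fs (k N) (zs N)) (F (zs N)) < e"
    by metis
  obtain z r where z: "z \<in> S" "strict_mono r" "(zs \<circ> r) \<longlonglongrightarrow> z"
    using S kz(2) unfolding compact_def by metis
  have "filterlim k sequentially sequentially"
    using kz(1) by (intro filterlim_at_top_mono[OF filterlim_ident]) auto
  then have "filterlim (\<lambda>n. k (r n)) sequentially sequentially"
    using filterlim_compose filterlim_subseq[OF z(2)] by blast
  then have "(\<lambda>n. Fs (k (r n)) (zs (r n))) \<longlonglongrightarrow> F z"
    using conv[of "\<lambda>n. k (r n)" "\<lambda>n. zs (r n)" z] kz(2) z by (simp add: o_def)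
  moreover have "(\<lambda>n. F (zs (r n))) \<longlonglongrightarrow> F z"
    using continuous_on_tendsto_compose[OF F z(3) z(1)] kz(2) by (simp add: o_def)
  ultimately have "(\<lambda>n. dist (Fs (k (r n)) (zs (r n))) (F (zs (r n)))) \<longlonglongrightarrow> dist (F z) (F z)"
    by (rule tendsto_dist)
  then have "eventually (\<lambda>n. dist (Fs (k (r n)) (zs (r n))) (F (zs (r n))) < e) sequentially"
    using e(1) by (intro order_tendstoD) auto
  then show False
    using kz(3) by simp
qed

lemma Fnet_uniform_limit:
  fixes \<theta>s :: "nat \<Rightarrow> ('n::finite, 'm::finite) netparam"
  assumes \<sigma>: "\<sigma> C1_differentiable_on UNIV" and \<theta>: "net_tendsto \<theta>s \<theta>" and S: "compact S"
  shows "uniform_limit S (\<lambda>k. Fnet \<sigma> Ns (\<theta>s k)) (Fnet \<sigma> Ns \<theta>) sequentially"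
proof (rule uniform_limit_compactI[OF S])
  show "continuous_on S (Fnet \<sigma> Ns \<theta>)"
    using Fnet_lipschitz[OF \<sigma> S] lipschitz_on_continuous_on by blast
  have c: "continuous_on UNIV \<sigma>"
    using \<sigma> by (rule C1_differentiable_imp_continuous_on)
  show "(\<lambda>n. Fnet \<sigma> Ns (\<theta>s (r n)) (zs n)) \<longlonglongrightarrow> Fnet \<sigma> Ns \<theta> z"
    if "filterlim r sequentially sequentially" "zs \<longlonglongrightarrow> z" for r zs z
    by (rule Fnet_tendsto[OF c net_tendsto_compose[OF \<theta> that(1)] that(2)])
qed

section \<open>Compactness of the admissible parameters\<close>

text \<open>Bolzano-Weierstrass is applied to one index after the other, in the enumeration
  \<open>from_nat\<close>. The diagonal sequence is, up to finitely many initial terms, a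
  subsequence of each of the sequences obtained on the way.\<close>

lemma bounded_family_convergent_subseq:
  fixes P :: "nat \<Rightarrow> 'i::countable \<Rightarrow> real"
  assumes "\<And>k i. \<bar>P k i\<bar> \<le> D"
  obtains r l where "strict_mono (r::nat \<Rightarrow> nat)" "\<And>i. (\<lambda>k. P (r k) i) \<longlonglongrightarrow> l i"
proof -
  define Q where "Q n s \<longleftrightarrow> convergent (\<lambda>k. P (s k) (from_nat n))" for n and s :: "nat \<Rightarrow> nat"
  interpret subseqs Q
  proof
    fix n and s :: "nat \<Rightarrow> nat"
    have "bounded (range (\<lambda>k. P (s k) (from_nat n)))"
      using assms by (auto simp: bounded_iff)
    then obtain l r where "strict_mono r" "((\<lambda>k. P (s k) (from_nat n)) \<circ> r) \<longlonglongrightarrow> l"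
      using bounded_imp_convergent_subsequence by blast
    then show "\<exists>r. strict_mono r \<and> Q n (s \<circ> r)"
      unfolding Q_def by (auto simp: o_def convergent_def)
  qed
  have "Q n (diagseq \<circ> (+) (Suc n))" for n
  proof (rule diagseq_holds)
    fix r s n assume "strict_mono (r::nat \<Rightarrow> nat)" "Q n s"
    then show "Q n (s \<circ> r)"
      unfolding Q_def convergent_def
      using LIMSEQ_subseq_LIMSEQ[of "\<lambda>k. P (s k) (from_nat n)" _ r] by (auto simp: o_def)
  qed
  then have "convergent (\<lambda>k. P (diagseq (Suc n + k)) (from_nat n))" for n
    unfolding Q_def by (simp add: o_def)
  then have "convergent (\<lambda>k. P (diagseq (k + Suc n)) (from_nat n))" for n
    by (simp only: add.commute[of "Suc _"])
  then have "convergent (\<lambda>k. P (diagseq k) (from_nat n))" for n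
    using convergent_ignore_initial_segment[of "\<lambda>k. P (diagseq k) (from_nat n)" "Suc n"] by simp
  then have "convergent (\<lambda>k. P (diagseq k) i)" for i
    by (rule from_nat_to_nat[of i, THEN subst])
  then have "(\<lambda>k. P (diagseq k) i) \<longlonglongrightarrow> lim (\<lambda>k. P (diagseq k) i)" for i
    by (simp add: convergent_LIMSEQ_iff)
  then show ?thesis
    by (rule that[OF subseq_diagseq])
qed

text \<open>The finite branch of \<open>Greg\<close> without the factor \<alpha>, kept real so that
  it can be subtracted from the total cost.\<close>

definition weight_sq :: "nat list \<Rightarrow> ('n::finite, 'm::finite) netparam \<Rightarrow> real" where
  "weight_sq Ns \<theta> = (\<Sum>l<length (mids \<theta>). \<Sum>j<Ns ! (l+1). \<Sum>k<Ns ! l. (fst (mids \<theta> ! l) j k)\<^sup>2)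
                    + (\<Sum>i\<in>UNIV. \<Sum>k<last Ns. (WL \<theta> i k)\<^sup>2)"

lemma Greg_eq: "in_Rad Ns \<eta>1 \<eta>2 \<theta> \<Longrightarrow> Greg Ns \<eta>1 \<eta>2 \<alpha> \<theta> = ereal (\<alpha> * weight_sq Ns \<theta>)"
  by (simp add: Greg_def weight_sq_def)

lemma weight_sq_nonneg: "weight_sq Ns \<theta> \<ge> 0"
  unfolding weight_sq_def by (intro add_nonneg_nonneg sum_nonneg) auto

lemma weight_sq_tendsto:
  assumes "net_tendsto \<theta>s \<theta>"
  shows "(\<lambda>k. weight_sq Ns (\<theta>s k)) \<longlonglongrightarrow> weight_sq Ns \<theta>"
proof -
  have "length (mids (\<theta>s k)) = length (mids \<theta>)" for k
    using assms by (simp add: net_tendsto_def)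
  then show ?thesis
    using assms unfolding weight_sq_def net_tendsto_def by (auto intro!: tendsto_intros)
qed

lemma mid_weight_sq_le:
  assumes "l < length (mids \<theta>)" "j < Ns ! (l+1)" "k < Ns ! l"
  shows "(fst (mids \<theta> ! l) j k)\<^sup>2 \<le> weight_sq Ns \<theta>"
proof -
  have "(fst (mids \<theta> ! l) j k)\<^sup>2 \<le> (\<Sum>k<Ns ! l. (fst (mids \<theta> ! l) j k)\<^sup>2)"
    using assms by (intro member_le_sum) auto
  also have "\<dots> \<le> (\<Sum>j<Ns ! (l+1). \<Sum>k<Ns ! l. (fst (mids \<theta> ! l) j k)\<^sup>2)"
    using assms by (intro member_le_sum[where f="\<lambda>j. \<Sum>k<Ns ! l. (fst (mids \<theta> ! l) j k)\<^sup>2"] sum_nonneg) auto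
  also have "\<dots> \<le> (\<Sum>l<length (mids \<theta>). \<Sum>j<Ns ! (l+1). \<Sum>k<Ns ! l. (fst (mids \<theta> ! l) j k)\<^sup>2)"
    using assms
    by (intro member_le_sum[where f="\<lambda>l. \<Sum>j<Ns ! (l+1). \<Sum>k<Ns ! l. (fst (mids \<theta> ! l) j k)\<^sup>2"] sum_nonneg) auto
  also have "\<dots> \<le> weight_sq Ns \<theta>"
    unfolding weight_sq_def by (simp add: sum_nonneg)
  finally show ?thesis .
qed

lemma last_weight_sq_le:
  assumes "k < last Ns"
  shows "(WL \<theta> i k)\<^sup>2 \<le> weight_sq Ns \<theta>"
proof -
  have "(WL \<theta> i k)\<^sup>2 \<le> (\<Sum>k<last Ns. (WL \<theta> i k)\<^sup>2)"
    using assms by (intro member_le_sum) auto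
  also have "\<dots> \<le> (\<Sum>i\<in>UNIV. \<Sum>k<last Ns. (WL \<theta> i k)\<^sup>2)"
    by (intro member_le_sum[where f="\<lambda>i. \<Sum>k<last Ns. (WL \<theta> i k)\<^sup>2"] sum_nonneg) auto
  also have "\<dots> \<le> weight_sq Ns \<theta>"
    unfolding weight_sq_def by (simp add: sum_nonneg)
  finally show ?thesis .
qed

lemma abs_le_if_sq_le: "x\<^sup>2 \<le> G \<Longrightarrow> \<bar>x\<bar> \<le> 1 + G" for x G :: real
  using sum_squares_bound[of 1 "\<bar>x\<bar>"] by (simp add: abs_le_square_iff)

text \<open>Admissibility survives the limit because it consists of non-strict bounds and of
  equations with zero, on single entries or finite sums.\<close>

lemma net_convergent_subseq:
  fixes \<theta>s :: "nat \<Rightarrow> ('n::finite, 'm::finite) netparam"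
  assumes ad: "\<And>k. in_Rad Ns \<eta>1 \<eta>2 (\<theta>s k)" and G: "\<And>k. weight_sq Ns (\<theta>s k) \<le> G"
    and pos: "hd Ns > 0" "\<eta>1 \<ge> 0" "\<eta>2 \<ge> 0"
  obtains r \<theta> where "strict_mono r" "net_tendsto (\<lambda>k. \<theta>s (r k)) \<theta>" "in_Rad Ns \<eta>1 \<eta>2 \<theta>"
proof -
  have R: "in_R Ns (\<theta>s k)" for k using ad by (simp add: in_Rad_def)
  define L where "L = length Ns - 1"
  have len: "length (mids (\<theta>s k)) = L" for k using R[of k] by (auto simp: in_R_def L_def)
  \<comment> \<open>The maximum is meaningful because the first hidden layer is nonempty.\<close>
  have Max_iff: "Max ((\<lambda>j. \<Sum>i\<in>UNIV. \<bar>W1 \<theta> j $ i\<bar>) ` {..<hd Ns}) \<le> \<eta>1 \<longleftrightarrow> (\<forall>j<hd Ns. (\<Sum>i\<in>UNIV. \<bar>W1 \<theta> j $ i\<bar>) \<le> \<eta>1)"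
    for \<theta> :: "('n, 'm) netparam"
    using pos by (subst Max_le_iff) auto
  have G0: "G \<ge> 0" using G[of 0] weight_sq_nonneg[of Ns "\<theta>s 0"] by linarith
  \<comment> \<open>One bound for all entries: \<open>\<eta>1\<close> for the first layer,
    \<open>\<eta>2\<close> for the biases and \<open>1 + G\<close> for the remaining weights, whose
    squares are at most \<open>G\<close>.\<close>
  define D where "D = \<eta>1 + \<eta>2 + 1 + G"
  have W1b: "\<bar>W1 (\<theta>s k) j $ i\<bar> \<le> D" for k j i
  proof (cases "j < hd Ns")
    case True
    have "\<bar>W1 (\<theta>s k) j $ i\<bar> \<le> (\<Sum>i\<in>UNIV. \<bar>W1 (\<theta>s k) j $ i\<bar>)"
      by (rule member_le_sum) auto
    also have "\<dots> \<le> \<eta>1" using ad[of k] True unfolding in_Rad_def Max_iff by blast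
    finally show ?thesis using pos G0 by (simp add: D_def)
  qed (use R[of k] pos G0 in \<open>auto simp: in_R_def D_def\<close>)
  have b1b: "\<bar>b1 (\<theta>s k) j\<bar> \<le> D" for k j
  proof (cases "j < hd Ns")
    case True
    then have "\<bar>b1 (\<theta>s k) j\<bar> \<le> \<eta>2" using ad[of k] by (simp add: in_Rad_def)
    then show ?thesis using pos G0 by (simp add: D_def)
  qed (use R[of k] pos G0 in \<open>auto simp: in_R_def D_def\<close>)
  have mWb: "\<bar>fst (mids (\<theta>s k) ! l) i j\<bar> \<le> D" if "l < L" for k l i j
  proof (cases "i < Ns ! (l+1) \<and> j < Ns ! l")
    case True
    then have "(fst (mids (\<theta>s k) ! l) i j)\<^sup>2 \<le> G"
      using mid_weight_sq_le[of l "\<theta>s k" i Ns j] that len G[of k] by fastforce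
    then show ?thesis using abs_le_if_sq_le pos by (fastforce simp: D_def)
  next
    case False
    then have "fst (mids (\<theta>s k) ! l) i j = 0"
      using R[of k] that len[of k] unfolding in_R_def by (meson not_le)
    then show ?thesis using pos G0 by (simp add: D_def)
  qed
  have mbb: "\<bar>snd (mids (\<theta>s k) ! l) j\<bar> \<le> D" if "l < L" for k l j
  proof (cases "j < Ns ! (l+1)")
    case True
    then have "\<bar>snd (mids (\<theta>s k) ! l) j\<bar> \<le> \<eta>2" using ad[of k] that len[of k] by (simp add: in_Rad_def)
    then show ?thesis using pos G0 by (simp add: D_def)
  next
    case False
    then have "snd (mids (\<theta>s k) ! l) j = 0"
      using R[of k] that len[of k] unfolding in_R_def by (meson not_le)
    then show ?thesis using pos G0 by (simp add: D_def)
  qed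
  have WLb: "\<bar>WL (\<theta>s k) i j\<bar> \<le> D" for k i j
  proof (cases "j < last Ns")
    case True
    then have "(WL (\<theta>s k) i j)\<^sup>2 \<le> G"
      using last_weight_sq_le[of j Ns "\<theta>s k" i] G[of k] by linarith
    then show ?thesis using abs_le_if_sq_le pos by (fastforce simp: D_def)
  next
    case False
    then have "WL (\<theta>s k) i j = 0" using R[of k] by (simp add: in_R_def)
    then show ?thesis using pos G0 by (simp add: D_def)
  qed
  have bLb: "\<bar>bL (\<theta>s k) $ i\<bar> \<le> D" for k i
    using ad[of k] pos G0 by (force simp: in_Rad_def D_def intro: order_trans)
  \<comment> \<open>All parameters as one family of reals, indexed by a tag and the row, column and layer numbers.\<close>
  define P :: "nat \<Rightarrow> nat \<times> 'n \<times> 'm \<times> nat \<times> nat \<times> nat \<Rightarrow> real" where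
    "P k = (\<lambda>(tag, n, m, l, i, j).
      if tag = 0 then W1 (\<theta>s k) j $ n else if tag = 1 then b1 (\<theta>s k) j
      else if tag = 2 then (if l < L then fst (mids (\<theta>s k) ! l) i j else 0)
      else if tag = 3 then (if l < L then snd (mids (\<theta>s k) ! l) j else 0)
      else if tag = 4 then WL (\<theta>s k) m j else bL (\<theta>s k) $ m)" for k
  have P: "\<bar>P k c\<bar> \<le> D" for k c
    using W1b b1b mWb mbb WLb bLb pos G0 by (cases c) (auto simp: P_def D_def)
  obtain r l where r: "strict_mono r" and lim: "\<And>c. (\<lambda>k. P (r k) c) \<longlonglongrightarrow> l c"
    using bounded_family_convergent_subseq[of P D, OF P] by blast
  \<comment> \<open>Placeholders: an entry that does not depend on an input or output coordinate is
    read off at an arbitrary one.\<close>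
  define n0 :: 'n where "n0 = undefined"
  define m0 :: 'm where "m0 = undefined"
  define \<theta> :: "('n, 'm) netparam" where
    "\<theta> = \<lparr>W1 = (\<lambda>j. \<chi> n. l (0, n, m0, 0, 0, j)), b1 = (\<lambda>j. l (1, n0, m0, 0, 0, j)),
      mids = map (\<lambda>p. (\<lambda>i j. l (2, n0, m0, p, i, j), \<lambda>j. l (3, n0, m0, p, 0, j))) [0..<L],
      WL = (\<lambda>m j. l (4, n0, m, 0, 0, j)), bL = (\<chi> m. l (5, n0, m, 0, 0, 0))\<rparr>"
  have conv: "net_tendsto (\<lambda>k. \<theta>s (r k)) \<theta>"
    unfolding net_tendsto_def
  proof (intro conjI allI impI)
    show "(\<lambda>k. W1 (\<theta>s (r k)) j) \<longlonglongrightarrow> W1 \<theta> j" for j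
      by (rule vec_tendstoI) (use lim[of "(0, _, m0, 0, 0, j)"] in \<open>simp add: P_def \<theta>_def\<close>)
    show "(\<lambda>k. b1 (\<theta>s (r k)) j) \<longlonglongrightarrow> b1 \<theta> j" for j
      using lim[of "(1, n0, m0, 0, 0, j)"] by (simp add: P_def \<theta>_def)
    show "length (mids (\<theta>s (r k))) = length (mids \<theta>)" for k
      by (simp add: len \<theta>_def)
    show "(\<lambda>k. fst (mids (\<theta>s (r k)) ! p) i j) \<longlonglongrightarrow> fst (mids \<theta> ! p) i j" if "p < length (mids \<theta>)" for p i j
      using lim[of "(2, n0, m0, p, i, j)"] that by (simp add: P_def \<theta>_def)
    show "(\<lambda>k. snd (mids (\<theta>s (r k)) ! p) j) \<longlonglongrightarrow> snd (mids \<theta> ! p) j" if "p < length (mids \<theta>)" for p j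
      using lim[of "(3, n0, m0, p, 0, j)"] that by (simp add: P_def \<theta>_def)
    show "(\<lambda>k. WL (\<theta>s (r k)) i j) \<longlonglongrightarrow> WL \<theta> i j" for i j
      using lim[of "(4, n0, i, 0, 0, j)"] by (simp add: P_def \<theta>_def)
    show "(\<lambda>k. bL (\<theta>s (r k))) \<longlonglongrightarrow> bL \<theta>"
      by (rule vec_tendstoI) (use lim[of "(5, n0, _, 0, 0, 0)"] in \<open>simp add: P_def \<theta>_def\<close>)
  qed
  have zero: "x = 0" if "f \<longlonglongrightarrow> x" "\<And>k. f k = 0" for f :: "nat \<Rightarrow> 'x::real_normed_vector" and x
    using that(1) unfolding that(2) by (simp add: LIMSEQ_const_iff)
  have len': "length (mids \<theta>) = L" by (simp add: \<theta>_def)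
  have T: "(\<lambda>k. W1 (\<theta>s (r k)) j) \<longlonglongrightarrow> W1 \<theta> j" "(\<lambda>k. b1 (\<theta>s (r k)) j) \<longlonglongrightarrow> b1 \<theta> j"
    "p < L \<Longrightarrow> (\<lambda>k. fst (mids (\<theta>s (r k)) ! p) i j) \<longlonglongrightarrow> fst (mids \<theta> ! p) i j"
    "p < L \<Longrightarrow> (\<lambda>k. snd (mids (\<theta>s (r k)) ! p) j) \<longlonglongrightarrow> snd (mids \<theta> ! p) j"
    "(\<lambda>k. WL (\<theta>s (r k)) m j) \<longlonglongrightarrow> WL \<theta> m j" "(\<lambda>k. bL (\<theta>s (r k))) \<longlonglongrightarrow> bL \<theta>" for i j p m
    using conv by (auto simp: net_tendsto_def len')
  have inR: "in_R Ns \<theta>"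
    unfolding in_R_def len'
  proof (intro conjI allI impI)
    show "L + 1 = length Ns" using R[of 0] len[of 0] by (simp add: in_R_def)
    show "W1 \<theta> j = 0" "b1 \<theta> j = 0" if "hd Ns \<le> j" for j
      by (rule zero[OF T(1)] zero[OF T(2)]; use R that in \<open>simp add: in_R_def\<close>)+
    show "fst (mids \<theta> ! p) i j = 0" if "p < L" "Ns ! (p+1) \<le> i \<or> Ns ! p \<le> j" for p i j
      by (rule zero[OF T(3)[OF that(1)]]) (use R that len in \<open>auto simp: in_R_def\<close>)
    show "snd (mids \<theta> ! p) j = 0" if "p < L" "Ns ! (p+1) \<le> j" for p j
      by (rule zero[OF T(4)[OF that(1)]]) (use R that len in \<open>auto simp: in_R_def\<close>)
    show "WL \<theta> i j = 0" if "last Ns \<le> j" for i j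
      by (rule zero[OF T(5)]) (use R that in \<open>simp add: in_R_def\<close>)
  qed
  have "in_Rad Ns \<eta>1 \<eta>2 \<theta>"
    unfolding in_Rad_def Max_iff len'
  proof (intro conjI allI impI inR)
    fix j assume j: "j < hd Ns"
    have "(\<lambda>k. \<Sum>i\<in>UNIV. \<bar>W1 (\<theta>s (r k)) j $ i\<bar>) \<longlonglongrightarrow> (\<Sum>i\<in>UNIV. \<bar>W1 \<theta> j $ i\<bar>)"
      by (intro tendsto_intros T)
    then show "(\<Sum>i\<in>UNIV. \<bar>W1 \<theta> j $ i\<bar>) \<le> \<eta>1"
      by (rule LIMSEQ_le_const2) (use ad j in \<open>auto simp: in_Rad_def Max_iff\<close>)
    show "\<bar>b1 \<theta> j\<bar> \<le> \<eta>2"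
      by (rule LIMSEQ_le_const2[OF tendsto_rabs[OF T(2)]]) (use ad j in \<open>auto simp: in_Rad_def\<close>)
  next
    fix p j assume p: "p < L" "j < Ns ! (p + 1)"
    show "\<bar>snd (mids \<theta> ! p) j\<bar> \<le> \<eta>2"
      by (rule LIMSEQ_le_const2[OF tendsto_rabs[OF T(4)[OF p(1)]]]) (use ad p len in \<open>auto simp: in_Rad_def\<close>)
  next
    fix i
    show "\<bar>bL \<theta> $ i\<bar> \<le> \<eta>2"
      by (rule LIMSEQ_le_const2[OF tendsto_rabs[OF tendsto_vec_nth[OF T(6)]]]) (use ad in \<open>auto simp: in_Rad_def\<close>)
  qed
  with r conv show ?thesis by (rule that)
qed

section \<open>Costs and existence of minimizers\<close>

lemma Jcost_nonneg: "\<beta> \<ge> 0 \<Longrightarrow> Jcost Q \<beta> y u \<ge> 0"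
  unfolding Jcost_def set_lebesgue_integral_def
  by (intro mult_nonneg_nonneg integral_nonneg_AE AE_I2) auto

lemma jcost_nonneg: "\<beta> \<ge> 0 \<Longrightarrow> jcost \<mu> Q \<beta> F Y \<ge> 0"
  unfolding jcost_def by (intro integral_nonneg_AE AE_I2 Jcost_nonneg)

text \<open>The representation as a nonnegative integral makes Fatou's lemma and measurability
  arguments applicable. The upper bound is independent of \<open>x\<close> and makes the cost
  integrable over the ensemble; it comes from the linear growth of \<open>Q\<close> and
  \<open>F\<close>.\<close>

lemma Jcost_ode_sol:
  fixes y :: "real \<Rightarrow> real^'n" and F :: "real^'n \<Rightarrow> real^'m"
  assumes C: "C > 0" "\<And>y :: real \<Rightarrow> real^'n. is_W y \<Longrightarrow> \<forall>t\<ge>0. norm (y t) \<le> C * Wnorm y"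
    and y: "ode_sol h b x y" and F: "K-lipschitz_on (cball 0 (C * b)) F" "F 0 = 0" and \<beta>: "\<beta> \<ge> 0"
  shows "ennreal (Jcost Q \<beta> y (\<lambda>t. F (y t))) =
      (\<integral>\<^sup>+t. ennreal (indicator {0..} t * (1/2 * ((norm (Q *v y t))\<^sup>2 + \<beta> * (norm (F (y t)))\<^sup>2))) \<partial>lborel)"
    and "Jcost Q \<beta> y (\<lambda>t. F (y t)) \<le> 1/2 * ((onorm ((*v) Q))\<^sup>2 + \<beta> * K\<^sup>2) * b\<^sup>2"
proof -
  have W: "is_W y" "Wnorm y \<le> b" using y by (auto simp: ode_sol_def)
  obtain v where v: "has_Wderiv y v" using W by (auto simp: is_W_def)
  have L: "L2fun y" "L2fun v" using W has_WderivD(1)[OF v] by (auto simp: is_W_def)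
  have b: "b \<ge> 0" using W(2) Wnorm_nonneg[of y] by linarith
  have yS: "y t \<in> cball 0 (C * b)" if "t \<ge> 0" for t using ode_sol_bounded[OF C y that] .
  have Q: "bounded_linear ((*v) Q)" by (simp add: matrix_vector_mul_bounded_linear)
  have Qle: "norm (Q *v z) \<le> onorm ((*v) Q) * norm z" for z using onorm[OF Q] .
  have Qlip: "(onorm ((*v) Q))-lipschitz_on (cball 0 (C * b)) ((*v) Q)"
  proof (rule lipschitz_onI)
    show "dist (Q *v z) (Q *v w) \<le> onorm ((*v) Q) * dist z w" for z w
      using Qle[of "z - w"] by (simp add: dist_norm matrix_vector_mult_diff_distrib)
  qed (rule onorm_pos_le[OF Q])
  have LQ: "L2fun (\<lambda>t. Q *v y t)"
    by (rule L2fun_lipschitz_comp[OF W(1) yS Qlip]) auto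
  have LF: "L2fun (\<lambda>t. F (y t))"
    by (rule L2fun_lipschitz_comp[OF W(1) yS F]) auto
  let ?q = "\<lambda>t. (norm (Q *v y t))\<^sup>2 + \<beta> * (norm (F (y t)))\<^sup>2"
  have q: "set_integrable lborel {0..} ?q"
    by (rule set_integral_add(1)[OF _ set_integrable_mult_right]) (use LQ LF in \<open>auto simp: L2fun_def\<close>)
  have q': "integrable lborel (\<lambda>t. indicator {0..} t * (1/2 * ?q t))"
    using set_integrable_mult_right[of "1/2", OF q] by (simp add: set_integrable_def)
  have J: "Jcost Q \<beta> y (\<lambda>t. F (y t)) = (LINT t|lborel. indicator {0..} t * (1/2 * ?q t))"
    unfolding Jcost_def set_integral_mult_right[symmetric] by (simp add: set_lebesgue_integral_def)
  show "ennreal (Jcost Q \<beta> y (\<lambda>t. F (y t))) =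
      (\<integral>\<^sup>+t. ennreal (indicator {0..} t * (1/2 * ?q t)) \<partial>lborel)"
    unfolding J using \<beta> by (intro nn_integral_eq_integral[symmetric] q') auto
  define c where "c = 1/2 * ((onorm ((*v) Q))\<^sup>2 + \<beta> * K\<^sup>2)"
  have c: "c \<ge> 0" using \<beta> by (simp add: c_def)
  have W2: "integrable lborel (\<lambda>t. indicator {0..} t * (c * ((norm (y t))\<^sup>2 + (norm (v t))\<^sup>2)))"
  proof -
    have "set_integrable lborel {0..} (\<lambda>t. (norm (y t))\<^sup>2 + (norm (v t))\<^sup>2)"
      using L by (intro set_integral_add(1)) (auto simp: L2fun_def)
    from set_integrable_mult_right[of c, OF this] show ?thesis by (simp add: set_integrable_def)
  qed
  have "Jcost Q \<beta> y (\<lambda>t. F (y t)) \<le> (LINT t|lborel. indicator {0..} t * (c * ((norm (y t))\<^sup>2 + (norm (v t))\<^sup>2)))"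
    unfolding J
  proof (rule integral_mono[OF q' W2])
    fix t :: real
    show "indicator {0..} t * (1/2 * ?q t) \<le> indicator {0..} t * (c * ((norm (y t))\<^sup>2 + (norm (v t))\<^sup>2))"
    proof (cases "t \<ge> 0")
      case True
      have "norm (F (y t)) \<le> K * norm (y t)"
        using lipschitz_onD[OF F(1) yS[OF True], of 0] F(2) b C(1) by (simp add: dist_norm)
      then have "(norm (F (y t)))\<^sup>2 \<le> (K * norm (y t))\<^sup>2" by (intro power_mono) auto
      then have "\<beta> * (norm (F (y t)))\<^sup>2 \<le> \<beta> * (K * norm (y t))\<^sup>2" using \<beta> by (rule mult_left_mono)
      moreover have "(norm (Q *v y t))\<^sup>2 \<le> (onorm ((*v) Q) * norm (y t))\<^sup>2"
        using Qle by (intro power_mono) auto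
      ultimately have "1/2 * ?q t \<le> c * (norm (y t))\<^sup>2"
        unfolding c_def by (simp add: power_mult_distrib algebra_simps)
      also have "\<dots> \<le> c * ((norm (y t))\<^sup>2 + (norm (v t))\<^sup>2)"
        using c by (intro mult_left_mono) auto
      finally show ?thesis using True by simp
    qed simp
  qed
  also have "\<dots> = c * (Wnorm y)\<^sup>2"
    unfolding Wnorm_sq[OF L(1) v] set_lebesgue_integral_def real_scaleR_def mult.left_commute[of _ c]
    by (rule integral_mult_right_zero)
  also have "\<dots> \<le> c * b\<^sup>2"
    using c W Wnorm_nonneg by (intro mult_left_mono power_mono) auto
  finally show "Jcost Q \<beta> y (\<lambda>t. F (y t)) \<le> 1/2 * ((onorm ((*v) Q))\<^sup>2 + \<beta> * K\<^sup>2) * b\<^sup>2"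
    unfolding c_def .
qed

section \<open>Measurability and lower semicontinuity of the cost\<close>

text \<open>By continuity in time, \<open>g\<close> is the limit of its values at the grid points
  obtained by rounding \<open>t\<close> down to a multiple of \<open>1 / Suc n\<close>. Each
  approximation glues countably many functions of \<open>x\<close> alone.\<close>

lemma caratheodory_measurable:
  fixes g :: "'x \<Rightarrow> real \<Rightarrow> 'a::{banach, second_countable_topology}"
  assumes m: "\<And>t. (\<lambda>x. g x t) \<in> borel_measurable \<mu>" and c: "\<And>x. x \<in> space \<mu> \<Longrightarrow> continuous_on UNIV (g x)"
  shows "(\<lambda>(x, t). g x t) \<in> borel_measurable (\<mu> \<Otimes>\<^sub>M lborel)"
proof (rule borel_measurable_LIMSEQ_metric)
  let ?q = "\<lambda>n t. real_of_int \<lfloor>real (Suc n) * t\<rfloor> / real (Suc n)"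
  show "(\<lambda>(x, t). g x (?q n t)) \<in> borel_measurable (\<mu> \<Otimes>\<^sub>M lborel)" for n
  proof -
    have "(\<lambda>p. g (fst p) (real_of_int i / real (Suc n))) \<in> borel_measurable (\<mu> \<Otimes>\<^sub>M lborel)" for i :: int
      by (rule measurable_compose[OF measurable_fst m])
    moreover have "(\<lambda>p. \<lfloor>real (Suc n) * snd p\<rfloor>) \<in> measurable (\<mu> \<Otimes>\<^sub>M lborel) (count_space UNIV)"
      by measurable
    ultimately have "(\<lambda>p. g (fst p) (?q n (snd p))) \<in> borel_measurable (\<mu> \<Otimes>\<^sub>M lborel)"
      by (rule measurable_compose_countable)
    then show ?thesis by (simp add: case_prod_beta')
  qed
  fix p :: "'x \<times> real" assume p: "p \<in> space (\<mu> \<Otimes>\<^sub>M lborel)"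
  have q: "(\<lambda>n. ?q n t) \<longlonglongrightarrow> t" for t :: real
  proof (rule LIM_zero_cancel, rule Lim_null_comparison[OF _ LIMSEQ_inverse_real_of_nat])
    have "norm (?q n t - t) \<le> inverse (real (Suc n))" for n
    proof -
      have "norm (?q n t - t) = \<bar>real_of_int \<lfloor>real (Suc n) * t\<rfloor> - real (Suc n) * t\<bar> / real (Suc n)"
        by (simp add: field_simps abs_mult[symmetric] del: of_nat_Suc)
      also have "\<dots> \<le> 1 / real (Suc n)"
        by (intro divide_right_mono) linarith+
      finally show ?thesis by (simp add: inverse_eq_divide)
    qed
    then show "eventually (\<lambda>n. norm (?q n t - t) \<le> inverse (real (Suc n))) sequentially" by simp
  qed
  have "fst p \<in> space \<mu>" using p by (auto simp: space_pair_measure)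
  then have "(\<lambda>n. g (fst p) (?q n (snd p))) \<longlonglongrightarrow> g (fst p) (snd p)"
    by (intro continuous_on_tendsto_compose[OF c q]) auto
  then show "(\<lambda>n. case p of (x, t) \<Rightarrow> g x (?q n t)) \<longlonglongrightarrow> (case p of (x, t) \<Rightarrow> g x t)"
    by (simp add: case_prod_beta')
qed

lemma integrable_Jcost:
  fixes Y :: "real^'n \<Rightarrow> real \<Rightarrow> real^'n" and F :: "real^'n \<Rightarrow> real^'m"
  assumes C: "C > 0" "\<And>y :: real \<Rightarrow> real^'n. is_W y \<Longrightarrow> \<forall>t\<ge>0. norm (y t) \<le> C * Wnorm y"
    and fin: "finite_measure \<mu>" and compl: "complete_measure \<mu>"
    and Y: "strongly_meas \<mu> Y" "AE x in \<mu>. ode_sol h b x (Y x)"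
    and F: "K-lipschitz_on (cball 0 (C * b)) F" "F 0 = 0" "continuous_on UNIV F" and \<beta>: "\<beta> \<ge> 0"
  shows "integrable \<mu> (\<lambda>x. Jcost Q \<beta> (Y x) (\<lambda>t. F (Y x t)))"
proof (rule finite_measure.integrable_const_bound[OF fin])
  show "AE x in \<mu>. norm (Jcost Q \<beta> (Y x) (\<lambda>t. F (Y x t))) \<le> 1/2 * ((onorm ((*v) Q))\<^sup>2 + \<beta> * K\<^sup>2) * b\<^sup>2"
    using Y(2)
  proof eventually_elim
    case (elim x)
    show ?case using Jcost_ode_sol(2)[OF C elim F(1,2) \<beta>, of Q] Jcost_nonneg[OF \<beta>, of Q "Y x" "\<lambda>t. F (Y x t)"] by simp
  qed
  have W: "AE x in \<mu>. is_W (Y x)"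
    using Y(2) by eventually_elim (simp add: ode_sol_def)
  \<comment> \<open>On the null set where \<open>Y x\<close> is not a trajectory it is replaced by
    zero, so that every section is continuous on the half-line.\<close>
  define Z where "Z x = (if is_W (Y x) then Y x else (\<lambda>_. 0))" for x
  have ZY: "AE x in \<mu>. Z x = Y x"
    using W by eventually_elim (simp add: Z_def)
  have Zm: "(\<lambda>x. Z x t) \<in> borel_measurable \<mu>" if "t \<ge> 0" for t
    using strongly_meas_eval_measurable[OF C(2) compl Y(1) W that]
    by (rule complete_measure.borel_measurable_AE_cong[OF compl]) (use ZY in \<open>auto elim!: eventually_mono\<close>)
  have Zc: "continuous_on {0..} (Z x)" for x
  proof -
    have "is_W (Z x)" by (auto simp: Z_def is_W_zero)
    then show ?thesis using has_Wderiv_continuous_on by (auto simp: is_W_def)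
  qed
  \<comment> \<open>Values at negative times are arbitrary; \<open>max 0 t\<close> extends each
    section continuously to the whole line.\<close>
  have [measurable]: "(\<lambda>(x, t). Z x (max 0 t)) \<in> borel_measurable (\<mu> \<Otimes>\<^sub>M lborel)"
  proof (rule caratheodory_measurable)
    show "continuous_on UNIV (\<lambda>t. Z x (max 0 t))" for x
      by (rule continuous_on_compose2[OF Zc]) (auto intro!: continuous_intros)
  qed (use Zm in simp)
  have [measurable]: "F \<in> borel_measurable borel"
    using F(3) by (rule borel_measurable_continuous_onI)
  have [measurable]: "(*v) Q \<in> borel_measurable borel"
    by (intro borel_measurable_continuous_onI linear_continuous_on matrix_vector_mul_bounded_linear)
  let ?G = "\<lambda>z. 1/2 * ((norm (Q *v z))\<^sup>2 + \<beta> * (norm (F z))\<^sup>2)"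
  have "(\<lambda>z. ?G z) \<in> borel_measurable borel" by measurable
  from measurable_compose[OF \<open>(\<lambda>(x, t). Z x (max 0 t)) \<in> _\<close> this]
  have [measurable]: "(\<lambda>p. ?G (Z (fst p) (max 0 (snd p)))) \<in> borel_measurable (\<mu> \<Otimes>\<^sub>M lborel)"
    by (simp add: case_prod_beta')
  have "(\<lambda>p. ennreal (indicator {0..} (snd p) * ?G (Z (fst p) (max 0 (snd p))))) \<in> borel_measurable (\<mu> \<Otimes>\<^sub>M lborel)"
    by measurable
  then have "(\<lambda>x. \<integral>\<^sup>+t. ennreal (indicator {0..} t * ?G (Z x (max 0 t))) \<partial>lborel) \<in> borel_measurable \<mu>"
    by (intro sigma_finite_measure.borel_measurable_nn_integral[OF sigma_finite_lborel]) (simp add: case_prod_beta')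
  then have m: "(\<lambda>x. enn2real (\<integral>\<^sup>+t. ennreal (indicator {0..} t * ?G (Z x (max 0 t))) \<partial>lborel)) \<in> borel_measurable \<mu>"
    by measurable
  show "(\<lambda>x. Jcost Q \<beta> (Y x) (\<lambda>t. F (Y x t))) \<in> borel_measurable \<mu>"
  proof (rule complete_measure.borel_measurable_AE_cong[OF compl m])
    show "AE x in \<mu>. Jcost Q \<beta> (Y x) (\<lambda>t. F (Y x t)) = enn2real (\<integral>\<^sup>+t. ennreal (indicator {0..} t * ?G (Z x (max 0 t))) \<partial>lborel)"
      using Y(2) ZY
    proof eventually_elim
      case (elim x)
      have "(\<integral>\<^sup>+t. ennreal (indicator {0..} t * ?G (Z x (max 0 t))) \<partial>lborel) = (\<integral>\<^sup>+t. ennreal (indicator {0..} t * ?G (Y x t)) \<partial>lborel)"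
        unfolding elim(2) by (intro nn_integral_cong) (auto simp: indicator_def)
      also have "\<dots> = ennreal (Jcost Q \<beta> (Y x) (\<lambda>t. F (Y x t)))"
        by (rule Jcost_ode_sol(1)[OF C elim(1) F(1,2) \<beta>, symmetric])
      finally show ?case by (simp add: Jcost_nonneg[OF \<beta>])
    qed
  qed
qed

text \<open>The integrands converge at every time, because the states converge and the feedback laws
  converge uniformly on the ball. Cost may be lost at late times, so Fatou's lemma gives an
  inequality only.\<close>

lemma Jcost_le_liminf:
  fixes ys :: "nat \<Rightarrow> real \<Rightarrow> real^'n" and F :: "real^'n \<Rightarrow> real^'m"
  assumes C: "C > 0" "\<And>y :: real \<Rightarrow> real^'n. is_W y \<Longrightarrow> \<forall>t\<ge>0. norm (y t) \<le> C * Wnorm y"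
    and ys: "\<And>k. ode_sol (hs k) b x (ys k)" and y: "ode_sol h b x y"
    and lim: "\<And>t. t \<ge> 0 \<Longrightarrow> (\<lambda>k. ys k t) \<longlonglongrightarrow> y t"
    and u: "uniform_limit (cball 0 (C * b)) Fs F sequentially"
    and F: "K-lipschitz_on (cball 0 (C * b)) F" "F 0 = 0"
    and Fs: "\<And>k. \<exists>K. K-lipschitz_on (cball 0 (C * b)) (Fs k)" "\<And>k. Fs k 0 = 0" and \<beta>: "\<beta> \<ge> 0"
  shows "ennreal (Jcost Q \<beta> y (\<lambda>t. F (y t))) \<le> liminf (\<lambda>k. ennreal (Jcost Q \<beta> (ys k) (\<lambda>t. Fs k (ys k t))))"
proof -
  let ?g = "\<lambda>t. indicator {0..} t * (1/2 * ((norm (Q *v y t))\<^sup>2 + \<beta> * (norm (F (y t)))\<^sup>2)) :: real"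
  let ?gs = "\<lambda>k t. indicator {0..} t * (1/2 * ((norm (Q *v ys k t))\<^sup>2 + \<beta> * (norm (Fs k (ys k t)))\<^sup>2)) :: real"
  have J: "ennreal (Jcost Q \<beta> (ys k) (\<lambda>t. Fs k (ys k t))) = (\<integral>\<^sup>+t. ennreal (?gs k t) \<partial>lborel)" for k
  proof -
    obtain Kk where "Kk-lipschitz_on (cball 0 (C * b)) (Fs k)" using Fs(1) by blast
    from Jcost_ode_sol(1)[OF C ys this Fs(2) \<beta>] show ?thesis .
  qed
  have Qc: "continuous_on UNIV ((*v) Q)"
    by (intro linear_continuous_on matrix_vector_mul_bounded_linear)
  have gm: "(\<lambda>t. ennreal (?gs k t)) \<in> borel_measurable lborel" for k
  proof -
    have W: "is_W (ys k)" using ys[of k] by (simp add: ode_sol_def)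
    then have c: "continuous_on {0..} (ys k)" using has_Wderiv_continuous_on by (auto simp: is_W_def)
    obtain Kk where "Kk-lipschitz_on (cball 0 (C * b)) (Fs k)" using Fs(1) by blast
    then have "continuous_on (cball 0 (C * b)) (Fs k)" by (rule lipschitz_on_continuous_on)
    then have "continuous_on {0..} (\<lambda>t. Fs k (ys k t))"
      by (rule continuous_on_compose2[OF _ c]) (use ode_sol_bounded[OF C ys] in auto)
    moreover have "continuous_on {0..} (\<lambda>t. Q *v ys k t)"
      by (rule continuous_on_compose2[OF Qc c]) auto
    ultimately have "continuous_on {0..} (\<lambda>t. 1/2 * ((norm (Q *v ys k t))\<^sup>2 + \<beta> * (norm (Fs k (ys k t)))\<^sup>2))"
      by (intro continuous_intros)
    from borel_measurable_continuous_on_indicator[OF _ this]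
    have "?gs k \<in> borel_measurable borel" by simp
    then show ?thesis by measurable
  qed
  have "ennreal (Jcost Q \<beta> y (\<lambda>t. F (y t))) = (\<integral>\<^sup>+t. ennreal (?g t) \<partial>lborel)"
    by (rule Jcost_ode_sol(1)[OF C y F \<beta>])
  also have "\<dots> \<le> (\<integral>\<^sup>+t. liminf (\<lambda>k. ennreal (?gs k t)) \<partial>lborel)"
  proof (rule nn_integral_mono)
    fix t :: real
    have "(\<lambda>k. ?gs k t) \<longlonglongrightarrow> ?g t"
    proof (cases "t \<ge> 0")
      case True
      have "(\<lambda>k. Fs k (ys k t)) \<longlonglongrightarrow> F (y t)"
        using True lim ode_sol_bounded[OF C ys] ode_sol_bounded[OF C y]
        by (intro uniform_limit_tendsto_compose[OF u lipschitz_on_continuous_on[OF F(1)]]) auto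
      moreover have "(\<lambda>k. Q *v ys k t) \<longlonglongrightarrow> Q *v y t"
        by (rule continuous_on_tendsto_compose[OF Qc lim[OF True]]) auto
      ultimately show ?thesis by (intro tendsto_intros)
    qed simp
    then have "(\<lambda>k. ennreal (?gs k t)) \<longlonglongrightarrow> ennreal (?g t)"
      by (rule tendsto_ennrealI)
    from lim_imp_Liminf[OF sequentially_bot this]
    show "ennreal (?g t) \<le> liminf (\<lambda>k. ennreal (?gs k t))"
      by (rule eq_refl[OF sym])
  qed
  also have "\<dots> \<le> liminf (\<lambda>k. \<integral>\<^sup>+t. ennreal (?gs k t) \<partial>lborel)"
    by (intro nn_integral_liminf gm)
  finally show ?thesis
    unfolding J .
qed

section \<open>Passage to the limit in ensemble solutions\<close>

lemma Fnet_zero [simp]: "Fnet \<sigma> Ns \<theta> 0 = 0"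
  by (simp add: Fnet_def)

lemma continuous_on_Fnet:
  assumes "continuous_on UNIV \<sigma>"
  shows "continuous_on UNIV (Fnet \<sigma> Ns \<theta>)"
proof -
  have "net_tendsto (\<lambda>_. \<theta>) \<theta>" by (simp add: net_tendsto_def)
  from Fnet_tendsto[OF assms this] show ?thesis
    unfolding continuous_on_sequentially by (simp add: o_def)
qed

lemma closed_loop_lipschitz:
  fixes B :: "real^'m^'n"
  assumes "Kf-lipschitz_on S f" "\<exists>K. K-lipschitz_on S F"
  shows "\<exists>K. K-lipschitz_on S (\<lambda>z. f z + B *v F z)"
proof -
  obtain K where K: "K-lipschitz_on S F" using assms by blast
  obtain K' where "K'-lipschitz_on (F ` S) ((*v) B)"
    using bounded_linear.lipschitz_boundE[OF matrix_vector_mul_bounded_linear] by blast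
  from lipschitz_on_add[OF assms(1) lipschitz_on_compose2[OF K this]] show ?thesis by blast
qed

lemma ens_sol_limit:
  fixes Ys :: "nat \<Rightarrow> real^'n \<Rightarrow> real \<Rightarrow> real^'n" and B :: "real^'m^'n" and Fs :: "nat \<Rightarrow> real^'n \<Rightarrow> real^'m"
  assumes C: "C > 0" "\<And>y :: real \<Rightarrow> real^'n. is_W y \<Longrightarrow> \<forall>t\<ge>0. norm (y t) \<le> C * Wnorm y"
    and fin: "finite_measure \<mu>" and compl: "complete_measure \<mu>"
    and f: "Kf-lipschitz_on (cball 0 (C * b)) f" "f 0 = 0"
    and F: "\<exists>K. K-lipschitz_on (cball 0 (C * b)) F" "F 0 = 0" "continuous_on UNIV F"
    and Fs: "\<And>k. \<exists>K. K-lipschitz_on (cball 0 (C * b)) (Fs k)" "\<And>k. Fs k 0 = 0" "\<And>k. continuous_on UNIV (Fs k)"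
    and u: "uniform_limit (cball 0 (C * b)) Fs F sequentially"
    and Ys: "\<And>k. ens_sol \<mu> f B b (Fs k) (Ys k)" and \<beta>: "\<beta> \<ge> 0"
  obtains Y where "ens_sol \<mu> f B b F Y"
    "ennreal (jcost \<mu> Q \<beta> F Y) \<le> liminf (\<lambda>k. ennreal (jcost \<mu> Q \<beta> (Fs k) (Ys k)))"
proof -
  let ?h = "\<lambda>z. f z + B *v F z" and ?hs = "\<lambda>k z. f z + B *v Fs k z"
  obtain K where K: "K-lipschitz_on (cball 0 (C * b)) F" using F by blast
  obtain Kh where h: "Kh-lipschitz_on (cball 0 (C * b)) ?h" using closed_loop_lipschitz[OF f(1) F(1)] by blast
  have h0: "?h 0 = 0" using f F by simp
  have hs: "\<exists>K. K-lipschitz_on (cball 0 (C * b)) (?hs k)" "?hs k 0 = 0" for k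
    using closed_loop_lipschitz[OF f(1) Fs(1)[of k]] f Fs by simp_all
  have uh: "uniform_limit (cball 0 (C * b)) ?hs ?h sequentially"
    by (intro uniform_limit_add uniform_limit_const
      bounded_linear.uniform_limit[OF matrix_vector_mul_bounded_linear] u)
  have ode: "AE x in \<mu>. ode_sol (?hs k) b x (Ys k x)" for k
  proof -
    obtain K where "K-lipschitz_on (cball 0 (C * b)) (?hs k)" using hs by blast
    from ens_sol_imp_ode_sol[OF C fin Ys this hs(2)] show ?thesis .
  qed
  then have good: "AE x in \<mu>. \<forall>k. ode_sol (?hs k) b x (Ys k x)"
    unfolding AE_all_countable by blast
  have sm: "strongly_meas \<mu> (Ys k)" and W: "AE x in \<mu>. is_W (Ys k x)" for k
    using Ys[of k] by (auto simp: ens_sol_def elim!: eventually_mono)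
  \<comment> \<open>\<open>lim\<close> returns some value even where the sequence diverges; this can
    affect only the null set of initial values outside \<open>good\<close>.\<close>
  define Y where "Y x t = lim (\<lambda>k. Ys k x t)" for x t
  have conv: "t \<ge> 0 \<Longrightarrow> (\<lambda>k. Ys k x t) \<longlonglongrightarrow> Y x t" "ode_sol ?h b x (Y x)"
    "t \<ge> 0 \<Longrightarrow> (\<lambda>k. Wnorm (\<lambda>s. cutoff t 1 (Ys k x) s - cutoff t 1 (Y x) s)) \<longlonglongrightarrow> 0"
    if "\<forall>k. ode_sol (?hs k) b x (Ys k x)" for x t
    using ode_sol_convergent[OF C uh h h0 hs, of x "\<lambda>k. Ys k x" "Y x"] that by (auto simp: Y_def)
  have odeY: "AE x in \<mu>. ode_sol ?h b x (Y x)"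
    using good by eventually_elim (rule conv)
  then have WY: "AE x in \<mu>. is_W (Y x)"
    by eventually_elim (simp add: ode_sol_def)
  have Wcut: "is_W (cutoff (real n) 1 y)" if "is_W y" for n and y :: "real \<Rightarrow> real^'n"
    using has_Wderiv_Wderiv[OF that] by (intro is_W_cutoff) auto
  have "strongly_meas \<mu> (\<lambda>x. cutoff (real n) 1 (Y x))" for n
  proof (rule strongly_meas_LIMSEQ[OF fin compl])
    show "strongly_meas \<mu> (\<lambda>x. cutoff (real n) 1 (Ys k x))" for k
      by (rule strongly_meas_cutoff[OF C(2) sm W]) auto
    show "AE x in \<mu>. is_W (cutoff (real n) 1 (Ys k x))" for k
      using W by eventually_elim (rule Wcut)
    show "AE x in \<mu>. is_W (cutoff (real n) 1 (Y x))"
      using WY by eventually_elim (rule Wcut)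
    show "AE x in \<mu>. (\<lambda>k. Wnorm (\<lambda>t. cutoff (real n) 1 (Ys k x) t - cutoff (real n) 1 (Y x) t)) \<longlonglongrightarrow> 0"
      using good by eventually_elim (rule conv, auto)
  qed
  then have smY: "strongly_meas \<mu> Y"
  proof (rule strongly_meas_LIMSEQ[OF fin compl])
    show "AE x in \<mu>. is_W (cutoff (real n) 1 (Y x))" for n
      using WY by eventually_elim (rule Wcut)
    show "AE x in \<mu>. (\<lambda>n. Wnorm (\<lambda>t. cutoff (real n) 1 (Y x) t - Y x t)) \<longlonglongrightarrow> 0"
      using WY by eventually_elim (rule cutoff_tendsto[OF C(2)])
  qed (rule WY)
  have ens: "ens_sol \<mu> f B b F Y"
    by (rule ode_sol_imp_ens_sol[OF C compl smY odeY h h0])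
  let ?J = "\<lambda>x. Jcost Q \<beta> (Y x) (\<lambda>t. F (Y x t))" and ?Js = "\<lambda>k x. Jcost Q \<beta> (Ys k x) (\<lambda>t. Fs k (Ys k x t))"
  \<comment> \<open>The Bochner integral of a nonintegrable function is 0 by convention, so
    integrability must be secured before \<open>jcost\<close> is rewritten as a nonnegative
    integral.\<close>
  have iJ: "integrable \<mu> ?J"
    by (rule integrable_Jcost[OF C fin compl smY odeY K F(2,3) \<beta>])
  have iJs: "integrable \<mu> (?Js k)" for k
  proof -
    obtain K where "K-lipschitz_on (cball 0 (C * b)) (Fs k)" using Fs(1) by blast
    from integrable_Jcost[OF C fin compl sm ode this Fs(2,3) \<beta>] show ?thesis .
  qed
  have "ennreal (jcost \<mu> Q \<beta> F Y) = (\<integral>\<^sup>+x. ennreal (?J x) \<partial>\<mu>)"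
    unfolding jcost_def using iJ by (intro nn_integral_eq_integral[symmetric]) (auto simp: Jcost_nonneg[OF \<beta>])
  also have "\<dots> \<le> (\<integral>\<^sup>+x. liminf (\<lambda>k. ennreal (?Js k x)) \<partial>\<mu>)"
  proof (rule nn_integral_mono_AE)
    show "AE x in \<mu>. ennreal (?J x) \<le> liminf (\<lambda>k. ennreal (?Js k x))"
      using good
    proof eventually_elim
      case (elim x)
      show ?case
        by (rule Jcost_le_liminf[OF C elim[rule_format] conv(2)[OF elim] conv(1)[OF elim] u K F(2) Fs(1,2) \<beta>])
    qed
  qed
  also have "\<dots> \<le> liminf (\<lambda>k. \<integral>\<^sup>+x. ennreal (?Js k x) \<partial>\<mu>)"
  proof (rule nn_integral_liminf)
    fix k
    have [measurable]: "?Js k \<in> borel_measurable \<mu>" using iJs by (rule borel_measurable_integrable)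
    show "(\<lambda>x. ennreal (?Js k x)) \<in> borel_measurable \<mu>" by measurable
  qed
  also have "(\<lambda>k. \<integral>\<^sup>+x. ennreal (?Js k x) \<partial>\<mu>) = (\<lambda>k. ennreal (jcost \<mu> Q \<beta> (Fs k) (Ys k)))"
    unfolding jcost_def using iJs by (intro ext nn_integral_eq_integral) (auto simp: Jcost_nonneg[OF \<beta>])
  finally show ?thesis using that[OF ens] by blast
qed

section \<open>Existence of a minimizer\<close>

theorem mainTheorem14:
  fixes Y0 :: "(real^'n) set" and \<mu> :: "(real^'n) measure"
    and f :: "real^'n \<Rightarrow> real^'n" and B :: "real^'m^'n" and Q :: "real^'n^'n"
    and \<beta> C\<^sub>\<i> M :: real
    and \<N> :: "(real^'n) set" and Fstar :: "real^'n \<Rightarrow> real^'m"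
    and ystar :: "real^'n \<Rightarrow> real \<Rightarrow> real^'n"
    and \<sigma> :: "real \<Rightarrow> real" and L :: nat and Ns :: "nat list"
    and \<eta>1 \<eta>2 \<alpha> :: real
  assumes beta: "\<beta> > 0" and Qpsd: "psd Q"
    and Ci: "C\<^sub>\<i> > 0" "\<And>y :: real \<Rightarrow> real^'n. is_W y \<Longrightarrow> \<forall>t\<ge>0. norm (y t) \<le> C\<^sub>\<i> * Wnorm y"
    \<comment> \<open>probability space\<close>
    and prob: "prob_space \<mu>" and compl: "complete_measure \<mu>" and spaceY0: "space \<mu> = Y0"
    \<comment> \<open>Standing Assumption 1\<close>
    and Y0: "compact Y0" "0 \<in> Y0"
    and A1: "f 0 = 0"
      "\<exists>Df. (\<forall>x. (f has_derivative Df x) (at x)) \<and>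
            (\<forall>K. compact K \<longrightarrow> (\<exists>Lc. \<forall>x\<in>K. \<forall>z\<in>K. onorm (\<lambda>h. Df x h - Df z h) \<le> Lc * dist x z))"
    and A2: "open \<N>" "Y0 \<subseteq> \<N>" "Fstar 0 = 0"
      "\<And>y0. y0 \<in> \<N> \<Longrightarrow> state_sol f B (\<lambda>t. Fstar (ystar y0 t)) y0 (ystar y0)"
      "\<And>y0 y. y0 \<in> \<N> \<Longrightarrow> state_sol f B (\<lambda>t. Fstar (y t)) y0 y \<Longrightarrow> \<forall>t\<ge>0. y t = ystar y0 t"
      "\<And>y0. y0 \<in> \<N> \<Longrightarrow> is_opt f B Q \<beta> y0 (ystar y0) (\<lambda>t. Fstar (ystar y0 t))"
    and A3: "\<exists>D :: real^'n \<Rightarrow> real^'n \<Rightarrow> real \<Rightarrow> real^'n.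
        (\<forall>y0\<in>\<N>. (\<forall>h. is_W (D y0 h)) \<and>
           (\<forall>a b h k t. D y0 (a *\<^sub>R h + b *\<^sub>R k) t = a *\<^sub>R D y0 h t + b *\<^sub>R D y0 k t) \<and>
           (\<forall>\<epsilon>>0. \<exists>\<delta>>0. \<forall>h. norm h < \<delta> \<and> y0 + h \<in> \<N> \<longrightarrow>
               Wnorm (\<lambda>t. ystar (y0 + h) t - ystar y0 t - D y0 h t) \<le> \<epsilon> * norm h) \<and>
           (\<forall>\<epsilon>>0. \<exists>\<delta>>0. \<forall>y1\<in>\<N>. dist y1 y0 < \<delta> \<longrightarrow>
               (\<forall>h. Wnorm (\<lambda>t. D y1 h t - D y0 h t) \<le> \<epsilon> * norm h)))"
      "M > 0" "\<And>y0. y0 \<in> \<N> \<Longrightarrow> Wnorm (ystar y0) \<le> M * norm y0"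
    and A4: "\<exists>DF. (\<forall>x\<in>cball 0 (2 * (C\<^sub>\<i> * (M * (SUP y0\<in>Y0. norm y0)))).
              (Fstar has_derivative DF x) (at x within cball 0 (2 * (C\<^sub>\<i> * (M * (SUP y0\<in>Y0. norm y0))))))
           \<and> (\<exists>K. \<forall>x\<in>cball 0 (2 * (C\<^sub>\<i> * (M * (SUP y0\<in>Y0. norm y0)))).
                   \<forall>z\<in>cball 0 (2 * (C\<^sub>\<i> * (M * (SUP y0\<in>Y0. norm y0)))).
                     onorm (\<lambda>h. DF x h - DF z h) \<le> K * dist x z)"
    \<comment> \<open>activation and architecture\<close>
    and sigma: "\<sigma> C1_differentiable_on UNIV"
    and L: "L \<ge> 2" "length Ns = L - 1" "\<forall>N\<in>set Ns. N > 0"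
    and eta: "\<eta>1 > 0" "\<eta>2 > 0" and alpha: "\<alpha> > 0"
    \<comment> \<open>at least one admissible pair\<close>
    and adm: "\<exists>\<theta>. in_Rad Ns \<eta>1 \<eta>2 \<theta> \<and>
               (\<exists>Y. ens_sol \<mu> f B (2 * (M * (SUP y0\<in>Y0. norm y0))) (Fnet \<sigma> Ns \<theta>) Y)"
  shows "\<exists>\<theta>s Ys. in_Rad Ns \<eta>1 \<eta>2 \<theta>s \<and>
           ens_sol \<mu> f B (2 * (M * (SUP y0\<in>Y0. norm y0))) (Fnet \<sigma> Ns \<theta>s) Ys \<and>
           (\<forall>\<theta> Y. in_R Ns \<theta> \<and> ens_sol \<mu> f B (2 * (M * (SUP y0\<in>Y0. norm y0))) (Fnet \<sigma> Ns \<theta>) Y \<longrightarrow>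
              ereal (jcost \<mu> Q \<beta> (Fnet \<sigma> Ns \<theta>s) Ys) + Greg Ns \<eta>1 \<eta>2 \<alpha> \<theta>s
                \<le> ereal (jcost \<mu> Q \<beta> (Fnet \<sigma> Ns \<theta>) Y) + Greg Ns \<eta>1 \<eta>2 \<alpha> \<theta>)"
proof -
  define b where "b = 2 * (M * (SUP y0\<in>Y0. norm y0))"
  let ?F = "Fnet \<sigma> Ns"
  let ?val = "\<lambda>\<theta> Y. jcost \<mu> Q \<beta> (?F \<theta>) Y + \<alpha> * weight_sq Ns \<theta>"
  interpret prob_space \<mu> by fact
  have \<beta>: "\<beta> \<ge> 0" using beta by simp
  obtain \<theta>0 Y1 where adm0: "in_Rad Ns \<eta>1 \<eta>2 \<theta>0" "ens_sol \<mu> f B b (?F \<theta>0) Y1"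
    using adm unfolding b_def by blast
  \<comment> \<open>Read off from the admissible pair: norms are nonnegative, and a condition that
    holds almost everywhere in a probability space cannot be unsatisfiable.\<close>
  have b0: "b \<ge> 0"
  proof (rule ccontr)
    assume "\<not> b \<ge> 0"
    have "AE x in \<mu>. is_W (Y1 x) \<and> Wnorm (Y1 x) \<le> b"
      using adm0(2) by (simp add: ens_sol_def)
    then have "AE x in \<mu>. False"
    proof eventually_elim
      case (elim x)
      then show ?case using \<open>\<not> b \<ge> 0\<close> Wnorm_nonneg[of "Y1 x"] by linarith
    qed
    then show False by simp
  qed
  have R: "C\<^sub>\<i> * b \<ge> 0" using b0 Ci(1) by simp
  obtain Kf where Kf: "Kf-lipschitz_on (cball 0 (C\<^sub>\<i> * b)) f"
  proof -
    obtain Df Lc where "\<And>x. (f has_derivative Df x) (at x)"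
      "\<forall>x\<in>cball 0 (C\<^sub>\<i> * b). \<forall>z\<in>cball 0 (C\<^sub>\<i> * b). onorm (\<lambda>h. Df x h - Df z h) \<le> Lc * dist x z"
      using A1(2) compact_cball by meson
    then show ?thesis
      using lipschitz_on_cball_if_deriv_lipschitz[of f Df "C\<^sub>\<i> * b" Lc] R that by blast
  qed
  have cs: "continuous_on UNIV \<sigma>"
    using sigma by (rule C1_differentiable_imp_continuous_on)
  have hd: "hd Ns > 0" using L by (cases Ns) auto
  \<comment> \<open>Parameters outside \<open>in_Rad\<close> have infinite cost, so the infimum can
    be taken over real values.\<close>
  define V where "V = {?val \<theta> Y | \<theta> Y. in_Rad Ns \<eta>1 \<eta>2 \<theta> \<and> ens_sol \<mu> f B b (?F \<theta>) Y}"
  have V: "V \<noteq> {}" "bdd_below V"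
  proof -
    show "V \<noteq> {}" using adm0 unfolding V_def by blast
    have "0 \<le> ?val \<theta> Y" for \<theta> :: "('n, 'm) netparam" and Y
      using alpha weight_sq_nonneg[of Ns \<theta>] jcost_nonneg[OF \<beta>, of \<mu> Q "?F \<theta>" Y] by simp
    then show "bdd_below V" unfolding V_def by (intro bdd_belowI[of _ 0]) auto
  qed
  define m where "m = Inf V"
  have "\<exists>\<theta> Y. in_Rad Ns \<eta>1 \<eta>2 \<theta> \<and> ens_sol \<mu> f B b (?F \<theta>) Y \<and> ?val \<theta> Y < m + inverse (real (Suc k))" for k
  proof -
    have "Inf V < m + inverse (real (Suc k))" by (simp add: m_def)
    then obtain v where "v \<in> V" "v < m + inverse (real (Suc k))"
      using cInf_lessD[OF V(1)] by blast
    then show ?thesis unfolding V_def by blast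
  qed
  then obtain \<theta>s Ys where ad: "\<And>k. in_Rad Ns \<eta>1 \<eta>2 (\<theta>s k)" and sol: "\<And>k. ens_sol \<mu> f B b (?F (\<theta>s k)) (Ys k)"
    and lt: "\<And>k. ?val (\<theta>s k) (Ys k) < m + inverse (real (Suc k))"
    by metis
  have ge: "m \<le> ?val \<theta> Y" if "in_Rad Ns \<eta>1 \<eta>2 \<theta>" "ens_sol \<mu> f B b (?F \<theta>) Y" for \<theta> Y
    unfolding m_def by (rule cInf_lower[OF _ V(2)]) (use that in \<open>auto simp: V_def\<close>)
  have lim: "(\<lambda>k. ?val (\<theta>s k) (Ys k)) \<longlonglongrightarrow> m"
  proof (rule tendsto_sandwich)
    show "eventually (\<lambda>k. m \<le> ?val (\<theta>s k) (Ys k)) sequentially" using ge ad sol by simp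
    show "eventually (\<lambda>k. ?val (\<theta>s k) (Ys k) \<le> m + inverse (real (Suc k))) sequentially"
      using lt by (simp add: less_imp_le)
    show "(\<lambda>k. m + inverse (real (Suc k))) \<longlonglongrightarrow> m"
      using LIMSEQ_inverse_real_of_nat_add by simp
  qed simp
  \<comment> \<open>Every term of the minimizing sequence has total value below
    \<open>m + 1\<close>, and its ensemble cost is nonnegative.\<close>
  have G: "weight_sq Ns (\<theta>s k) \<le> (m + 1) / \<alpha>" for k
  proof -
    have "inverse (real (Suc k)) \<le> 1" by (simp add: inverse_le_1_iff)
    then have "\<alpha> * weight_sq Ns (\<theta>s k) \<le> m + 1"
      using lt[of k] jcost_nonneg[OF \<beta>, of \<mu> Q "?F (\<theta>s k)" "Ys k"] by linarith
    then show ?thesis using alpha by (simp add: field_simps)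
  qed
  obtain r \<theta> where r: "strict_mono r" and \<theta>: "net_tendsto (\<lambda>k. \<theta>s (r k)) \<theta>" "in_Rad Ns \<eta>1 \<eta>2 \<theta>"
    by (rule net_convergent_subseq[OF ad G hd less_imp_le[OF eta(1)] less_imp_le[OF eta(2)]])
  have Fl: "\<exists>K. K-lipschitz_on (cball 0 (C\<^sub>\<i> * b)) (?F \<theta>')" for \<theta>' :: "('n, 'm) netparam"
    by (rule Fnet_lipschitz[OF sigma compact_cball])
  obtain Y where Y: "ens_sol \<mu> f B b (?F \<theta>) Y"
    "ennreal (jcost \<mu> Q \<beta> (?F \<theta>) Y) \<le> liminf (\<lambda>k. ennreal (jcost \<mu> Q \<beta> (?F (\<theta>s (r k))) (Ys (r k))))"
    by (rule ens_sol_limit[OF Ci finite_measure_axioms compl Kf A1(1) Fl Fnet_zero continuous_on_Fnet[OF cs]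
        Fl Fnet_zero continuous_on_Fnet[OF cs] Fnet_uniform_limit[OF sigma \<theta>(1) compact_cball] sol \<beta>])
  \<comment> \<open>The regularizer converges along the subsequence, so the ensemble costs alone
    converge as well and their limit inferior is identified.\<close>
  have "(\<lambda>k. ?val (\<theta>s (r k)) (Ys (r k)) - \<alpha> * weight_sq Ns (\<theta>s (r k))) \<longlonglongrightarrow> m - \<alpha> * weight_sq Ns \<theta>"
    using LIMSEQ_subseq_LIMSEQ[OF lim r] by (intro tendsto_intros weight_sq_tendsto \<theta>) (simp add: o_def)
  then have jl: "(\<lambda>k. jcost \<mu> Q \<beta> (?F (\<theta>s (r k))) (Ys (r k))) \<longlonglongrightarrow> m - \<alpha> * weight_sq Ns \<theta>"
    by simp
  \<comment> \<open>Guards the return to real numbers, since \<open>ennreal\<close> sends negative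
    reals to 0.\<close>
  then have nn: "0 \<le> m - \<alpha> * weight_sq Ns \<theta>"
    by (rule LIMSEQ_le_const) (use jcost_nonneg[OF \<beta>] in blast)
  have "ennreal (jcost \<mu> Q \<beta> (?F \<theta>) Y) \<le> ennreal (m - \<alpha> * weight_sq Ns \<theta>)"
    using Y(2) lim_imp_Liminf[OF sequentially_bot tendsto_ennrealI[OF jl]] by simp
  then have le: "?val \<theta> Y \<le> m"
    using nn by (simp add: ennreal_le_iff)
  have "ereal (jcost \<mu> Q \<beta> (?F \<theta>) Y) + Greg Ns \<eta>1 \<eta>2 \<alpha> \<theta> \<le> ereal (jcost \<mu> Q \<beta> (?F \<theta>') Y') + Greg Ns \<eta>1 \<eta>2 \<alpha> \<theta>'"
    if "ens_sol \<mu> f B b (?F \<theta>') Y'" for \<theta>' Y'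
  proof (cases "in_Rad Ns \<eta>1 \<eta>2 \<theta>'")
    case True
    then show ?thesis using le ge[OF True that] \<theta>(2) by (simp add: Greg_eq)
  next
    case False
    then show ?thesis by (simp add: Greg_def)
  qed
  then show ?thesis
    using \<theta>(2) Y(1) unfolding b_def by blast
qed

end
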